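(* Let $\mathbb{F}$ be a field with $\operatorname{char}\mathbb{F}\neq 2$, and let $n\ge 2$. Then $$\mathscr{P}(H_{2n}(\mathbb{F},\mathrm{sp}))=\left(H_{2n}(\mathbb{F},\mathrm{sp})\setminus\mathbb{F}I_{2n}\right)\cup\{0,I_{2n}\},$$ and $$1+\lceil\log_2 n\rceil\le w(H_{2n}(\mathbb{F},\mathrm{sp}))\le w(M_n(\mathbb{F})^+).$$ In particular, the maximum length $w(H_{2n}(\mathbb{F},\mathrm{sp}))$ grows logarithmically with $n$.
   Context: $M_n(\mathbb{F})^+$ is $M_n(\mathbb{F})$ with the Jordan product $X\circ Y=\frac12(XY+YX)$. Let $R_n=\begin{bmatrix}0&I_n\\-I_n&0\end{bmatrix}\in M_{2n}(\mathbb{F})$. The symplectic Hermitian algebra $H_{2n}(\mathbb{F},\mathrm{sp})=\{X\in M_{2n}(\mathbb{F}):X^tR_n=R_nX\}$ is a Jordan subalgebra of $M_{2n}(\mathbb{F})^+$ with unit $I_{2n}$. Idempotent words: let $\mathcal{J}$ be a unital Jordan algebra with product $\circ$. An idempotent is $e\in\mathcal{J}$ with $e\circ e=e$. An idempotent word of length $m\ge 1$ is a left-nested product $(\cdots((e_1\circ e_2)\circ e_3)\circ\cdots)\circ e_m$ with all $e_i$ idempotents of $\mathcal{J}$ (for $m=1$ it is $e_1$). $\mathscr{P}(\mathcal{J})$ is the set of all values of idempotent words. For $x\in\mathscr{P}(\mathcal{J})$, $\ell_{\mathcal{J}}(x)$ is the minimal length of an idempotent word with value $x$, and $w(\mathcal{J})=\sup_{x\in\mathscr{P}(\mathcal{J})}\ell_{\mathcal{J}}(x)$.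 "Grows logarithmically with $n$" means it is bounded below and above by positive constant multiples of $\log n$ for $n\ge2$. *)

theory Defs
  imports
    "Jordan_Normal_Form.Matrix"
    "HOL-Library.Extended_Real"
begin

text \<open>A Jordan algebra enters the notions below only through its carrier \<open>J\<close> and its
  product \<open>p\<close>.\<close>

definition idempotents :: "('x \<Rightarrow> 'x \<Rightarrow> 'x) \<Rightarrow> 'x set \<Rightarrow> 'x set" where
  "idempotents p J = {e \<in> J. p e e = e}"

text \<open>\<open>foldl p e es\<close> is the left-nested product of the nonempty word \<open>e # es\<close>.\<close>

definition is_word_value :: "('x \<Rightarrow> 'x \<Rightarrow> 'x) \<Rightarrow> 'x set \<Rightarrow> nat \<Rightarrow> 'x \<Rightarrow> bool" where
  "is_word_value p J m x \<longleftrightarrow>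
     (\<exists>e es. length (e # es) = m \<and> set (e # es) \<subseteq> idempotents p J \<and> x = foldl p e es)"

definition word_values :: "('x \<Rightarrow> 'x \<Rightarrow> 'x) \<Rightarrow> 'x set \<Rightarrow> 'x set" where
  "word_values p J = {x. \<exists>m. is_word_value p J m x}"

definition word_length :: "('x \<Rightarrow> 'x \<Rightarrow> 'x) \<Rightarrow> 'x set \<Rightarrow> 'x \<Rightarrow> nat" where
  "word_length p J x = (LEAST m. is_word_value p J m x)"

definition max_word_length :: "('x \<Rightarrow> 'x \<Rightarrow> 'x) \<Rightarrow> 'x set \<Rightarrow> enat" where
  "max_word_length p J = (SUP x\<in>word_values p J. enat (word_length p J x))"

definition jordan_prod :: "'a :: field mat \<Rightarrow> 'a mat \<Rightarrow> 'a mat" where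
  "jordan_prod X Y = (1 / 2) \<cdot>\<^sub>m (X * Y + Y * X)"

definition symp_R :: "nat \<Rightarrow> 'a :: field mat" where
  "symp_R n = four_block_mat (0\<^sub>m n n) (1\<^sub>m n) (- 1\<^sub>m n) (0\<^sub>m n n)"

text \<open>The parameter is half the matrix size: \<open>herm_sp n\<close> consists of \<open>2n \<times> 2n\<close> matrices.\<close>

definition herm_sp :: "nat \<Rightarrow> 'a :: field mat set" where
  "herm_sp n = {X \<in> carrier_mat (2 * n) (2 * n). X\<^sup>T * symp_R n = symp_R n * X}"

definition scalar_mats :: "nat \<Rightarrow> 'a :: field mat set" where
  "scalar_mats k = {c \<cdot>\<^sub>m 1\<^sub>m k | c. True}"

lemma symp_R_carrier: "symp_R n \<in> carrier_mat (2 * n) (2 * n)"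
  unfolding symp_R_def by (simp add: mult_2)

lemma herm_sp_one: "(1\<^sub>m (2 * n) :: 'a :: field mat) \<in> herm_sp n"
  using left_mult_one_mat[OF symp_R_carrier[where 'a = 'a]]
    right_mult_one_mat[OF symp_R_carrier[where 'a = 'a]]
  by (simp add: herm_sp_def)

lemma herm_sp_jordan_prod:
  assumes "X \<in> herm_sp n" and "Y \<in> herm_sp n"
  shows "jordan_prod X Y \<in> herm_sp n"
proof -
  define R :: "'a mat" where "R = symp_R n"
  have X: "X \<in> carrier_mat (2*n) (2*n)" "X\<^sup>T * R = R * X"
    and Y: "Y \<in> carrier_mat (2*n) (2*n)" "Y\<^sup>T * R = R * Y"
    using assms by (auto simp: herm_sp_def R_def)
  have R: "R \<in> carrier_mat (2*n) (2*n)" by (simp add: R_def symp_R_carrier)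
  have aux: "(A * B)\<^sup>T * R = R * (B * A)"
    if "A \<in> carrier_mat (2*n) (2*n)" "A\<^sup>T * R = R * A"
      "B \<in> carrier_mat (2*n) (2*n)" "B\<^sup>T * R = R * B" for A B :: "'a mat"
  proof -
    have "(A * B)\<^sup>T * R = B\<^sup>T * (A\<^sup>T * R)"
      using that R by (simp add: transpose_mult[of _ _ "2*n"] assoc_mult_mat[of _ "2*n" "2*n" _ "2*n" _ "2*n"])
    also have "\<dots> = B\<^sup>T * R * A"
      unfolding that(2) using that(1,3) R
      by (subst assoc_mult_mat[of _ "2*n" "2*n" _ "2*n" _ "2*n"]) auto
    also have "\<dots> = R * (B * A)"
      unfolding that(4) using that(1,3) R by (simp add: assoc_mult_mat[of _ "2*n" "2*n" _ "2*n" _ "2*n"])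
    finally show ?thesis .
  qed
  have XY: "X * Y \<in> carrier_mat (2*n) (2*n)" "Y * X \<in> carrier_mat (2*n) (2*n)"
    using X Y by auto
  have "(X * Y + Y * X)\<^sup>T * R = (X * Y)\<^sup>T * R + (Y * X)\<^sup>T * R"
    using XY R by (simp add: transpose_add[of _ "2*n" "2*n"] add_mult_distrib_mat[of _ "2*n" "2*n" _ _ "2*n"])
  also have "\<dots> = R * (Y * X) + R * (X * Y)"
    using aux[OF X Y] aux[OF Y X] by simp
  also have "\<dots> = R * (X * Y + Y * X)"
    using XY R by (simp add: mult_add_distrib_mat[of _ "2*n" "2*n" _ "2*n"] comm_add_mat[of _ "2*n" "2*n"])
  finally have eq: "(X * Y + Y * X)\<^sup>T * R = R * (X * Y + Y * X)" .
  have tr: "(c \<cdot>\<^sub>m A)\<^sup>T = c \<cdot>\<^sub>m A\<^sup>T" for c :: 'a and A by (rule eq_matI) auto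
  have "(jordan_prod X Y)\<^sup>T * R = R * jordan_prod X Y"
    unfolding jordan_prod_def tr using XY R eq
    by (simp add: mult_smult_distrib[of _ "2*n" "2*n" _ "2*n"] mult_smult_assoc_mat[of _ "2*n" "2*n" _ "2*n"])
  then show ?thesis
    using XY by (auto simp: herm_sp_def R_def jordan_prod_def)
qed

end

theory Submission
  imports Defs "Jordan_Normal_Form.Determinant"
begin

text \<open>Words are examined from the last letter backwards: if \<open>f\<close> is
  an idempotent matrix with \<open>f x f = 0\<close>, then \<open>x = y \<circ> (1 - f)\<close> for every
  \<open>y = x + x f + f x + f d f\<close>, whatever \<open>d\<close> is (\<open>word_from_step\<close>). So \<open>x\<close> is a word as soon as
  \<open>y\<close> is one, at the price of one letter, and \<open>d\<close> can be chosen.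

  \<^bold>\<open>Nonscalar matrices are short words.\<close> On block matrices \<open>[[a, 1], [b, 0]]\<close> the backward step
  is, up to similarity, \<open>(a, b) \<mapsto> (a + d, 4 b - d a)\<close>, and four such steps lead from any pair to
  \<open>(1, \<beta>)\<close> with a prescribed scalar \<open>\<beta>\<close> (\<open>companion_block_to_scalar\<close>); for \<open>\<beta> = 0\<close> this
  is an idempotent. For an arbitrary \<open>A\<close>, choose \<open>W\<close> of maximal dimension with \<open>W\<close> and \<open>A W\<close>
  independent. By maximality the corner of \<open>A\<close> on a complement of \<open>W + A W\<close> is a scalar matrix
  \<open>\<lambda> 1\<^sub>p\<close> (\<open>similar_scalar_corner\<close>), while its corner on \<open>W + A W\<close> is a block as above. A bounded
  number of steps turns \<open>A\<close> into the direct sum of an idempotent and \<open>\<lambda> 1\<^sub>p\<close>. If \<open>\<lambda>\<close> is 0 or 1 this is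
  idempotent. Otherwise an idempotent of size \<open>q\<close> plus \<open>\<lambda> 1\<^sub>q\<close> is again similar to a block
  \<open>[[a, 1], [b, 0]]\<close>, so four steps turn it into an idempotent of size \<open>2 q\<close>. The
  idempotent part doubles each time, whence a length logarithmic in \<open>n\<close>
  (\<open>word_value_nonscalar\<close>).

  \<^bold>\<open>The symplectic algebra is governed by \<open>M\<^sub>n\<close>.\<close> Every \<open>X\<close> in \<open>herm_sp n\<close> is
  \<open>T diag(A, A\<^sup>T) T\<^sup>-\<^sup>1\<close> with \<open>T\<close> symplectic (\<open>herm_sp_block_form\<close>), because cyclic subspaces
  of a self-adjoint operator are isotropic, and two maximal ones can be put in duality and split off.
  Since \<open>M \<mapsto> T diag(M, M\<^sup>T) T\<^sup>-\<^sup>1\<close> is a Jordan homomorphism into \<open>herm_sp n\<close>, each word for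
  \<open>A\<close> becomes a word of the same length for \<open>X\<close>.

  \<^bold>\<open>Ranks bound the length from below.\<close> Let \<open>\<lambda> \<noteq> 0\<close>. Undoing a multiplication by an idempotent at most
  doubles the rank of \<open>x - \<lambda>\<close> (\<open>rank_at_most_undo_mult\<close>), while \<open>e - \<lambda>\<close> is
  invertible for an idempotent \<open>e\<close> and \<open>\<lambda> \<noteq> 1\<close>. With rank 0 this excludes the scalars other than 0 and 1;
  with \<open>\<lambda> = -1\<close> and an element of \<open>herm_sp n\<close> for which the rank is 2, it gives
  \<open>2 n \<le> 2 \<cdot> 2\<^sup>m\<^sup>-\<^sup>1\<close>.\<close>

section \<open>Idempotent words\<close>

lemma two_neq_zero:
  assumes "CHAR('a :: field) \<noteq> 2"
  shows "(2 :: 'a) \<noteq> 0"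
proof
  assume "(2 :: 'a) = 0"
  then have "of_nat 2 = (0 :: 'a)" by simp
  then have d: "CHAR('a) dvd 2" by (simp only: of_nat_eq_0_iff_char_dvd)
  then have "CHAR('a) \<le> 2" by (rule dvd_imp_le) simp
  moreover have "CHAR('a) \<noteq> 0" using d by (intro notI) simp
  moreover have "CHAR('a) \<noteq> 1"
    using of_nat_CHAR[where 'a = 'a] by (intro notI) simp
  ultimately show False using assms by linarith
qed

lemma four_neq_zero: "(2 :: 'a :: field) \<noteq> 0 \<Longrightarrow> (4 :: 'a) \<noteq> 0"
  by (metis mult_2 mult_eq_0_iff numeral_Bit0)

lemma is_word_value_idempotent: "e \<in> idempotents p J \<Longrightarrow> is_word_value p J 1 e"
  by (auto simp: is_word_value_def intro!: exI[of _ e] exI[of _ "[]"])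

lemma is_word_value_mult:
  assumes "is_word_value p J m x" "e \<in> idempotents p J"
  shows "is_word_value p J (Suc m) (p x e)"
proof -
  obtain f fs where "length (f # fs) = m" "set (f # fs) \<subseteq> idempotents p J" "x = foldl p f fs"
    using assms(1) by (auto simp: is_word_value_def)
  then show ?thesis
    unfolding is_word_value_def using assms(2)
    by (intro exI[of _ f] exI[of _ "fs @ [e]"]) auto
qed

text \<open>A letter may be repeated at the front, because an idempotent satisfies \<open>e \<circ> e = e\<close>.\<close>

lemma is_word_value_mono:
  assumes "is_word_value p J m x" "m \<le> l"
  shows "is_word_value p J l x"
proof -
  have "is_word_value p J (Suc m) x" if m: "is_word_value p J m x" for m
  proof -
    obtain f fs where "length (f # fs) = m" "set (f # fs) \<subseteq> idempotents p J" "x = foldl p f fs"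
      using m by (auto simp: is_word_value_def)
    then show ?thesis
      unfolding is_word_value_def
      by (intro exI[of _ f] exI[of _ "f # fs"]) (auto simp: idempotents_def)
  qed
  then show ?thesis using assms(1) by (induction rule: dec_induct[OF assms(2)]) auto
qed

lemma is_word_value_hom:
  assumes "is_word_value p J m x"
    and J: "\<And>a b. a \<in> J \<Longrightarrow> b \<in> J \<Longrightarrow> p a b \<in> J"
    and h: "\<And>a. a \<in> J \<Longrightarrow> h a \<in> J'" "\<And>a b. a \<in> J \<Longrightarrow> b \<in> J \<Longrightarrow> h (p a b) = q (h a) (h b)"
  shows "is_word_value q J' m (h x)"
proof -
  obtain e es where e: "length (e # es) = m" "set (e # es) \<subseteq> idempotents p J" "x = foldl p e es"
    using assms(1) by (auto simp: is_word_value_def)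
  have "h (foldl p e es) = foldl q (h e) (map h es) \<and> foldl p e es \<in> J"
    if "e \<in> J" "set es \<subseteq> J" for e es
    using that by (induction es arbitrary: e) (auto simp: h J)
  moreover have "set (e # es) \<subseteq> J" using e(2) by (auto simp: idempotents_def)
  moreover have "h a \<in> idempotents q J'" if "a \<in> idempotents p J" for a
    using that h(1)[of a] h(2)[of a a] by (auto simp: idempotents_def)
  ultimately show ?thesis
    unfolding is_word_value_def using e
    by (intro exI[of _ "h e"] exI[of _ "map h es"]) auto
qed

lemma word_value_carrier:
  assumes "is_word_value p J m x" "\<And>a b. a \<in> J \<Longrightarrow> b \<in> J \<Longrightarrow> p a b \<in> J"
  shows "x \<in> J"
proof -
  obtain e es where e: "set (e # es) \<subseteq> idempotents p J" "x = foldl p e es"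
    using assms(1) by (auto simp: is_word_value_def)
  have "foldl p e es \<in> J" if "e \<in> J" "set es \<subseteq> J" for e es
    using that by (induction es arbitrary: e) (auto simp: assms(2))
  then show ?thesis using e by (force simp: idempotents_def)
qed

lemma is_word_value_pos: "is_word_value p J m x \<Longrightarrow> 1 \<le> m"
  by (auto simp: is_word_value_def)

lemma word_length_le: "is_word_value p J m x \<Longrightarrow> word_length p J x \<le> m"
  unfolding word_length_def by (rule Least_le)

lemma word_value_word_length:
  "x \<in> word_values p J \<Longrightarrow> is_word_value p J (word_length p J x) x"
  unfolding word_length_def word_values_def by (auto intro: LeastI)

section \<open>Matrix arithmetic\<close>

text \<open>Most matrices below are rectangular blocks. The ring laws are restated with equations between
  dimensions as side conditions, so that the simplifier can discharge them; together they bring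
  an expression into a sum of scaled monomials, which is then compared entry by entry. The rules with carriers
  leave the simpset, because their premises mention dimensions that a goal does not determine.\<close>

declare assoc_mult_mat [simp del] carrier_matD [simp del]

lemma mm_assoc: "dim_col A = dim_row B \<Longrightarrow> dim_col B = dim_row C \<Longrightarrow> A * B * C = A * (B * (C :: 'a :: field mat))"
  by (rule assoc_mult_mat[of _ "dim_row A" "dim_col A" _ "dim_col B" _ "dim_col C"]) auto

lemma mm_add_mult:
  "dim_row A = dim_row B \<Longrightarrow> dim_col A = dim_col B \<Longrightarrow> dim_col B = dim_row C
    \<Longrightarrow> (A + B) * C = A * C + B * (C :: 'a :: field mat)"
  by (rule add_mult_distrib_mat[of _ "dim_row A" "dim_col A" _ _ "dim_col C"]) auto

lemma mm_mult_add:
  "dim_row B = dim_row C \<Longrightarrow> dim_col B = dim_col C \<Longrightarrow> dim_col A = dim_row B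
    \<Longrightarrow> A * (B + C) = A * B + A * (C :: 'a :: field mat)"
  by (rule mult_add_distrib_mat[of _ "dim_row A" "dim_col A" _ "dim_col C"]) auto

lemma mm_smult_mult: "dim_col A = dim_row B \<Longrightarrow> (k \<cdot>\<^sub>m A) * B = k \<cdot>\<^sub>m (A * (B :: 'a :: field mat))"
  by (rule mult_smult_assoc_mat[of _ "dim_row A" "dim_col A" _ "dim_col B"]) auto

lemma mm_mult_smult: "dim_col A = dim_row B \<Longrightarrow> A * (k \<cdot>\<^sub>m B) = k \<cdot>\<^sub>m (A * (B :: 'a :: field mat))"
  by (rule mult_smult_distrib[of _ "dim_row A" "dim_col A" _ "dim_col B"]) auto

lemma mm_smult_add: "dim_row A = dim_row B \<Longrightarrow> dim_col A = dim_col B \<Longrightarrow>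
    k \<cdot>\<^sub>m (A + B) = k \<cdot>\<^sub>m A + k \<cdot>\<^sub>m (B :: 'a :: field mat)"
  by (rule eq_matI) (simp_all add: distrib_left mult.assoc)

lemma mm_smult_smult: "k \<cdot>\<^sub>m (l \<cdot>\<^sub>m A) = (k * l) \<cdot>\<^sub>m (A :: 'a :: field mat)"
  by (rule eq_matI) (simp_all add: distrib_left mult.assoc)

lemma mm_one: "dim_row A = n \<Longrightarrow> 1\<^sub>m n * A = (A :: 'a :: field mat)"
    "dim_col A = n \<Longrightarrow> A * 1\<^sub>m n = (A :: 'a :: field mat)"
  by auto

lemma mm_zero: "dim_row A = n \<Longrightarrow> 0\<^sub>m k n * A = (0\<^sub>m k (dim_col A) :: 'a :: field mat)"
    "dim_col A = n \<Longrightarrow> A * 0\<^sub>m n k = (0\<^sub>m (dim_row A) k :: 'a :: field mat)"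
  by auto

lemmas mm_simps = carrier_mat_def mm_assoc mm_add_mult mm_mult_add mm_smult_mult mm_mult_smult mm_smult_add
  mm_smult_smult mm_one mm_zero

lemma similar_by:
  assumes "A \<in> carrier_mat n n" "B \<in> carrier_mat n n" "T \<in> carrier_mat n n" "S \<in> carrier_mat n n"
    and "T * S = 1\<^sub>m n" and "A * T = T * (B :: 'a :: field mat)"
  shows "similar_mat A B"
proof -
  have ST: "S * T = 1\<^sub>m n" using mat_mult_left_right_inverse[OF assms(3,4,5)] .
  have "T * B * S = A * (T * S)"
    unfolding assms(6)[symmetric] using assms(1,3,4) by (intro mm_assoc) (auto simp: carrier_mat_def)
  then have "A = T * B * S" using assms(1,5) by (simp add: mm_simps)
  then show ?thesis using assms ST by (intro similar_matI[of _ _ T S n]) auto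
qed

lemma similar_mat_carrier: "similar_mat x z \<Longrightarrow> z \<in> carrier_mat n n \<Longrightarrow> x \<in> carrier_mat n n"
  by (auto dest!: similar_matD)

lemma jordan_prod_carrier: "x \<in> carrier_mat n n \<Longrightarrow> y \<in> carrier_mat n n \<Longrightarrow> jordan_prod x y \<in> carrier_mat n n"
  by (auto simp: jordan_prod_def)

lemma jordan_prod_idempotent:
  assumes "(2 :: 'a) \<noteq> 0"
  shows "jordan_prod e e = e * (e :: 'a :: field mat)"
  using assms by (intro eq_matI) (auto simp: jordan_prod_def field_simps simp del: index_mult_mat(1))

lemma idempotents_carrier_iff:
  assumes "(2 :: 'a) \<noteq> 0"
  shows "e \<in> idempotents jordan_prod (carrier_mat n n) \<longleftrightarrow> e \<in> carrier_mat n n \<and> e * e = (e :: 'a :: field mat)"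
  using jordan_prod_idempotent[OF assms] by (auto simp: idempotents_def)

lemma is_word_value_idem:
  assumes "(2 :: 'a :: field) \<noteq> 0" "e \<in> carrier_mat n n" "e * e = (e :: 'a mat)"
  shows "is_word_value jordan_prod (carrier_mat n n) 1 e"
  using assms by (intro is_word_value_idempotent) (simp add: idempotents_carrier_iff)

lemma jordan_prod_conj:
  assumes "x \<in> carrier_mat n n" "y \<in> carrier_mat n n" "P \<in> carrier_mat n n" "Q \<in> carrier_mat n n"
    "Q * P = 1\<^sub>m n"
  shows "jordan_prod (P * x * Q) (P * y * Q) = P * jordan_prod x y * (Q :: 'a :: field mat)"
proof -
  have 1: "Q * (P * z) = z" if "dim_row z = n" for z
    using assms(5) mm_assoc[of Q P z] assms(3,4) that by (simp add: carrier_mat_def)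
  show ?thesis
    unfolding jordan_prod_def using assms by (simp add: mm_simps 1)
qed

lemma is_word_value_similar:
  assumes "similar_mat x z" "is_word_value jordan_prod (carrier_mat n n) m z" "z \<in> carrier_mat n n"
  shows "is_word_value jordan_prod (carrier_mat n n) m (x :: 'a :: field mat)"
proof -
  obtain P Q where PQ: "{x,z,P,Q} \<subseteq> carrier_mat n n" "P * Q = 1\<^sub>m n" "Q * P = 1\<^sub>m n" "x = P * z * Q"
    using similar_matD[OF assms(1)] assms(3) by (force simp: carrier_mat_def)
  then have "P * a * Q \<in> carrier_mat n n" if "a \<in> carrier_mat n n" for a
    by (simp add: carrier_mat_def)
  then show ?thesis
    using is_word_value_hom[OF assms(2), of "\<lambda>y. P * y * Q" "carrier_mat n n" jordan_prod] PQ
    by (simp add: jordan_prod_conj jordan_prod_carrier)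
qed

section \<open>Block matrices\<close>

lemma fb_mult:
  fixes A1 :: "'a :: field mat"
  assumes "dim_row B1 = dim_row A1" "dim_col C1 = dim_col A1" "dim_row D1 = dim_row C1" "dim_col D1 = dim_col B1"
    "dim_row A2 = dim_col A1" "dim_row B2 = dim_row A2" "dim_col C2 = dim_col A2" "dim_row C2 = dim_col B1"
    "dim_row D2 = dim_row C2" "dim_col D2 = dim_col B2"
  shows "four_block_mat A1 B1 C1 D1 * four_block_mat A2 B2 C2 D2
    = four_block_mat (A1 * A2 + B1 * C2) (A1 * B2 + B1 * D2) (C1 * A2 + D1 * C2) (C1 * B2 + D1 * D2)"
  using assms
  by (intro mult_four_block_mat[of _ "dim_row A1" "dim_col A1" _ "dim_col B1" _ "dim_row C1" _ _ "dim_col A2" _ "dim_col B2"])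
    (auto simp: carrier_mat_def)

lemma fb_add:
  fixes A1 :: "'a :: field mat"
  assumes "dim_row B1 = dim_row A1" "dim_col C1 = dim_col A1" "dim_row D1 = dim_row C1" "dim_col D1 = dim_col B1"
    "dim_row A2 = dim_row A1" "dim_col A2 = dim_col A1" "dim_row B2 = dim_row A1" "dim_col B2 = dim_col B1"
    "dim_row C2 = dim_row C1" "dim_col C2 = dim_col A1" "dim_row D2 = dim_row C1" "dim_col D2 = dim_col B1"
  shows "four_block_mat A1 B1 C1 D1 + four_block_mat A2 B2 C2 D2
    = four_block_mat (A1 + A2) (B1 + B2) (C1 + C2) (D1 + D2)"
  using assms
  by (intro add_four_block_mat[of _ "dim_row A1" "dim_col A1" _ "dim_col B1" _ "dim_row C1"]) (auto simp: carrier_mat_def)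

lemma fb_smult:
  fixes A1 :: "'a :: field mat"
  assumes "dim_row B1 = dim_row A1" "dim_col C1 = dim_col A1" "dim_row D1 = dim_row C1" "dim_col D1 = dim_col B1"
  shows "k \<cdot>\<^sub>m four_block_mat A1 B1 C1 D1 = four_block_mat (k \<cdot>\<^sub>m A1) (k \<cdot>\<^sub>m B1) (k \<cdot>\<^sub>m C1) (k \<cdot>\<^sub>m D1)"
  using assms
  by (intro smult_four_block_mat[of _ "dim_row A1" "dim_col A1" _ "dim_col B1" _ "dim_row C1"]) (auto simp: carrier_mat_def)

lemma fb_one: "1\<^sub>m (n + m) = four_block_mat (1\<^sub>m n) (0\<^sub>m n m) (0\<^sub>m m n) (1\<^sub>m m)"
  by simp

lemma fb_zero: "0\<^sub>m (n + m) (k + l) = four_block_mat (0\<^sub>m n k) (0\<^sub>m n l) (0\<^sub>m m k) (0\<^sub>m m l)"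
  by (rule four_block_zero_mat[symmetric])

lemma smult_zero_mat: "k \<cdot>\<^sub>m 0\<^sub>m n m = (0\<^sub>m n m :: 'a :: field mat)"
  by (rule eq_matI) auto

lemmas block_simps = fb_mult fb_add fb_smult mm_simps smult_zero_mat

lemma fb_empty: "dim_row D = 0 \<Longrightarrow> dim_col D = 0 \<Longrightarrow> four_block_mat A B C D = A"
  by (rule eq_matI) auto

lemma fb_inject:
  assumes "four_block_mat A B C D = four_block_mat A' B' C' D'"
    and "dim_row A = dim_row A'" "dim_col A = dim_col A'" "dim_row D = dim_row D'" "dim_col D = dim_col D'"
    and "dim_row B = dim_row A" "dim_col B = dim_col D" "dim_row C = dim_row D" "dim_col C = dim_col A"
    and "dim_row B' = dim_row A" "dim_col B' = dim_col D" "dim_row C' = dim_row D" "dim_col C' = dim_col A"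
  shows "A = A' \<and> B = B' \<and> C = C' \<and> D = D'"
proof -
  let ?r = "dim_row A" and ?c = "dim_col A"
  have e: "four_block_mat A B C D $$ (i, j) = four_block_mat A' B' C' D' $$ (i, j)" for i j
    using assms(1) by simp
  have "A $$ (i, j) = A' $$ (i, j)" if "i < dim_row A'" "j < dim_col A'" for i j
    using e[of i j] that assms(2-) by simp
  moreover have "B $$ (i, j) = B' $$ (i, j)" if "i < dim_row A'" "j < dim_col D'" for i j
    using e[of i "?c + j"] that assms(2-) by simp
  moreover have "C $$ (i, j) = C' $$ (i, j)" if "i < dim_row D'" "j < dim_col A'" for i j
    using e[of "?r + i" j] that assms(2-) by simp
  moreover have "D $$ (i, j) = D' $$ (i, j)" if "i < dim_row D'" "j < dim_col D'" for i j
    using e[of "?r + i" "?c + j"] that assms(2-) by simp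
  ultimately show ?thesis using assms(2-) by (auto intro!: eq_matI)
qed

lemma fb_ex:
  fixes A :: "'a :: field mat"
  assumes "A \<in> carrier_mat (a + b) (c + d)"
  shows "\<exists>P Q R S. A = four_block_mat P Q R S \<and> P \<in> carrier_mat a c \<and> Q \<in> carrier_mat a d
    \<and> R \<in> carrier_mat b c \<and> S \<in> carrier_mat b d"
  using assms
  by (intro exI[of _ "mat a c (\<lambda>(i, j). A $$ (i, j))"] exI[of _ "mat a d (\<lambda>(i, j). A $$ (i, j + c))"]
      exI[of _ "mat b c (\<lambda>(i, j). A $$ (i + a, j))"] exI[of _ "mat b d (\<lambda>(i, j). A $$ (i + a, j + c))"])
    (auto intro!: eq_matI simp: carrier_mat_def)

text \<open>Juxtaposition and stacking are four-block matrices with an empty block row or column, so the block multiplication rule covers them too.\<close>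

abbreviation hcat :: "'a :: field mat \<Rightarrow> 'a mat \<Rightarrow> 'a mat" where
  "hcat A B \<equiv> four_block_mat A B (0\<^sub>m 0 (dim_col A)) (0\<^sub>m 0 (dim_col B))"

abbreviation vcat :: "'a :: field mat \<Rightarrow> 'a mat \<Rightarrow> 'a mat" where
  "vcat A B \<equiv> four_block_mat A (0\<^sub>m (dim_row A) 0) B (0\<^sub>m (dim_row B) 0)"

lemma vcat_ex:
  fixes A :: "'a :: field mat"
  assumes "A \<in> carrier_mat (a + b) c"
  shows "\<exists>P Q. A = vcat P Q \<and> P \<in> carrier_mat a c \<and> Q \<in> carrier_mat b c"
  using assms
  by (intro exI[of _ "mat a c (\<lambda>(i, j). A $$ (i, j))"] exI[of _ "mat b c (\<lambda>(i, j). A $$ (i + a, j))"])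
    (auto intro!: eq_matI simp: carrier_mat_def)

lemma hcat_vcat:
  assumes "dim_row B = dim_row A" "dim_row C = dim_col A" "dim_row D = dim_col B" "dim_col D = dim_col C"
  shows "hcat A B * vcat C D = A * C + B * D"
  using assms by (simp add: block_simps fb_empty)

lemma vcat_hcat:
  assumes "dim_col B = dim_col A" "dim_row C = dim_col A" "dim_row D = dim_row C"
  shows "vcat A B * hcat C D = four_block_mat (A * C) (A * D) (B * C) (B * D)"
proof -
  have "A * C + 0\<^sub>m (dim_row A) (dim_col C) = A * C" "A * D + 0\<^sub>m (dim_row A) (dim_col D) = A * D"
    "B * C + 0\<^sub>m (dim_row B) (dim_col C) = B * C" "B * D + 0\<^sub>m (dim_row B) (dim_col D) = B * D"
    by (auto intro!: right_add_zero_mat simp: carrier_mat_def)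
  then show ?thesis using assms by (simp add: block_simps)
qed

lemma mult_hcat:
  assumes "dim_row A = dim_col M" "dim_row B = dim_col M"
  shows "M * hcat A B = hcat (M * A) (M * B)"
proof -
  have "M * hcat A B = vcat M (0\<^sub>m 0 (dim_col M)) * hcat A B"
    by (simp add: fb_empty)
  also have "\<dots> = hcat (M * A) (M * B)"
    using assms by (subst vcat_hcat) (auto simp: mm_zero)
  finally show ?thesis .
qed

lemma vcat_mult:
  assumes "dim_row M = dim_col A" "dim_col B = dim_col A"
  shows "vcat A B * M = vcat (A * M) (B * M)"
proof -
  have "vcat A B * M = vcat A B * hcat M (0\<^sub>m (dim_row M) 0)"
    by (simp add: fb_empty)
  also have "\<dots> = vcat (A * M) (B * M)"
    using assms by (subst vcat_hcat) (auto simp: mm_zero)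
  finally show ?thesis .
qed

lemma hcat_fb:
  assumes "dim_row B = dim_row A" "dim_row a = dim_col A" "dim_row b = dim_row a" "dim_row c = dim_col B"
    "dim_row d = dim_row c" "dim_col c = dim_col a" "dim_col d = dim_col b"
  shows "hcat A B * four_block_mat a b c d = hcat (A * a + B * c) (A * b + B * d)"
  using assms by (simp add: block_simps)

lemma hcat_assoc:
  assumes "dim_row B = dim_row A" "dim_row C = dim_row A"
  shows "hcat A (hcat B C) = hcat (hcat A B) C"
  using assms by (intro eq_matI) auto

lemma transpose_hcat:
  assumes "dim_row B = dim_row A"
  shows "(hcat A B)\<^sup>T = vcat (A\<^sup>T) (B\<^sup>T)"
  using assms by (intro eq_matI) auto

lemma similar_swap:
  fixes A :: "'a :: field mat"
  assumes c: "A \<in> carrier_mat p p" "B \<in> carrier_mat q q"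
  shows "similar_mat (four_block_mat A (0\<^sub>m p q) (0\<^sub>m q p) B) (four_block_mat B (0\<^sub>m q p) (0\<^sub>m p q) A)"
proof (rule similar_by[where n = "p + q" and T = "four_block_mat (0\<^sub>m p q) (1\<^sub>m p) (1\<^sub>m q) (0\<^sub>m q p)"
          and S = "four_block_mat (0\<^sub>m q p) (1\<^sub>m q) (1\<^sub>m p) (0\<^sub>m p q)"])
  show "four_block_mat (0\<^sub>m p q) (1\<^sub>m p) (1\<^sub>m q) (0\<^sub>m q p) * four_block_mat (0\<^sub>m q p) (1\<^sub>m q) (1\<^sub>m p) (0\<^sub>m p q)
      = (1\<^sub>m (p + q) :: 'a mat)"
    unfolding fb_one by (simp add: block_simps del: four_block_one_mat)
  show "four_block_mat A (0\<^sub>m p q) (0\<^sub>m q p) B * four_block_mat (0\<^sub>m p q) (1\<^sub>m p) (1\<^sub>m q) (0\<^sub>m q p) =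
    four_block_mat (0\<^sub>m p q) (1\<^sub>m p) (1\<^sub>m q) (0\<^sub>m q p) * four_block_mat B (0\<^sub>m q p) (0\<^sub>m p q) A"
    using c by (simp add: block_simps)
qed (use c in \<open>auto simp: carrier_mat_def\<close>)

lemma direct_sum_assoc:
  assumes "A \<in> carrier_mat a a" "B \<in> carrier_mat b b" "C \<in> carrier_mat c c"
  shows "four_block_mat (four_block_mat A (0\<^sub>m a b) (0\<^sub>m b a) B) (0\<^sub>m (a + b) c) (0\<^sub>m c (a + b)) C
    = four_block_mat A (0\<^sub>m a (b + c)) (0\<^sub>m (b + c) a) (four_block_mat B (0\<^sub>m b c) (0\<^sub>m c b) C)"
  using assoc_four_block_mat[of A B C] assms by (simp add: carrier_mat_def)

definition unit_col :: "nat \<Rightarrow> nat \<Rightarrow> 'a :: field mat" where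
  "unit_col n j = mat n 1 (\<lambda>(i, _). if i = j then 1 else 0)"

lemma unit_col_carrier [simp]: "unit_col n j \<in> carrier_mat n 1" "dim_row (unit_col n j) = n" "dim_col (unit_col n j) = 1"
  by (auto simp: unit_col_def)

lemma mult_unit_col_index:
  assumes "i < dim_row A" "j < dim_col A"
  shows "(A * unit_col (dim_col A) j) $$ (i, 0) = A $$ (i, j)"
proof -
  have "(A * unit_col (dim_col A) j) $$ (i, 0) = (\<Sum>k<dim_col A. A $$ (i, k) * (if k = j then 1 else 0))"
    using assms by (simp add: unit_col_def scalar_prod_def atLeast0LessThan)
  also have "\<dots> = A $$ (i, j)" using assms by (simp add: if_distrib sum.delta cong: if_cong)
  finally show ?thesis .
qed

lemma unit_row_mult_index:
  assumes "i < dim_row A" "j < dim_col A"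
  shows "((unit_col (dim_row A) i)\<^sup>T * A) $$ (0, j) = A $$ (i, j)"
proof -
  have "((unit_col (dim_row A) i)\<^sup>T * A) $$ (0, j) = (\<Sum>k<dim_row A. (if k = i then 1 else 0) * A $$ (k, j))"
    using assms by (simp add: unit_col_def scalar_prod_def atLeast0LessThan)
  also have "\<dots> = A $$ (i, j)" using assms by (simp add: if_distrib[of "\<lambda>x. x * _"] sum.delta cong: if_cong)
  finally show ?thesis .
qed

section \<open>Rank and left inverses\<close>

text \<open>Rank at most \<open>k\<close>, expressed as factorization through a \<open>k\<close>-dimensional space: bounds then add and pass to products by manipulating factors.\<close>

definition rank_at_most :: "nat \<Rightarrow> 'a :: field mat \<Rightarrow> bool" where
  "rank_at_most k M \<longleftrightarrow> (\<exists>U \<in> carrier_mat (dim_row M) k. \<exists>V \<in> carrier_mat k (dim_col M). M = U * V)"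

lemma rank_at_most_product: "dim_col U = k \<Longrightarrow> dim_row V = k \<Longrightarrow> rank_at_most k (U * V)"
  unfolding rank_at_most_def by (intro bexI[of _ U] bexI[of _ V]) auto

lemma rank_at_most_mult:
  assumes "rank_at_most k M" "dim_col A = dim_row M" "dim_col M = dim_row B"
  shows "rank_at_most k (A * M * B)"
proof -
  obtain U V where "U \<in> carrier_mat (dim_row M) k" "V \<in> carrier_mat k (dim_col M)" "M = U * V"
    using assms(1) by (auto simp: rank_at_most_def)
  then show ?thesis unfolding rank_at_most_def using assms(2,3)
    by (intro bexI[of _ "A * U"] bexI[of _ "V * B"]) (auto simp: mm_simps)
qed

lemma rank_at_most_add:
  assumes "rank_at_most k A" "rank_at_most l B" "dim_row A = dim_row B" "dim_col A = dim_col B"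
  shows "rank_at_most (k + l) (A + B)"
proof -
  obtain U V where 1: "U \<in> carrier_mat (dim_row A) k" "V \<in> carrier_mat k (dim_col A)" "A = U * V"
    using assms(1) by (auto simp: rank_at_most_def)
  obtain U' V' where 2: "U' \<in> carrier_mat (dim_row B) l" "V' \<in> carrier_mat l (dim_col B)" "B = U' * V'"
    using assms(2) by (auto simp: rank_at_most_def)
  have "A + B = hcat U U' * vcat V V'"
    using 1 2 assms(3,4) by (subst hcat_vcat) (auto simp: carrier_mat_def)
  then show ?thesis unfolding rank_at_most_def using assms(3,4) 1 2
    by (intro bexI[of _ "hcat U U'"] bexI[of _ "vcat V V'"]) (auto simp: carrier_mat_def)
qed

text \<open>Pad the two factors of \<open>1\<^sub>n = U V\<close> with zeros to square matrices. They are then mutually inverse, yet the product in the other order has a zero diagonal entry if \<open>k < n\<close>.\<close>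

lemma rank_at_most_one:
  assumes "rank_at_most k (1\<^sub>m n :: 'a :: field mat)"
  shows "n \<le> k"
proof (rule ccontr)
  assume "\<not> n \<le> k"
  then obtain l where n: "n = k + l" "l > 0" by (metis less_imp_add_positive not_le)
  obtain U V where UV: "U \<in> carrier_mat n k" "V \<in> carrier_mat k n" "U * V = (1\<^sub>m n :: 'a mat)"
    using assms unfolding rank_at_most_def by (metis index_one_mat(2,3))
  let ?U = "hcat U (0\<^sub>m n l)" and ?V = "vcat V (0\<^sub>m l n)"
  have "?U * ?V = 1\<^sub>m n"
    using UV by (subst hcat_vcat) (auto simp: mm_simps)
  moreover have "?U \<in> carrier_mat n n" "?V \<in> carrier_mat n n"
    using UV(1,2) n by (auto simp: carrier_mat_def)
  ultimately have "?V * ?U = 1\<^sub>m n" by (metis mat_mult_left_right_inverse)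
  moreover have "?V * ?U = four_block_mat (V * U) (V * 0\<^sub>m n l) (0\<^sub>m l n * U) (0\<^sub>m l n * 0\<^sub>m n l)"
    using UV by (subst vcat_hcat) (auto simp: carrier_mat_def)
  ultimately have "four_block_mat (V * U) (V * 0\<^sub>m n l) (0\<^sub>m l n * U) (0\<^sub>m l n * 0\<^sub>m n l) $$ (k, k) = (1\<^sub>m n :: 'a mat) $$ (k, k)"
    by simp
  then show False using UV n by (simp add: carrier_mat_def)
qed

text \<open>Linear independence of the columns, in a form that supplies the dual vectors.\<close>

definition left_invertible :: "'a :: field mat \<Rightarrow> bool" where
  "left_invertible K \<longleftrightarrow> (\<exists>L \<in> carrier_mat (dim_col K) (dim_row K). L * K = 1\<^sub>m (dim_col K))"

lemma left_invertible_le: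
  assumes "left_invertible K"
  shows "dim_col K \<le> dim_row K"
proof -
  obtain L where "L \<in> carrier_mat (dim_col K) (dim_row K)" "L * K = 1\<^sub>m (dim_col K)"
    using assms by (auto simp: left_invertible_def)
  then have "rank_at_most (dim_row K) (1\<^sub>m (dim_col K) :: 'a mat)"
    unfolding rank_at_most_def by (intro bexI[of _ L] bexI[of _ K]) (auto simp: carrier_mat_def)
  then show ?thesis by (rule rank_at_most_one)
qed

text \<open>With \<open>L K = 1\<close>, the vector \<open>K L k\<close> is the only candidate for \<open>k\<close> as a combination of the
  columns of \<open>K\<close>. If it differs from \<open>k\<close> in coordinate \<open>i\<close>, the \<open>i\<close>-th row of \<open>1 - K L\<close>
  annihilates \<open>K\<close> but not \<open>k\<close>, and so completes a left inverse.\<close>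

lemma left_invertible_hcat_col:
  fixes K :: "'a :: field mat"
  assumes c: "K \<in> carrier_mat N d" "L \<in> carrier_mat d N" "k \<in> carrier_mat N 1"
    and LK: "L * K = 1\<^sub>m d" and k: "K * (L * k) \<noteq> k"
  shows "left_invertible (hcat K k)"
proof -
  obtain i where i: "i < N" "(K * (L * k)) $$ (i, 0) \<noteq> k $$ (i, 0)"
  proof (rule ccontr)
    assume "\<not> thesis"
    with that have "(K * (L * k)) $$ (i, 0) = k $$ (i, 0)" if "i < N" for i using that by blast
    then have "K * (L * k) = k" using c by (intro eq_matI) (auto simp: carrier_mat_def simp del: index_mult_mat(1))
    with k show False by simp
  qed
  let ?u = "(unit_col N i)\<^sup>T :: 'a mat"
  define r where "r = k $$ (i, 0) - (K * (L * k)) $$ (i, 0)"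
  define \<rho> where "\<rho> = (1 / r) \<cdot>\<^sub>m (?u + (-1) \<cdot>\<^sub>m (?u * K * L))"
  have r: "r \<noteq> 0" using i by (simp add: r_def)
  have \<rho>c: "\<rho> \<in> carrier_mat 1 N" using c by (simp add: \<rho>_def carrier_mat_def)
  have \<rho>K: "\<rho> * K = 0\<^sub>m 1 d"
    unfolding \<rho>_def using c LK by (simp add: mm_simps) (intro eq_matI; auto simp del: index_mult_mat(1))
  have "\<rho> * k = (1 / r) \<cdot>\<^sub>m (?u * k + (-1) \<cdot>\<^sub>m (?u * (K * (L * k))))"
    unfolding \<rho>_def using c by (simp add: mm_simps)
  moreover have "(?u * k) $$ (0, 0) = k $$ (i, 0)" "(?u * (K * (L * k))) $$ (0, 0) = (K * (L * k)) $$ (i, 0)"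
    using unit_row_mult_index[of i k 0] unit_row_mult_index[of i "K * (L * k)" 0] i c
    by (auto simp: carrier_mat_def simp del: index_mult_mat(1))
  ultimately have \<rho>k: "\<rho> * k = 1\<^sub>m 1"
    using r c by (intro eq_matI) (auto simp: r_def carrier_mat_def simp del: index_mult_mat(1))
  let ?L = "vcat (L + (-1) \<cdot>\<^sub>m (L * k * \<rho>)) \<rho>"
  have "?L * hcat K k = four_block_mat (1\<^sub>m d) (0\<^sub>m d 1) (0\<^sub>m 1 d) (1\<^sub>m 1)"
    using c \<rho>c
    by (subst vcat_hcat; simp add: mm_simps LK \<rho>K \<rho>k smult_zero_mat del: four_block_one_mat)
      (intro cong_four_block_mat; intro eq_matI; auto simp del: index_mult_mat(1))
  also have "\<dots> = 1\<^sub>m (dim_col (hcat K k))" using c by (simp add: carrier_mat_def)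
  finally show ?thesis unfolding left_invertible_def using c \<rho>c
    by (intro bexI[of _ ?L]) (auto simp: carrier_mat_def)
qed

text \<open>As long as \<open>K L \<noteq> 1\<close>, some unit vector is not fixed by \<open>K L\<close> and can be appended to \<open>K\<close>.\<close>

lemma left_invertible_complete:
  fixes K :: "'a :: field mat"
  assumes "left_invertible K" "K \<in> carrier_mat N d"
  shows "\<exists>Z \<in> carrier_mat N (N - d). left_invertible (hcat K Z)"
  using assms
proof (induction "N - d" arbitrary: d K)
  case 0
  have "hcat K (0\<^sub>m N 0) = K" by (simp add: fb_empty)
  then show ?case using 0 by (intro bexI[of _ "0\<^sub>m N 0"]) auto
next
  case (Suc t)
  obtain L where L: "L \<in> carrier_mat d N" "L * K = 1\<^sub>m d"
    using Suc(3,4) by (auto simp: left_invertible_def carrier_mat_def)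
  have "K * L \<noteq> 1\<^sub>m N"
  proof
    assume "K * L = 1\<^sub>m N"
    then have "rank_at_most d (1\<^sub>m N :: 'a mat)"
      unfolding rank_at_most_def using L Suc(4) by (intro bexI[of _ K] bexI[of _ L]) (auto simp: carrier_mat_def)
    then show False using rank_at_most_one Suc(2) by fastforce
  qed
  then obtain i j where ij: "i < N" "j < N" "(K * L) $$ (i, j) \<noteq> (1\<^sub>m N :: 'a mat) $$ (i, j)"
    using L Suc(4) eq_matI[of "1\<^sub>m N" "K * L"] by (auto simp: carrier_mat_def simp del: index_mult_mat(1) index_one_mat(1))
  let ?k = "unit_col N j :: 'a mat"
  have "(K * (L * ?k)) $$ (i, 0) = (K * L * ?k) $$ (i, 0)" using L Suc(4) by (simp add: mm_simps)
  also have "\<dots> = (K * L) $$ (i, j)" using mult_unit_col_index[of i "K * L" j] ij L Suc(4)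
    by (simp add: carrier_mat_def del: index_mult_mat(1))
  also have "\<dots> \<noteq> (1\<^sub>m N :: 'a mat) $$ (i, j)" by fact
  finally have "K * (L * ?k) \<noteq> ?k" using ij by (auto simp: unit_col_def simp del: index_mult_mat(1))
  from left_invertible_hcat_col[OF Suc(4) L(1) unit_col_carrier(1) L(2) this]
  have "left_invertible (hcat K ?k)" .
  moreover have "hcat K ?k \<in> carrier_mat N (Suc d)" using Suc(4) by (auto simp: carrier_mat_def)
  moreover have "t = N - Suc d" using Suc(2) by simp
  ultimately obtain Z where Z: "Z \<in> carrier_mat N (N - Suc d)" "left_invertible (hcat (hcat K ?k) Z)"
    using Suc(1) by blast
  then have "left_invertible (hcat K (hcat ?k Z))"
    using Suc(4) by (subst hcat_assoc) (auto simp: carrier_mat_def)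
  moreover have "hcat ?k Z \<in> carrier_mat N (N - d)" using Z(1) Suc(2) by (auto simp: carrier_mat_def)
  ultimately show ?case by blast
qed

section \<open>Rank grows slowly along a word\<close>

text \<open>Put \<open>N = y \<circ> e - l\<close> and \<open>f = 1 - e\<close>. Since \<open>f (y \<circ> e) f = 0\<close>, the corner \<open>f N f\<close> is
  \<open>- l f\<close>, so the one part of \<open>y\<close> that \<open>y \<circ> e\<close> forgets, namely \<open>f y f\<close>, still has all its
  columns in the range of \<open>f N\<close>. Thus \<open>y - l\<close> is a right multiple of \<open>e N\<close> plus a right multiple of \<open>f N\<close>.\<close>

lemma rank_at_most_undo_mult:
  fixes y :: "'a :: field mat"
  assumes two: "(2 :: 'a) \<noteq> 0" and l: "l \<noteq> 0"
    and c: "y \<in> carrier_mat n n" "e \<in> carrier_mat n n" and e: "e * e = e"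
    and r: "rank_at_most k (jordan_prod y e + (- l) \<cdot>\<^sub>m 1\<^sub>m n)"
  shows "rank_at_most (k + k) (y + (- l) \<cdot>\<^sub>m 1\<^sub>m n)"
proof -
  have four: "(4 :: 'a) \<noteq> 0" using four_neq_zero[OF two] .
  let ?N = "jordan_prod y e + (- l) \<cdot>\<^sub>m 1\<^sub>m n"
  let ?f = "1\<^sub>m n + (-1) \<cdot>\<^sub>m e" and ?y = "y + (- l) \<cdot>\<^sub>m 1\<^sub>m n"
  have ez: "e * (e * z) = e * z" if "dim_row z = n" for z
    using e mm_assoc[of e e z] c that by (simp add: carrier_mat_def)
  have 1: "e * ?N * (2 \<cdot>\<^sub>m 1\<^sub>m n + (-1) \<cdot>\<^sub>m e) = e * ?y"
    unfolding jordan_prod_def using c two four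
    by (simp add: mm_simps e ez) (intro eq_matI; auto simp: field_simps simp del: index_mult_mat(1))
  have 2: "?f * ?N * (2 \<cdot>\<^sub>m e + (- 1 / l) \<cdot>\<^sub>m (?f * ?y * ?f)) = ?f * ?y"
  proof -
    \<comment> \<open>Keep \<open>f\<close> opaque: expanding \<open>1 - e\<close> everywhere produces far larger terms.\<close>
    obtain f where f: "f = ?f" "f \<in> carrier_mat n n" using c by (simp add: carrier_mat_def)
    have ff: "f * f = f" "f * e = 0\<^sub>m n n" "e * f = 0\<^sub>m n n" "y * f = y + (-1) \<cdot>\<^sub>m (y * e)"
      unfolding f(1) using c e by (simp_all add: mm_simps) (intro eq_matI; auto simp del: index_mult_mat(1))+
    have fz: "f * (f * z) = f * z" "f * (e * z) = 0\<^sub>m n (dim_col z)" "e * (f * z) = 0\<^sub>m n (dim_col z)"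
      if "dim_row z = n" for z
      using ff mm_assoc[of f f z] mm_assoc[of f e z] mm_assoc[of e f z] c f(2) that by (auto simp: carrier_mat_def mm_zero)
    show ?thesis
      unfolding f(1)[symmetric] jordan_prod_def using c f(2) two l
      by (simp add: mm_simps e ez ff fz smult_zero_mat) (intro eq_matI; auto simp: field_simps simp del: index_mult_mat(1))
  qed
  have "?y = e * ?y + ?f * ?y"
    using c by (simp add: mm_simps) (intro eq_matI; auto simp del: index_mult_mat(1))
  then have "?y = e * ?N * (2 \<cdot>\<^sub>m 1\<^sub>m n + (-1) \<cdot>\<^sub>m e) + ?f * ?N * (2 \<cdot>\<^sub>m e + (- 1 / l) \<cdot>\<^sub>m (?f * ?y * ?f))"
    unfolding 1 2 .
  moreover have "rank_at_most (k + k) \<dots>"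
    using c by (intro rank_at_most_add rank_at_most_mult r) (auto simp: carrier_mat_def jordan_prod_def)
  ultimately show ?thesis by simp
qed

lemma word_rank_bound:
  fixes x :: "'a :: field mat"
  assumes two: "(2 :: 'a) \<noteq> 0" and l: "l \<noteq> 0" "l \<noteq> 1"
    and w: "is_word_value jordan_prod (carrier_mat n n) m x"
    and r: "rank_at_most k (x + (- l) \<cdot>\<^sub>m 1\<^sub>m n)"
  shows "n \<le> 2 ^ (m - 1) * k"
proof -
  obtain e es where e: "length (e # es) = m" "e \<in> idempotents jordan_prod (carrier_mat n n)"
     "set es \<subseteq> idempotents jordan_prod (carrier_mat n n)" "x = foldl jordan_prod e es"
    using w by (auto simp: is_word_value_def)
  have ec: "e \<in> carrier_mat n n" "e * e = e" using e(2) idempotents_carrier_iff[OF two] by auto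
  have y: "foldl jordan_prod e es \<in> carrier_mat n n"
    if "set es \<subseteq> idempotents jordan_prod (carrier_mat n n)" for es
    using that by (induction es rule: rev_induct) (auto simp: ec jordan_prod_carrier idempotents_def)
  have "n \<le> 2 ^ length es * k"
    if "set es \<subseteq> idempotents jordan_prod (carrier_mat n n)"
      "rank_at_most k (foldl jordan_prod e es + (- l) \<cdot>\<^sub>m 1\<^sub>m n)" for es k
    using that
  proof (induction es arbitrary: k rule: rev_induct)
    case Nil
    let ?M = "(1 / (l * (1 - l))) \<cdot>\<^sub>m (e + (l - 1) \<cdot>\<^sub>m 1\<^sub>m n)"
    \<comment> \<open>\<open>e\<^sup>2 = e\<close> gives \<open>(e - l) (e + l - 1) = l (1 - l)\<close>.\<close>
    have "1\<^sub>m n * (e + (- l) \<cdot>\<^sub>m 1\<^sub>m n) * ?M = 1\<^sub>m n"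
      using ec l by (simp add: mm_simps) (intro eq_matI; auto simp: divide_simps simp del: index_mult_mat(1); simp add: algebra_simps)
    moreover have "rank_at_most k (1\<^sub>m n * (e + (- l) \<cdot>\<^sub>m 1\<^sub>m n) * ?M)"
      using Nil(2) ec by (intro rank_at_most_mult) (auto simp: carrier_mat_def)
    ultimately have "rank_at_most k (1\<^sub>m n :: 'a mat)" by simp
    then show ?case using rank_at_most_one ec by auto
  next
    case (snoc a es)
    have a: "a \<in> carrier_mat n n" "a * a = a"
      using snoc(2) idempotents_carrier_iff[OF two] by auto
    show ?case
      using rank_at_most_undo_mult[OF two l(1) y a, of es k] snoc(1)[of "k + k"] snoc(2,3)
      by (simp add: mult_2 algebra_simps)
  qed
  then show ?thesis using e r by force
qed

section \<open>Words relative to a starting matrix\<close>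

text \<open>\<open>word_from n k x y\<close>: up to similarity, \<open>x\<close> arises from \<open>y\<close> by \<open>k\<close> multiplications with
  idempotents. Allowing a similarity between any two multiplications is harmless because
  idempotents are conjugated along, and it keeps all block forms normalised.\<close>

inductive word_from :: "nat \<Rightarrow> nat \<Rightarrow> 'a :: field mat \<Rightarrow> 'a mat \<Rightarrow> bool" for n where
  base: "y \<in> carrier_mat n n \<Longrightarrow> word_from n 0 y y"
| mult: "word_from n k z y \<Longrightarrow> e \<in> carrier_mat n n \<Longrightarrow> e * e = e \<Longrightarrow> word_from n (Suc k) (jordan_prod z e) y"
| sim: "word_from n k z y \<Longrightarrow> similar_mat x z \<Longrightarrow> word_from n k x y"

lemma word_from_carrier: "word_from n k x y \<Longrightarrow> x \<in> carrier_mat n n \<and> y \<in> carrier_mat n n"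
  by (induction rule: word_from.induct) (auto simp: jordan_prod_carrier similar_mat_carrier)

lemma word_from_trans: "word_from n k x y \<Longrightarrow> word_from n l y z \<Longrightarrow> word_from n (k + l) x z"
  by (induction rule: word_from.induct) (auto intro: word_from.intros)

lemma word_from_similar: "similar_mat x y \<Longrightarrow> y \<in> carrier_mat n n \<Longrightarrow> word_from n 0 x y"
  by (rule word_from.sim[OF word_from.base])

lemma is_word_value_word_from:
  assumes "(2 :: 'a :: field) \<noteq> 0"
    and "word_from n k x y" "is_word_value jordan_prod (carrier_mat n n) m y"
  shows "is_word_value jordan_prod (carrier_mat n n) (m + k) (x :: 'a mat)"
  using assms(2,3)
proof (induction rule: word_from.induct)
  case (mult k z y e)
  then show ?case by (auto intro!: is_word_value_mult simp: idempotents_carrier_iff[OF assms(1)])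
next
  case (sim k z y x)
  then show ?case using word_from_carrier[OF sim(1)] by (auto intro: is_word_value_similar)
qed simp

text \<open>Multiplication by \<open>1 - f\<close> halves the two off-diagonal Peirce components of \<open>y\<close> with respect to
  \<open>f\<close> and deletes the component \<open>f y f\<close>, which is therefore free.\<close>

lemma word_from_step:
  assumes two: "(2 :: 'a :: field) \<noteq> 0"
    and c: "x \<in> carrier_mat n n" "f \<in> carrier_mat n n" "d \<in> carrier_mat n n"
    and f: "f * f = f" "f * (x * f) = 0\<^sub>m n n"
  shows "word_from n 1 x (x + x * f + f * x + f * (d * f) :: 'a mat)"
proof -
  let ?y = "x + x * f + f * x + f * (d * f)" and ?e = "1\<^sub>m n + (-1) \<cdot>\<^sub>m f"
  have 1: "f * (f * z) = f * z" if "dim_row z = n" for z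
    using f(1) mm_assoc[of f f z] c that by (simp add: carrier_mat_def)
  have "?y * ?e = x + (-1) \<cdot>\<^sub>m (x * f) + f * x"
    using c f by (simp add: mm_simps) (intro eq_matI, auto simp: f simp del: index_mult_mat(1))
  moreover have "?e * ?y = x + (-1) \<cdot>\<^sub>m (f * x) + x * f"
    using c f by (simp add: mm_simps 1) (intro eq_matI, auto simp: f simp del: index_mult_mat(1))
  ultimately have "jordan_prod ?y ?e = x"
    using c two unfolding jordan_prod_def
    by (intro eq_matI) (auto simp: carrier_mat_def field_simps simp del: index_mult_mat(1))
  moreover have "?e * ?e = ?e"
    using c f by (simp add: mm_simps) (intro eq_matI, auto simp: field_simps simp del: index_mult_mat(1))
  ultimately show ?thesis
    using word_from.mult[OF word_from.base, of ?y n ?e] c by simp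
qed

text \<open>Extending each idempotent \<open>e\<close> of a word by the identity acts on a lower left block as
  \<open>G \<mapsto> (G + G e) / 2\<close>. This map is invertible, with inverse \<open>G \<mapsto> G (2 - e)\<close>, so a word for the upper
  left corner lifts to any bordered matrix; the border changes only by a factor on the right that
  depends on the word alone.\<close>

lemma word_from_lower_triangular:
  assumes two: "(2 :: 'a :: field) \<noteq> 0" and "word_from n k x (y :: 'a mat)"
  shows "\<exists>M \<in> carrier_mat n n. \<forall>p. \<forall>D \<in> carrier_mat p p. \<forall>G \<in> carrier_mat p n.
    word_from (n + p) k (four_block_mat x (0\<^sub>m n p) G D) (four_block_mat y (0\<^sub>m n p) (G * M) D)"
  using assms(2)
proof (induction rule: word_from.induct)
  case (base y)
  then show ?case
    by (intro bexI[of _ "1\<^sub>m n"]) (auto simp: mm_simps intro!: word_from.base)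
next
  case (mult k z y e)
  have four: "(4 :: 'a) \<noteq> 0" using four_neq_zero[OF two] .
  from mult obtain M where M: "M \<in> carrier_mat n n" and
    w: "\<And>p D G. D \<in> carrier_mat p p \<Longrightarrow> G \<in> carrier_mat p n \<Longrightarrow>
      word_from (n + p) k (four_block_mat z (0\<^sub>m n p) G D) (four_block_mat y (0\<^sub>m n p) (G * M) D)" by blast
  have z: "z \<in> carrier_mat n n" using word_from_carrier[OF mult(1)] by simp
  let ?t = "2 \<cdot>\<^sub>m 1\<^sub>m n + (-1) \<cdot>\<^sub>m e"
  have "word_from (n + p) (Suc k) (four_block_mat (jordan_prod z e) (0\<^sub>m n p) G D)
      (four_block_mat y (0\<^sub>m n p) (G * (?t * M)) D)"
    if c: "D \<in> carrier_mat p p" "G \<in> carrier_mat p n" for p D G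
  proof -
    let ?E = "four_block_mat e (0\<^sub>m n p) (0\<^sub>m p n) (1\<^sub>m p)"
    have "jordan_prod (four_block_mat z (0\<^sub>m n p) (G * ?t) D) ?E
      = four_block_mat (jordan_prod z e) (0\<^sub>m n p) G D"
      unfolding jordan_prod_def using c z mult(2,3) two four
      by (simp add: block_simps) (intro cong_four_block_mat; intro eq_matI; auto simp: field_simps simp del: index_mult_mat(1))
    moreover have "?E * ?E = ?E" using mult(2,3) by (simp add: block_simps)
    moreover have "G * ?t * M = G * (?t * M)" using c mult(2) M by (simp add: mm_simps)
    moreover have "G * ?t \<in> carrier_mat p n" using c mult(2) by (simp add: carrier_mat_def)
    moreover have "?E \<in> carrier_mat (n + p) (n + p)" using mult(2) by (simp add: carrier_mat_def)
    ultimately show ?thesis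
      using word_from.mult[OF w[OF c(1), of "G * ?t"], of ?E] by simp
  qed
  moreover have "?t * M \<in> carrier_mat n n" using M mult(2) by (simp add: carrier_mat_def)
  ultimately show ?case by blast
next
  case (sim k z y x)
  then obtain M where M: "M \<in> carrier_mat n n" and
    w: "\<And>p D G. D \<in> carrier_mat p p \<Longrightarrow> G \<in> carrier_mat p n \<Longrightarrow>
      word_from (n + p) k (four_block_mat z (0\<^sub>m n p) G D) (four_block_mat y (0\<^sub>m n p) (G * M) D)" by blast
  have z: "z \<in> carrier_mat n n" using word_from_carrier[OF sim(1)] by simp
  obtain P Q where PQ: "x \<in> carrier_mat n n" "P \<in> carrier_mat n n" "Q \<in> carrier_mat n n"
    "P * Q = 1\<^sub>m n" "Q * P = 1\<^sub>m n" "x = P * z * Q"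
    using similar_matD[OF sim(2)] z by (force simp: carrier_mat_def)
  have xP: "x * P = P * z" using PQ z by (simp add: mm_simps)
  have "word_from (n + p) k (four_block_mat x (0\<^sub>m n p) G D)
      (four_block_mat y (0\<^sub>m n p) (G * (P * M)) D)"
    if c: "D \<in> carrier_mat p p" "G \<in> carrier_mat p n" for p D G
  proof -
    have "similar_mat (four_block_mat x (0\<^sub>m n p) G D) (four_block_mat z (0\<^sub>m n p) (G * P) D)"
    proof (rule similar_by[where n = "n + p" and T = "four_block_mat P (0\<^sub>m n p) (0\<^sub>m p n) (1\<^sub>m p)"
          and S = "four_block_mat Q (0\<^sub>m n p) (0\<^sub>m p n) (1\<^sub>m p)"])
      show "four_block_mat P (0\<^sub>m n p) (0\<^sub>m p n) (1\<^sub>m p) * four_block_mat Q (0\<^sub>m n p) (0\<^sub>m p n) (1\<^sub>m p) = 1\<^sub>m (n + p)"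
        unfolding fb_one using PQ(1-4) by (simp add: block_simps del: four_block_one_mat)
      show "four_block_mat x (0\<^sub>m n p) G D * four_block_mat P (0\<^sub>m n p) (0\<^sub>m p n) (1\<^sub>m p)
        = four_block_mat P (0\<^sub>m n p) (0\<^sub>m p n) (1\<^sub>m p) * four_block_mat z (0\<^sub>m n p) (G * P) D"
        using PQ(1-3) c z xP by (simp add: block_simps)
    qed (use c PQ(1-3) z in \<open>auto simp: carrier_mat_def\<close>)
    moreover have "G * P * M = G * (P * M)" using c PQ(1-3) M by (simp add: mm_simps)
    moreover have "G * P \<in> carrier_mat p n" using c PQ(1-3) by (simp add: carrier_mat_def)
    ultimately show ?thesis
      using word_from.sim[OF w[OF c(1), of "G * P"]] by simp
  qed
  moreover have "P * M \<in> carrier_mat n n" using M PQ(1-3) by (simp add: carrier_mat_def)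
  ultimately show ?case by blast
qed

lemma word_from_direct_sum:
  assumes "(2 :: 'a :: field) \<noteq> 0" "word_from n k x (y :: 'a mat)" "D \<in> carrier_mat p p"
  shows "word_from (n + p) k (four_block_mat x (0\<^sub>m n p) (0\<^sub>m p n) D) (four_block_mat y (0\<^sub>m n p) (0\<^sub>m p n) D)"
proof -
  obtain M where M: "M \<in> carrier_mat n n"
    "word_from (n + p) k (four_block_mat x (0\<^sub>m n p) (0\<^sub>m p n) D) (four_block_mat y (0\<^sub>m n p) (0\<^sub>m p n * M) D)"
    using word_from_lower_triangular[OF assms(1,2)] assms(3) zero_carrier_mat[of p n] by blast
  have "0\<^sub>m p n * M = 0\<^sub>m p n" using M(1) by (simp add: mm_simps)
  then show ?thesis using M(2) by simp
qed

section \<open>Companion blocks\<close>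

text \<open>The companion matrix of \<open>t\<^sup>2 - a t - b\<close>, with matrices \<open>a\<close> and \<open>b\<close> as coefficients.\<close>

definition companion_block :: "nat \<Rightarrow> 'a :: field mat \<Rightarrow> 'a mat \<Rightarrow> 'a mat" where
  "companion_block m a b = four_block_mat a (1\<^sub>m m) b (0\<^sub>m m m)"

lemma companion_block_carrier [simp]:
  "a \<in> carrier_mat m m \<Longrightarrow> companion_block m a b \<in> carrier_mat (m + m) (m + m)"
  by (simp add: companion_block_def carrier_mat_def)

text \<open>The basis change keeps the second block vector \<open>w\<close> and replaces the first, \<open>v\<close>, by the image \<open>2 v + w d\<close> of \<open>w\<close>.\<close>

lemma similar_companion_block:
  fixes a :: "'a :: field mat"
  assumes two: "(2 :: 'a) \<noteq> 0"
    and c: "a \<in> carrier_mat m m" "b \<in> carrier_mat m m" "d \<in> carrier_mat m m"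
  shows "similar_mat (four_block_mat a (2 \<cdot>\<^sub>m 1\<^sub>m m) b d) (companion_block m (a + d) (2 \<cdot>\<^sub>m b + (-1) \<cdot>\<^sub>m (d * a)))"
proof (rule similar_by[where n = "m + m" and T = "four_block_mat (2 \<cdot>\<^sub>m 1\<^sub>m m) (0\<^sub>m m m) d (1\<^sub>m m)"
    and S = "four_block_mat ((1/2) \<cdot>\<^sub>m 1\<^sub>m m) (0\<^sub>m m m) ((-1/2) \<cdot>\<^sub>m d) (1\<^sub>m m)"])
  show "four_block_mat (2 \<cdot>\<^sub>m 1\<^sub>m m) (0\<^sub>m m m) d (1\<^sub>m m) *
    four_block_mat ((1/2) \<cdot>\<^sub>m 1\<^sub>m m) (0\<^sub>m m m) ((-1/2) \<cdot>\<^sub>m d) (1\<^sub>m m) = 1\<^sub>m (m + m)"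
    unfolding fb_one using c two
    by (simp add: block_simps del: four_block_one_mat) (intro cong_four_block_mat; intro eq_matI; auto simp: field_simps simp del: index_mult_mat(1))
  show "four_block_mat a (2 \<cdot>\<^sub>m 1\<^sub>m m) b d * four_block_mat (2 \<cdot>\<^sub>m 1\<^sub>m m) (0\<^sub>m m m) d (1\<^sub>m m) =
    four_block_mat (2 \<cdot>\<^sub>m 1\<^sub>m m) (0\<^sub>m m m) d (1\<^sub>m m) * companion_block m (a + d) (2 \<cdot>\<^sub>m b + (-1) \<cdot>\<^sub>m (d * a))"
    unfolding companion_block_def using c two
    by (simp add: block_simps) (intro cong_four_block_mat; intro eq_matI; auto simp: field_simps simp del: index_mult_mat(1))
qed (use c in \<open>auto simp: companion_block_def carrier_mat_def\<close>)

text \<open>The free corner of the backward step is the lower right block.\<close>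

lemma companion_block_step:
  fixes a :: "'a :: field mat"
  assumes two: "(2 :: 'a) \<noteq> 0"
    and c: "a \<in> carrier_mat m m" "b \<in> carrier_mat m m" "d \<in> carrier_mat m m"
  shows "word_from (m + m) 1 (companion_block m a b) (companion_block m (a + d) (4 \<cdot>\<^sub>m b + (-1) \<cdot>\<^sub>m (d * a)))"
proof -
  let ?f = "four_block_mat (0\<^sub>m m m) (0\<^sub>m m m) (0\<^sub>m m m) (1\<^sub>m m) :: 'a mat"
  let ?d = "four_block_mat (0\<^sub>m m m) (0\<^sub>m m m) (0\<^sub>m m m) d :: 'a mat"
  let ?x = "companion_block m a b"
  have "?x + ?x * ?f + ?f * ?x + ?f * (?d * ?f) = four_block_mat a (2 \<cdot>\<^sub>m 1\<^sub>m m) (2 \<cdot>\<^sub>m b) d"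
    unfolding companion_block_def using c
    by (simp add: block_simps) (intro cong_four_block_mat; intro eq_matI; auto simp: field_simps simp del: index_mult_mat(1))
  moreover have "word_from (m + m) 1 ?x (?x + ?x * ?f + ?f * ?x + ?f * (?d * ?f))"
    by (rule word_from_step[OF two]; (unfold companion_block_def fb_zero)?) (use c in \<open>simp_all add: block_simps\<close>)
  ultimately have "word_from (m + m) 1 ?x (four_block_mat a (2 \<cdot>\<^sub>m 1\<^sub>m m) (2 \<cdot>\<^sub>m b) d)" by simp
  moreover have "word_from (m + m) 0 (four_block_mat a (2 \<cdot>\<^sub>m 1\<^sub>m m) (2 \<cdot>\<^sub>m b) d)
    (companion_block m (a + d) (4 \<cdot>\<^sub>m b + (-1) \<cdot>\<^sub>m (d * a)))"
    using similar_companion_block[OF two c(1) _ c(3), of "2 \<cdot>\<^sub>m b"] c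
    by (intro word_from_similar) (auto simp: mm_simps companion_block_def)
  ultimately show ?thesis using word_from_trans by fastforce
qed

text \<open>The step \<open>d = - a\<close> reaches \<open>(0, B)\<close>. From there \<open>d = s\<close> twice and then \<open>d = 1 - 2 s\<close> give
  \<open>(s, 4 B)\<close>, \<open>(2 s, 16 B - s\<^sup>2)\<close> and \<open>(1, 64 B - 2 s)\<close>: doubling the first coordinate makes the squares of
  \<open>s\<close> cancel, and the remaining condition \<open>64 B - 2 s = \<beta>\<close> is linear in \<open>s\<close>.\<close>

lemma companion_block_to_scalar:
  fixes a :: "'a :: field mat"
  assumes two: "(2 :: 'a) \<noteq> 0"
    and c: "a \<in> carrier_mat m m" "b \<in> carrier_mat m m"
  shows "word_from (m + m) 4 (companion_block m a b) (companion_block m (1\<^sub>m m) (\<beta> \<cdot>\<^sub>m 1\<^sub>m m))"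
proof -
  define B where "B = 4 \<cdot>\<^sub>m b + a * a"
  define s where "s = 32 \<cdot>\<^sub>m B + (- \<beta> / 2) \<cdot>\<^sub>m 1\<^sub>m m"
  have cB: "B \<in> carrier_mat m m" "s \<in> carrier_mat m m" using c by (auto simp: B_def s_def carrier_mat_def)
  note st = companion_block_step[OF two]
  have e1: "a + (-1) \<cdot>\<^sub>m a = 0\<^sub>m m m" "4 \<cdot>\<^sub>m b + (-1) \<cdot>\<^sub>m ((-1) \<cdot>\<^sub>m a * a) = B"
    using c by (auto simp: B_def mm_simps)
  have e2: "0\<^sub>m m m + s = s" "4 \<cdot>\<^sub>m B + (-1) \<cdot>\<^sub>m (s * 0\<^sub>m m m) = 4 \<cdot>\<^sub>m B"
    using cB by (auto simp: mm_simps smult_zero_mat)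
  have e3: "s + (1\<^sub>m m + (-1) \<cdot>\<^sub>m s) = 1\<^sub>m m" "(s + s) + (1\<^sub>m m + (-2) \<cdot>\<^sub>m s) = 1\<^sub>m m"
    "4 \<cdot>\<^sub>m (4 \<cdot>\<^sub>m (4 \<cdot>\<^sub>m B) + (-1) \<cdot>\<^sub>m (s * s)) + (-1) \<cdot>\<^sub>m ((1\<^sub>m m + (-2) \<cdot>\<^sub>m s) * (s + s)) = \<beta> \<cdot>\<^sub>m 1\<^sub>m m"
  proof -
    show "s + (1\<^sub>m m + (-1) \<cdot>\<^sub>m s) = 1\<^sub>m m" "(s + s) + (1\<^sub>m m + (-2) \<cdot>\<^sub>m s) = 1\<^sub>m m"
      using cB by (auto simp: carrier_mat_def)
    have "4 \<cdot>\<^sub>m (4 \<cdot>\<^sub>m (4 \<cdot>\<^sub>m B) + (-1) \<cdot>\<^sub>m (s * s)) + (-1) \<cdot>\<^sub>m ((1\<^sub>m m + (-2) \<cdot>\<^sub>m s) * (s + s))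
      = 64 \<cdot>\<^sub>m B + (-2) \<cdot>\<^sub>m s"
      using cB by (simp add: mm_simps) (intro eq_matI; auto simp: field_simps simp del: index_mult_mat(1))
    also have "\<dots> = \<beta> \<cdot>\<^sub>m 1\<^sub>m m"
      unfolding s_def using cB two by (intro eq_matI; auto simp: carrier_mat_def field_simps)
    finally show "4 \<cdot>\<^sub>m (4 \<cdot>\<^sub>m (4 \<cdot>\<^sub>m B) + (-1) \<cdot>\<^sub>m (s * s)) + (-1) \<cdot>\<^sub>m ((1\<^sub>m m + (-2) \<cdot>\<^sub>m s) * (s + s)) = \<beta> \<cdot>\<^sub>m 1\<^sub>m m" .
  qed
  have "word_from (m + m) 1 (companion_block m a b) (companion_block m (0\<^sub>m m m) B)"
    using st[OF c, of "(-1) \<cdot>\<^sub>m a"] c unfolding e1 by simp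
  moreover have "word_from (m + m) 1 (companion_block m (0\<^sub>m m m) B) (companion_block m s (4 \<cdot>\<^sub>m B))"
    using st[OF _ cB(1,2), of "0\<^sub>m m m"] unfolding e2 by simp
  moreover have "word_from (m + m) 1 (companion_block m s (4 \<cdot>\<^sub>m B))
      (companion_block m (s + s) (4 \<cdot>\<^sub>m (4 \<cdot>\<^sub>m B) + (-1) \<cdot>\<^sub>m (s * s)))"
    using st[OF cB(2) _ cB(2), of "4 \<cdot>\<^sub>m B"] cB by simp
  moreover have "word_from (m + m) 1 (companion_block m (s + s) (4 \<cdot>\<^sub>m (4 \<cdot>\<^sub>m B) + (-1) \<cdot>\<^sub>m (s * s)))
      (companion_block m (1\<^sub>m m) (\<beta> \<cdot>\<^sub>m 1\<^sub>m m))"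
    using st[of "s + s" m "4 \<cdot>\<^sub>m (4 \<cdot>\<^sub>m B) + (-1) \<cdot>\<^sub>m (s * s)" "1\<^sub>m m + (-2) \<cdot>\<^sub>m s"] cB unfolding e3 by simp
  ultimately have "word_from (m + m) (1 + (1 + (1 + 1))) (companion_block m a b) (companion_block m (1\<^sub>m m) (\<beta> \<cdot>\<^sub>m 1\<^sub>m m))"
    by (blast intro: word_from_trans)
  then show ?thesis by (simp add: numeral_eq_Suc)
qed

lemma similar_companion_diag:
  "similar_mat (companion_block m (1\<^sub>m m) (0\<^sub>m m m)) (four_block_mat (1\<^sub>m m) (0\<^sub>m m m) (0\<^sub>m m m) (0\<^sub>m m m) :: 'a :: field mat)"
proof (rule similar_by[where n = "m + m" and T = "four_block_mat (1\<^sub>m m) ((-1) \<cdot>\<^sub>m 1\<^sub>m m) (0\<^sub>m m m) (1\<^sub>m m)"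
          and S = "four_block_mat (1\<^sub>m m) (1\<^sub>m m) (0\<^sub>m m m) (1\<^sub>m m)"])
  show "four_block_mat (1\<^sub>m m) ((-1) \<cdot>\<^sub>m 1\<^sub>m m) (0\<^sub>m m m) (1\<^sub>m m) * four_block_mat (1\<^sub>m m) (1\<^sub>m m) (0\<^sub>m m m) (1\<^sub>m m)
      = (1\<^sub>m (m + m) :: 'a mat)"
    unfolding fb_one by (simp add: block_simps del: four_block_one_mat) (intro cong_four_block_mat; intro eq_matI; auto)
  show "companion_block m (1\<^sub>m m) (0\<^sub>m m m) * four_block_mat (1\<^sub>m m) ((-1) \<cdot>\<^sub>m 1\<^sub>m m) (0\<^sub>m m m) (1\<^sub>m m) =
    four_block_mat (1\<^sub>m m) ((-1) \<cdot>\<^sub>m 1\<^sub>m m) (0\<^sub>m m m) (1\<^sub>m m) *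
     (four_block_mat (1\<^sub>m m) (0\<^sub>m m m) (0\<^sub>m m m) (0\<^sub>m m m) :: 'a mat)"
    unfolding companion_block_def by (simp add: block_simps) (intro cong_four_block_mat; intro eq_matI; auto)
qed (auto simp: carrier_mat_def companion_block_def)

text \<open>If \<open>l\<close> is not a root of \<open>t\<^sup>2 - t - \<beta>\<close>, then \<open>C - l\<close> is invertible, with inverse a multiple of
  \<open>C + l - 1\<close>, and the equation \<open>r C - l r = G\<close> can be solved for the border \<open>r\<close> of a unipotent
  basis change.\<close>

lemma similar_split_eigenspace:
  fixes C :: "'a :: field mat"
  assumes c: "C \<in> carrier_mat n n" "G \<in> carrier_mat p n"
    and C: "C * C = C + \<beta> \<cdot>\<^sub>m 1\<^sub>m n" and k: "\<beta> + l - l * l \<noteq> 0"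
  shows "similar_mat (four_block_mat C (0\<^sub>m n p) G (l \<cdot>\<^sub>m 1\<^sub>m p)) (four_block_mat C (0\<^sub>m n p) (0\<^sub>m p n) (l \<cdot>\<^sub>m 1\<^sub>m p))"
proof -
  define r where "r = G * ((1 / (\<beta> + l - l * l)) \<cdot>\<^sub>m (C + (l - 1) \<cdot>\<^sub>m 1\<^sub>m n))"
  have r: "r \<in> carrier_mat p n" using c by (simp add: r_def carrier_mat_def)
  have eq: "G + l \<cdot>\<^sub>m r = r * C"
    unfolding r_def using c k
    by (simp add: mm_simps C) (intro eq_matI; auto simp: divide_simps simp del: index_mult_mat(1); simp add: algebra_simps)
  show ?thesis
  proof (rule similar_by[where n = "n + p" and T = "four_block_mat (1\<^sub>m n) (0\<^sub>m n p) r (1\<^sub>m p)"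
          and S = "four_block_mat (1\<^sub>m n) (0\<^sub>m n p) ((-1) \<cdot>\<^sub>m r) (1\<^sub>m p)"])
    show "four_block_mat (1\<^sub>m n) (0\<^sub>m n p) r (1\<^sub>m p) * four_block_mat (1\<^sub>m n) (0\<^sub>m n p) ((-1) \<cdot>\<^sub>m r) (1\<^sub>m p) = 1\<^sub>m (n + p)"
      unfolding fb_one using r
      by (simp add: block_simps del: four_block_one_mat) (intro cong_four_block_mat; intro eq_matI; auto)
    show "four_block_mat C (0\<^sub>m n p) G (l \<cdot>\<^sub>m 1\<^sub>m p) * four_block_mat (1\<^sub>m n) (0\<^sub>m n p) r (1\<^sub>m p) =
        four_block_mat (1\<^sub>m n) (0\<^sub>m n p) r (1\<^sub>m p) * four_block_mat C (0\<^sub>m n p) (0\<^sub>m p n) (l \<cdot>\<^sub>m 1\<^sub>m p)"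
      using c r eq by (simp add: block_simps)
  qed (use c r in \<open>auto simp: carrier_mat_def\<close>)
qed

section \<open>Absorbing a scalar summand\<close>

text \<open>The vectors \<open>(w, w)\<close> and their images \<open>(E w, l w)\<close> together form a basis, since \<open>E - l\<close> is
  invertible; and \<open>E\<close> and \<open>l\<close> are both roots of \<open>t\<^sup>2 - (E + l) t + l E\<close>.\<close>

lemma similar_idempotent_scalar:
  fixes E :: "'a :: field mat"
  assumes c: "E \<in> carrier_mat q q" and E: "E * E = E" and l: "l \<noteq> 0" "l \<noteq> 1"
  shows "similar_mat (four_block_mat E (0\<^sub>m q q) (0\<^sub>m q q) (l \<cdot>\<^sub>m 1\<^sub>m q))
    (companion_block q (E + l \<cdot>\<^sub>m 1\<^sub>m q) ((- l) \<cdot>\<^sub>m E))"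
proof -
  \<comment> \<open>\<open>N\<close> is the inverse of \<open>E - l\<close>.\<close>
  define N where "N = (1 / (l * (1 - l))) \<cdot>\<^sub>m (E + (l - 1) \<cdot>\<^sub>m 1\<^sub>m q)"
  have N: "N \<in> carrier_mat q q" using c by (simp add: N_def carrier_mat_def)
  have k: "l * (1 - l) \<noteq> 0" using l by simp
  have EN: "E * N = 1\<^sub>m q + l \<cdot>\<^sub>m N"
    unfolding N_def using c E l k
    by (simp add: mm_simps) (intro eq_matI; auto simp: divide_simps simp del: index_mult_mat(1); simp add: algebra_simps)
  show ?thesis
  proof (rule similar_by[where n = "q + q" and T = "four_block_mat E (1\<^sub>m q) (l \<cdot>\<^sub>m 1\<^sub>m q) (1\<^sub>m q)"
          and S = "four_block_mat N ((-1) \<cdot>\<^sub>m N) ((- l) \<cdot>\<^sub>m N) (1\<^sub>m q + l \<cdot>\<^sub>m N)"])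
    show "four_block_mat E (1\<^sub>m q) (l \<cdot>\<^sub>m 1\<^sub>m q) (1\<^sub>m q) *
      four_block_mat N ((-1) \<cdot>\<^sub>m N) ((- l) \<cdot>\<^sub>m N) (1\<^sub>m q + l \<cdot>\<^sub>m N) = 1\<^sub>m (q + q)"
      unfolding fb_one using c N EN
      by (simp add: block_simps del: four_block_one_mat) (intro cong_four_block_mat; intro eq_matI; auto)
    show "four_block_mat E (0\<^sub>m q q) (0\<^sub>m q q) (l \<cdot>\<^sub>m 1\<^sub>m q) * four_block_mat E (1\<^sub>m q) (l \<cdot>\<^sub>m 1\<^sub>m q) (1\<^sub>m q) =
      four_block_mat E (1\<^sub>m q) (l \<cdot>\<^sub>m 1\<^sub>m q) (1\<^sub>m q) * companion_block q (E + l \<cdot>\<^sub>m 1\<^sub>m q) ((- l) \<cdot>\<^sub>m E)"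
      unfolding companion_block_def using c E
      by (simp add: block_simps) (intro cong_four_block_mat; intro eq_matI; auto simp: algebra_simps)
  qed (use c N in \<open>auto simp: carrier_mat_def companion_block_def\<close>)
qed

text \<open>Idempotents of this diagonal shape can be cut into two summands at any position.\<close>

definition diag01 :: "nat \<Rightarrow> nat set \<Rightarrow> 'a :: field mat" where
  "diag01 n S = mat n n (\<lambda>(i, j). if i = j \<and> i \<in> S then 1 else 0)"

lemma diag01_carrier [simp]:
  "diag01 n S \<in> carrier_mat n n" "dim_row (diag01 n S) = n" "dim_col (diag01 n S) = n"
  by (simp_all add: diag01_def)

lemma diag01_idem: "diag01 n S * diag01 n S = (diag01 n S :: 'a :: field mat)"
proof (rule eq_matI)
  fix i j assume "i < dim_row (diag01 n S :: 'a mat)" "j < dim_col (diag01 n S :: 'a mat)"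
  then have ij: "i < n" "j < n" by simp_all
  have "(diag01 n S * diag01 n S :: 'a mat) $$ (i, j) = (\<Sum>k<n. diag01 n S $$ (i, k) * diag01 n S $$ (k, j))"
    using ij by (simp add: scalar_prod_def atLeast0LessThan)
  also have "\<dots> = (\<Sum>k<n. if k = i then (if i \<in> S \<and> i = j then 1 else 0) else 0)"
    using ij by (intro sum.cong) (auto simp: diag01_def)
  finally have "(diag01 n S * diag01 n S :: 'a mat) $$ (i, j) = \<dots>" .
  then show "(diag01 n S * diag01 n S) $$ (i, j) = (diag01 n S :: 'a mat) $$ (i, j)"
    using ij by (auto simp: diag01_def)
qed simp_all

lemma diag01_split: "diag01 (a + b) S = four_block_mat (diag01 a S) (0\<^sub>m a b) (0\<^sub>m b a) (diag01 b {i. i + a \<in> S})"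
  by (rule eq_matI) (auto simp: diag01_def)

lemma diag01_lower: "four_block_mat (1\<^sub>m m) (0\<^sub>m m m) (0\<^sub>m m m) (0\<^sub>m m m) = diag01 (m + m) {..<m}"
  by (rule eq_matI) (auto simp: diag01_def)

lemma word_from_diag01_scalar:
  assumes two: "(2 :: 'a :: field) \<noteq> 0" and l: "(l :: 'a) \<noteq> 0" "l \<noteq> 1"
  shows "word_from (q + q) 4 (four_block_mat (diag01 q S) (0\<^sub>m q q) (0\<^sub>m q q) (l \<cdot>\<^sub>m 1\<^sub>m q)) (diag01 (q + q) {..<q})"
proof -
  have "similar_mat (four_block_mat (diag01 q S) (0\<^sub>m q q) (0\<^sub>m q q) (l \<cdot>\<^sub>m 1\<^sub>m q))
    (companion_block q (diag01 q S + l \<cdot>\<^sub>m 1\<^sub>m q) ((- l) \<cdot>\<^sub>m diag01 q S))"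
    using similar_idempotent_scalar[OF diag01_carrier(1) diag01_idem l] .
  moreover have "word_from (q + q) 4 (companion_block q (diag01 q S + l \<cdot>\<^sub>m 1\<^sub>m q) ((- l) \<cdot>\<^sub>m diag01 q S))
      (companion_block q (1\<^sub>m q) (0 \<cdot>\<^sub>m 1\<^sub>m q))"
    by (rule companion_block_to_scalar[OF two]) (auto simp: carrier_mat_def)
  moreover have "(0 :: 'a) \<cdot>\<^sub>m 1\<^sub>m q = 0\<^sub>m q q" by (intro eq_matI) auto
  moreover have "word_from (q + q) 0 (companion_block q (1\<^sub>m q) (0\<^sub>m q q)) (diag01 (q + q) {..<q} :: 'a mat)"
    using similar_companion_diag[of q, where 'a = 'a] unfolding diag01_lower by (intro word_from_similar) auto
  ultimately show ?thesis using word_from_trans word_from.sim by fastforce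
qed

text \<open>While \<open>p > q\<close>, four steps absorb \<open>q\<close> of the \<open>p\<close> scalar entries and double \<open>q\<close>. Once
  \<open>p \<le> q\<close>, only \<open>p\<close> entries of the idempotent are needed as partners and the others are split off.\<close>

lemma word_value_diag01_scalar:
  assumes two: "(2 :: 'a :: field) \<noteq> 0" and l: "(l :: 'a) \<noteq> 0" "l \<noteq> 1"
    and p: "p \<le> 2 ^ j * q"
  shows "is_word_value jordan_prod (carrier_mat (q + p) (q + p)) (4 * j + 5)
    (four_block_mat (diag01 q S) (0\<^sub>m q p) (0\<^sub>m p q) (l \<cdot>\<^sub>m 1\<^sub>m p))"
proof -
  have base: "is_word_value jordan_prod (carrier_mat (q + p) (q + p)) 5
    (four_block_mat (diag01 q S) (0\<^sub>m q p) (0\<^sub>m p q) (l \<cdot>\<^sub>m 1\<^sub>m p))" if pq: "p \<le> q" for p q S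
  proof -
    obtain r where q: "q = r + p" using pq by (metis add.commute le_add_diff_inverse)
    let ?F = "diag01 r S :: 'a mat" and ?E = "diag01 p {i. i + r \<in> S} :: 'a mat"
    let ?X = "four_block_mat ?E (0\<^sub>m p p) (0\<^sub>m p p) (l \<cdot>\<^sub>m 1\<^sub>m p)"
    have n: "q + p = (p + p) + r" using q by simp
    have eq: "four_block_mat (diag01 q S) (0\<^sub>m q p) (0\<^sub>m p q) (l \<cdot>\<^sub>m 1\<^sub>m p)
      = four_block_mat ?F (0\<^sub>m r (p + p)) (0\<^sub>m (p + p) r) ?X"
      unfolding q diag01_split by (rule direct_sum_assoc) (auto simp: carrier_mat_def)
    have "similar_mat (four_block_mat ?F (0\<^sub>m r (p + p)) (0\<^sub>m (p + p) r) ?X)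
      (four_block_mat ?X (0\<^sub>m (p + p) r) (0\<^sub>m r (p + p)) ?F)"
      by (rule similar_swap) (auto simp: carrier_mat_def)
    moreover have "word_from ((p + p) + r) 4 (four_block_mat ?X (0\<^sub>m (p + p) r) (0\<^sub>m r (p + p)) ?F)
       (four_block_mat (diag01 (p + p) {..<p}) (0\<^sub>m (p + p) r) (0\<^sub>m r (p + p)) ?F)"
      using word_from_direct_sum[OF two word_from_diag01_scalar[OF two l]] by simp
    ultimately have "word_from ((p + p) + r) 4 (four_block_mat ?F (0\<^sub>m r (p + p)) (0\<^sub>m (p + p) r) ?X)
       (four_block_mat (diag01 (p + p) {..<p}) (0\<^sub>m (p + p) r) (0\<^sub>m r (p + p)) ?F)"
      by (rule word_from.sim[rotated])
    moreover have "is_word_value jordan_prod (carrier_mat ((p + p) + r) ((p + p) + r)) 1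
      (four_block_mat (diag01 (p + p) {..<p}) (0\<^sub>m (p + p) r) (0\<^sub>m r (p + p)) ?F)"
      by (rule is_word_value_idem[OF two]) (simp_all add: block_simps diag01_idem)
    ultimately show ?thesis
      unfolding eq n using is_word_value_word_from[OF two] by fastforce
  qed
  show ?thesis using p
  proof (induction j arbitrary: p q S)
    case 0
    then show ?case using base by simp
  next
    case (Suc j)
    show ?case
    proof (cases "p \<le> q")
      case True
      show ?thesis by (rule is_word_value_mono[OF base[OF True]]) simp
    next
      case False
      then obtain r where p: "p = q + r" by (metis le_add_diff_inverse nat_le_linear)
      let ?X = "four_block_mat (diag01 q S) (0\<^sub>m q q) (0\<^sub>m q q) (l \<cdot>\<^sub>m 1\<^sub>m q)"
      have "l \<cdot>\<^sub>m 1\<^sub>m (q + r) = four_block_mat (l \<cdot>\<^sub>m 1\<^sub>m q) (0\<^sub>m q r) (0\<^sub>m r q) (l \<cdot>\<^sub>m 1\<^sub>m r)"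
        by (intro eq_matI) auto
      then have eq: "four_block_mat (diag01 q S) (0\<^sub>m q p) (0\<^sub>m p q) (l \<cdot>\<^sub>m 1\<^sub>m p)
        = four_block_mat ?X (0\<^sub>m (q + q) r) (0\<^sub>m r (q + q)) (l \<cdot>\<^sub>m 1\<^sub>m r)"
        unfolding p by (subst direct_sum_assoc[of _ q]) (auto simp: carrier_mat_def)
      have "word_from ((q + q) + r) 4 (four_block_mat ?X (0\<^sub>m (q + q) r) (0\<^sub>m r (q + q)) (l \<cdot>\<^sub>m 1\<^sub>m r))
        (four_block_mat (diag01 (q + q) {..<q}) (0\<^sub>m (q + q) r) (0\<^sub>m r (q + q)) (l \<cdot>\<^sub>m 1\<^sub>m r))"
        using word_from_direct_sum[OF two word_from_diag01_scalar[OF two l]] by simp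
      moreover have "is_word_value jordan_prod (carrier_mat ((q + q) + r) ((q + q) + r)) (4 * j + 5)
        (four_block_mat (diag01 (q + q) {..<q}) (0\<^sub>m (q + q) r) (0\<^sub>m r (q + q)) (l \<cdot>\<^sub>m 1\<^sub>m r))"
        using Suc(2) p by (intro Suc(1)) (simp add: algebra_simps)
      ultimately have "is_word_value jordan_prod (carrier_mat ((q + q) + r) ((q + q) + r)) (4 * j + 5 + 4)
        (four_block_mat ?X (0\<^sub>m (q + q) r) (0\<^sub>m r (q + q)) (l \<cdot>\<^sub>m 1\<^sub>m r))"
        by (rule is_word_value_word_from[OF two])
      moreover have "q + p = (q + q) + r" "4 * Suc j + 5 = 4 * j + 5 + 4" using p by simp_all
      ultimately show ?thesis unfolding eq by (simp only:)
    qed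
  qed
qed

section \<open>A normal form with a scalar corner\<close>

text \<open>Unit vectors and sums of two of them test all entries of \<open>D\<close>, and a coordinate functional is a left inverse of each.\<close>

lemma all_vectors_eigen_imp_scalar:
  fixes D :: "'a :: field mat"
  assumes D: "D \<in> carrier_mat p p"
    and dep: "\<And>z. z \<in> carrier_mat p 1 \<Longrightarrow> \<not> left_invertible (hcat z (D * z))"
  shows "\<exists>l. D = l \<cdot>\<^sub>m 1\<^sub>m p"
proof -
  have eig: "\<exists>c. \<forall>i<p. (D * z) $$ (i, 0) = z $$ (i, 0) * c"
    if z: "z \<in> carrier_mat p 1" and L: "L \<in> carrier_mat 1 p" "L * z = 1\<^sub>m 1" for z L
  proof -
    have Dz: "D * z \<in> carrier_mat p 1" using D z by (simp add: carrier_mat_def)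
    then have "z * (L * (D * z)) = D * z"
      using left_invertible_hcat_col[OF z L(1) Dz L(2)] dep[OF z] by blast
    moreover have "(z * (L * (D * z))) $$ (i, 0) = z $$ (i, 0) * (L * (D * z)) $$ (0, 0)" if "i < p" for i
    proof -
      have "(z * M) $$ (i, 0) = z $$ (i, 0) * M $$ (0, 0)" if "M \<in> carrier_mat 1 1" for M
        using that \<open>i < p\<close> z by (auto simp: carrier_mat_def scalar_prod_def)
      then show ?thesis using Dz L(1) by (simp add: carrier_mat_def del: index_mult_mat(1))
    qed
    ultimately show ?thesis by (metis (no_types, lifting))
  qed
  have u1: "(unit_col p j)\<^sup>T * unit_col p j = (1\<^sub>m 1 :: 'a mat)" if "j < p" for j
    using that unit_row_mult_index[of j "unit_col p j :: 'a mat" 0]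
    by (intro eq_matI) (auto simp: unit_col_def simp del: index_mult_mat(1))
  have u2: "(unit_col p i)\<^sup>T * unit_col p j = (0\<^sub>m 1 1 :: 'a mat)" if "i < p" "j < p" "i \<noteq> j" for i j
    using that unit_row_mult_index[of i "unit_col p j :: 'a mat" 0]
    by (intro eq_matI) (auto simp: unit_col_def simp del: index_mult_mat(1))
  have uc: "unit_col p j \<in> carrier_mat p 1" "(unit_col p j)\<^sup>T \<in> carrier_mat 1 p" for j
    by (simp_all add: carrier_mat_def)
  have Du: "(D * unit_col p j) $$ (i, 0) = D $$ (i, j)" if "i < p" "j < p" for i j
    using that D mult_unit_col_index[of i D j] by (simp add: carrier_mat_def del: index_mult_mat(1))
  have off: "D $$ (i, j) = 0" if "i < p" "j < p" "i \<noteq> j" for i j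
  proof -
    obtain c where "\<forall>i<p. (D * unit_col p j) $$ (i, 0) = unit_col p j $$ (i, 0) * c"
      using eig[OF uc u1[OF \<open>j < p\<close>]] by blast
    then show ?thesis using Du that by (simp add: unit_col_def del: index_mult_mat(1))
  qed
  have diag: "D $$ (i, i) = D $$ (j, j)" if "i < p" "j < p" "i \<noteq> j" for i j
  proof -
    let ?z = "unit_col p i + unit_col p j :: 'a mat"
    have "(unit_col p i)\<^sup>T * ?z = 1\<^sub>m 1" using u1 u2 that by (simp add: mm_simps)
    moreover have "?z \<in> carrier_mat p 1" by (simp add: carrier_mat_def)
    ultimately obtain c where c: "\<forall>r<p. (D * ?z) $$ (r, 0) = ?z $$ (r, 0) * c"
      using eig[OF _ uc(2)] by blast
    have "(D * ?z) $$ (r, 0) = D $$ (r, i) + D $$ (r, j)" if "r < p" for r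
    proof -
      have "(D * ?z) $$ (r, 0) = (D * unit_col p i) $$ (r, 0) + (D * unit_col p j) $$ (r, 0)"
        using D that by (simp add: mm_simps del: index_mult_mat(1))
      then show ?thesis using Du \<open>i < p\<close> \<open>j < p\<close> that by simp
    qed
    then have "D $$ (i, i) + D $$ (i, j) = c" "D $$ (j, i) + D $$ (j, j) = c"
      using c that by (auto simp: unit_col_def)
    then show ?thesis using off that by simp
  qed
  have "D = D $$ (0, 0) \<cdot>\<^sub>m 1\<^sub>m p"
  proof (rule eq_matI)
    fix i j assume ij: "i < dim_row (D $$ (0, 0) \<cdot>\<^sub>m 1\<^sub>m p)" "j < dim_col (D $$ (0, 0) \<cdot>\<^sub>m 1\<^sub>m p)"
    then show "D $$ (i, j) = (D $$ (0, 0) \<cdot>\<^sub>m 1\<^sub>m p) $$ (i, j)"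
      using off[of i j] diag[of 0 j] by (cases "j = 0") auto
  qed (use D in \<open>auto simp: carrier_mat_def\<close>)
  then show ?thesis by blast
qed

text \<open>In a basis \<open>(A W, W)\<close> these are the projection onto \<open>W\<close> along \<open>A W\<close> and the map that
  kills \<open>A W\<close> and agrees with \<open>A\<close> on \<open>W\<close>. Hence \<open>C * corner_proj m = corner_shift m\<close> says that \<open>C\<close> has
  second block column \<open>(1, 0)\<close>, and \<open>G * corner_proj m = 0\<close> that \<open>G\<close> vanishes on \<open>W\<close>.\<close>

definition corner_proj :: "nat \<Rightarrow> 'a :: field mat" where
  "corner_proj m = four_block_mat (0\<^sub>m m m) (0\<^sub>m m m) (0\<^sub>m m m) (1\<^sub>m m)"

definition corner_shift :: "nat \<Rightarrow> 'a :: field mat" where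
  "corner_shift m = four_block_mat (0\<^sub>m m m) (1\<^sub>m m) (0\<^sub>m m m) (0\<^sub>m m m)"

lemma corner_carrier [simp]:
  "corner_proj m \<in> carrier_mat (m + m) (m + m)" "corner_shift m \<in> carrier_mat (m + m) (m + m)"
  "dim_row (corner_proj m) = m + m" "dim_col (corner_proj m) = m + m"
  "dim_row (corner_shift m) = m + m" "dim_col (corner_shift m) = m + m"
  by (auto simp: corner_proj_def corner_shift_def)

text \<open>Let the columns of \<open>W\<close> be as many as possible with \<open>(A W, W)\<close> independent, and complete by
  \<open>Z\<close> to a basis. If the corner \<open>D\<close> of \<open>A\<close> on \<open>Z\<close> were not scalar, some \<open>z\<close> and \<open>D z\<close> would be
  independent, and \<open>W\<close> could be enlarged by \<open>Z z\<close>.\<close>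

lemma similar_scalar_corner:
  fixes A :: "'a :: field mat"
  assumes A: "A \<in> carrier_mat n n"
  shows "\<exists>m p l C B G. n = (m + m) + p \<and> C \<in> carrier_mat (m + m) (m + m) \<and> B \<in> carrier_mat (m + m) p
    \<and> G \<in> carrier_mat p (m + m) \<and> similar_mat A (four_block_mat C B G (l \<cdot>\<^sub>m 1\<^sub>m p))
    \<and> C * corner_proj m = corner_shift m \<and> G * corner_proj m = 0\<^sub>m p (m + m)"
proof -
  let ?P = "\<lambda>m. \<exists>W \<in> carrier_mat n m. left_invertible (hcat (A * W) W)"
  have "0\<^sub>m 0 n * hcat (A * 0\<^sub>m n 0) (0\<^sub>m n 0) = 1\<^sub>m 0"
    by (intro eq_matI) auto
  then have "left_invertible (hcat (A * 0\<^sub>m n 0) (0\<^sub>m n 0))"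
    unfolding left_invertible_def using A by (intro bexI[of _ "0\<^sub>m 0 n"]) (simp_all add: carrier_mat_def)
  then have P0: "?P 0" by (intro bexI[of _ "0\<^sub>m n 0"]) auto
  have "m \<le> n" if m: "?P m" for m
  proof -
    obtain W where "W \<in> carrier_mat n m" "left_invertible (hcat (A * W) W)" using m by blast
    then show ?thesis using left_invertible_le[of "hcat (A * W) W"] A by (simp add: carrier_mat_def)
  qed
  then obtain m where "?P m" and max: "\<And>m'. ?P m' \<Longrightarrow> m' \<le> m"
    using Nat.ex_has_greatest_nat[of ?P 0 n] P0 by meson
  then obtain W where W: "W \<in> carrier_mat n m" "left_invertible (hcat (A * W) W)" by blast
  define K where "K = hcat (A * W) W"
  have K: "K \<in> carrier_mat n (m + m)" using A W(1) by (simp add: K_def carrier_mat_def)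
  define p where "p = n - (m + m)"
  have n: "n = (m + m) + p" using left_invertible_le[OF W(2)] A W(1) by (simp add: p_def carrier_mat_def)
  obtain Z where Z: "Z \<in> carrier_mat n p" "left_invertible (hcat K Z)"
    using left_invertible_complete[OF W(2)[folded K_def] K] by (auto simp: p_def)
  let ?T = "hcat K Z"
  have T: "?T \<in> carrier_mat n n" using K Z n by (simp add: carrier_mat_def)
  obtain S where S: "S \<in> carrier_mat n n" "S * ?T = 1\<^sub>m n"
    using Z(2) T unfolding left_invertible_def by (auto simp: carrier_mat_def)
  have TS: "?T * S = 1\<^sub>m n" using mat_mult_left_right_inverse[OF S(1) T S(2)] .
  obtain S1 S2 where S12: "S = vcat S1 S2" "S1 \<in> carrier_mat (m + m) n" "S2 \<in> carrier_mat p n"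
    using vcat_ex[of S "m + m" p n] S(1) n by blast
  have "four_block_mat (S1 * K) (S1 * Z) (S2 * K) (S2 * Z) = S * ?T"
    unfolding S12(1) using S12(2,3) K Z by (subst vcat_hcat) (auto simp: carrier_mat_def)
  also have "\<dots> = four_block_mat (1\<^sub>m (m + m)) (0\<^sub>m (m + m) p) (0\<^sub>m p (m + m)) (1\<^sub>m p)"
    unfolding S n by simp
  finally have ST: "S1 * K = 1\<^sub>m (m + m)" "S1 * Z = 0\<^sub>m (m + m) p" "S2 * K = 0\<^sub>m p (m + m)" "S2 * Z = 1\<^sub>m p"
    using fb_inject[of "S1 * K" "S1 * Z" "S2 * K" "S2 * Z" "1\<^sub>m (m + m)" "0\<^sub>m (m + m) p" "0\<^sub>m p (m + m)" "1\<^sub>m p"]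
      S12(2,3) K Z(1) by (auto simp: carrier_mat_def)
  define C where "C = S1 * (A * K)"
  define B where "B = S1 * (A * Z)"
  define G where "G = S2 * (A * K)"
  define D where "D = S2 * (A * Z)"
  have car: "C \<in> carrier_mat (m + m) (m + m)" "B \<in> carrier_mat (m + m) p" "G \<in> carrier_mat p (m + m)" "D \<in> carrier_mat p p"
    using A K Z S12(2,3) by (auto simp: C_def B_def G_def D_def carrier_mat_def)
  have AK: "A * (K * corner_proj m) = K * corner_shift m"
  proof -
    have "K * corner_proj m = hcat (0\<^sub>m n m) W" "K * corner_shift m = hcat (0\<^sub>m n m) (A * W)"
      unfolding K_def corner_proj_def corner_shift_def using A W(1)
      by (subst hcat_fb; auto simp: mm_simps)+
    then show ?thesis using A W(1) by (simp only:, subst mult_hcat) (auto simp: mm_simps)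
  qed
  have Cf: "C * corner_proj m = corner_shift m"
  proof -
    have "C * corner_proj m = S1 * (A * (K * corner_proj m))"
      unfolding C_def using A K S12(2) by (simp add: mm_simps)
    also have "\<dots> = (S1 * K) * corner_shift m"
      unfolding AK using K S12(2) by (simp add: mm_simps)
    finally show ?thesis unfolding ST by (simp add: mm_simps)
  qed
  have Gf: "G * corner_proj m = 0\<^sub>m p (m + m)"
  proof -
    have "G * corner_proj m = S2 * (A * (K * corner_proj m))"
      unfolding G_def using A K S12(3) by (simp add: mm_simps)
    also have "\<dots> = (S2 * K) * corner_shift m"
      unfolding AK using K S12(3) by (simp add: mm_simps)
    finally show ?thesis unfolding ST by (simp add: mm_simps)
  qed
  have sim: "similar_mat A (four_block_mat C B G D)"
  proof (rule similar_by[OF A _ T S(1) TS])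
    have "four_block_mat C B G D = S * (A * ?T)"
      unfolding S12(1) C_def B_def G_def D_def using S12(2,3) K Z(1) A
      by (subst mult_hcat; (subst vcat_hcat)?) (auto simp: carrier_mat_def)
    then have "?T * four_block_mat C B G D = ?T * (S * (A * ?T))" by simp
    also have "\<dots> = (?T * S) * (A * ?T)"
      using T S(1) A by (intro mm_assoc[symmetric]) (auto simp: carrier_mat_def)
    also have "\<dots> = A * ?T" unfolding TS using A by (simp add: mm_simps)
    finally show "A * ?T = ?T * four_block_mat C B G D" by simp
    show "four_block_mat C B G D \<in> carrier_mat n n" using car n by (simp add: carrier_mat_def)
  qed
  have "\<not> left_invertible (hcat z (D * z))" if z: "z \<in> carrier_mat p 1" for z
  proof
    assume "left_invertible (hcat z (D * z))"
    then obtain L where L: "L \<in> carrier_mat (1 + 1) p" "L * hcat z (D * z) = 1\<^sub>m (1 + 1)"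
      using z car unfolding left_invertible_def by (auto simp: carrier_mat_def)
    \<comment> \<open>Coordinate functionals dual to \<open>z\<close> and \<open>D z\<close>.\<close>
    obtain r2 r1 where r: "L = vcat r2 r1" "r2 \<in> carrier_mat 1 p" "r1 \<in> carrier_mat 1 p"
      using vcat_ex[OF L(1)] by blast
    have "four_block_mat (r2 * z) (r2 * (D * z)) (r1 * z) (r1 * (D * z)) = L * hcat z (D * z)"
      unfolding r(1) using r(2,3) z car(4) by (subst vcat_hcat) (auto simp: carrier_mat_def)
    also have "\<dots> = four_block_mat (1\<^sub>m 1) (0\<^sub>m 1 1) (0\<^sub>m 1 1) (1\<^sub>m 1)"
      unfolding L(2) by simp
    finally have rz: "r2 * z = 1\<^sub>m 1" "r2 * (D * z) = 0\<^sub>m 1 1" "r1 * z = 0\<^sub>m 1 1" "r1 * (D * z) = 1\<^sub>m 1"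
      using fb_inject[of "r2 * z" "r2 * (D * z)" "r1 * z" "r1 * (D * z)" "1\<^sub>m 1" "0\<^sub>m 1 1" "0\<^sub>m 1 1" "1\<^sub>m 1"]
        r(2,3) z car(4) by (auto simp: carrier_mat_def)
    obtain \<alpha> \<beta> where ab: "S1 = vcat \<alpha> \<beta>" "\<alpha> \<in> carrier_mat m n" "\<beta> \<in> carrier_mat m n"
      using vcat_ex[OF S12(2)] by blast
    have "four_block_mat (\<alpha> * (A * W)) (\<alpha> * W) (\<beta> * (A * W)) (\<beta> * W) = S1 * K"
      unfolding ab(1) K_def using ab(2,3) A W(1) by (subst vcat_hcat) (auto simp: carrier_mat_def)
    also have "\<dots> = four_block_mat (1\<^sub>m m) (0\<^sub>m m m) (0\<^sub>m m m) (1\<^sub>m m)"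
      unfolding ST by simp
    finally have abW: "\<alpha> * (A * W) = 1\<^sub>m m" "\<alpha> * W = 0\<^sub>m m m" "\<beta> * (A * W) = 0\<^sub>m m m" "\<beta> * W = 1\<^sub>m m"
      using fb_inject[of "\<alpha> * (A * W)" "\<alpha> * W" "\<beta> * (A * W)" "\<beta> * W" "1\<^sub>m m" "0\<^sub>m m m" "0\<^sub>m m m" "1\<^sub>m m"]
        ab(2,3) A W(1) by (auto simp: carrier_mat_def)
    have "vcat (\<alpha> * Z) (\<beta> * Z) = S1 * Z"
      unfolding ab(1) using ab(2,3) Z by (subst vcat_mult) (auto simp: carrier_mat_def)
    also have "\<dots> = vcat (0\<^sub>m m p) (0\<^sub>m m p)" unfolding ST by (intro eq_matI) auto
    finally have abZ: "\<alpha> * Z = 0\<^sub>m m p" "\<beta> * Z = 0\<^sub>m m p"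
      using fb_inject[of "\<alpha> * Z" "0\<^sub>m m 0" "\<beta> * Z" "0\<^sub>m m 0" "0\<^sub>m m p" "0\<^sub>m m 0" "0\<^sub>m m p" "0\<^sub>m m 0"]
        ab(2,3) Z(1) by (auto simp: carrier_mat_def)
    have "hcat (S2 * (A * W)) (S2 * W) = S2 * K"
      unfolding K_def using S12(3) A W(1) by (subst mult_hcat) (auto simp: carrier_mat_def)
    also have "\<dots> = hcat (0\<^sub>m p m) (0\<^sub>m p m)" unfolding ST by (intro eq_matI) auto
    finally have S2W: "S2 * (A * W) = 0\<^sub>m p m" "S2 * W = 0\<^sub>m p m"
      using fb_inject[of "S2 * (A * W)" "S2 * W" "0\<^sub>m 0 m" "0\<^sub>m 0 m" "0\<^sub>m p m" "0\<^sub>m p m" "0\<^sub>m 0 m" "0\<^sub>m 0 m"]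
        S12(3) A W(1) by (auto simp: carrier_mat_def)
    have Zz: "\<alpha> * (Z * z) = 0\<^sub>m m 1" "\<beta> * (Z * z) = 0\<^sub>m m 1" "S2 * (Z * z) = z" "S2 * (A * (Z * z)) = D * z"
      using mm_assoc[of \<alpha> Z z] mm_assoc[of \<beta> Z z] mm_assoc[of S2 Z z] mm_assoc[of A Z z] mm_assoc[of S2 "A * Z" z]
        abZ ST z Z(1) ab(2,3) S12(3) A by (auto simp: carrier_mat_def mm_one mm_zero D_def)
    \<comment> \<open>\<open>b1\<close> and \<open>b2\<close> are the coordinates of \<open>A Z z\<close> along \<open>A W\<close> and \<open>W\<close>; its coordinate along \<open>Z\<close> is \<open>D z\<close>.\<close>
    define b1 where "b1 = \<alpha> * (A * (Z * z))"
    define b2 where "b2 = \<beta> * (A * (Z * z))"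
    have b: "b1 \<in> carrier_mat m 1" "b2 \<in> carrier_mat m 1"
      using ab(2,3) A Z(1) z by (auto simp: b1_def b2_def carrier_mat_def)
    let ?W = "hcat W (Z * z)"
    let ?L = "vcat (vcat (\<alpha> + (-1) \<cdot>\<^sub>m (b1 * (r1 * S2))) (r1 * S2)) (vcat (\<beta> + (-1) \<cdot>\<^sub>m (b2 * (r1 * S2))) (r2 * S2))"
    have W': "?W \<in> carrier_mat n (m + 1)" using W(1) Z(1) z by (auto simp: carrier_mat_def)
    have "?L * hcat (A * ?W) ?W = 1\<^sub>m ((m + 1) + (m + 1))"
    proof -
      have AW: "A * ?W = hcat (A * W) (A * (Z * z))" using A W(1) Z(1) z by (subst mult_hcat) (auto simp: carrier_mat_def)
      have one: "1\<^sub>m (m + 1) = four_block_mat (1\<^sub>m m) (0\<^sub>m m 1) (0\<^sub>m 1 m) (1\<^sub>m 1 :: 'a mat)"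
        "0\<^sub>m (m + 1) (m + 1) = four_block_mat (0\<^sub>m m m) (0\<^sub>m m 1) (0\<^sub>m 1 m) (0\<^sub>m 1 1 :: 'a mat)" by auto
      note cc = ab(2,3) b r(2,3) S12(3) A W(1) Z(1) z car(4)
      note ev = abW abZ S2W Zz rz b1_def[symmetric] b2_def[symmetric] smult_zero_mat
      have "vcat (\<alpha> + (-1) \<cdot>\<^sub>m (b1 * (r1 * S2))) (r1 * S2) * hcat (A * W) (A * (Z * z)) = 1\<^sub>m (m + 1)"
        unfolding one using cc by (subst vcat_hcat; simp add: mm_simps ev del: four_block_one_mat)
          (intro cong_four_block_mat; intro eq_matI; auto)
      moreover have "vcat (\<alpha> + (-1) \<cdot>\<^sub>m (b1 * (r1 * S2))) (r1 * S2) * hcat W (Z * z) = 0\<^sub>m (m + 1) (m + 1)"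
        unfolding one using cc by (subst vcat_hcat; simp add: mm_simps ev del: four_block_zero_mat)
      moreover have "vcat (\<beta> + (-1) \<cdot>\<^sub>m (b2 * (r1 * S2))) (r2 * S2) * hcat (A * W) (A * (Z * z)) = 0\<^sub>m (m + 1) (m + 1)"
        unfolding one using cc by (subst vcat_hcat; simp add: mm_simps ev del: four_block_zero_mat)
          (intro cong_four_block_mat; intro eq_matI; auto)
      moreover have "vcat (\<beta> + (-1) \<cdot>\<^sub>m (b2 * (r1 * S2))) (r2 * S2) * hcat W (Z * z) = 1\<^sub>m (m + 1)"
        unfolding one using cc by (subst vcat_hcat; simp add: mm_simps ev del: four_block_one_mat)
      ultimately show ?thesis
        unfolding AW fb_one using cc by (subst vcat_hcat) (auto simp: carrier_mat_def)
    qed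
    then have "left_invertible (hcat (A * ?W) ?W)"
      unfolding left_invertible_def using ab(2,3) b r(2,3) S12(3) A W' W(1) Z(1) z
      by (intro bexI[of _ ?L]) (auto simp: carrier_mat_def)
    then have "?P (m + 1)" by (rule bexI[OF _ W'])
    from max[OF this] show False by simp
  qed
  then obtain l where "D = l \<cdot>\<^sub>m 1\<^sub>m p" using all_vectors_eigen_imp_scalar[OF car(4)] by blast
  then show ?thesis using n car Cf Gf sim by blast
qed

text \<open>Here \<open>f\<close> is the projection onto \<open>W\<close> along \<open>A W\<close>, and \<open>J\<close> maps \<open>A W\<close> back to \<open>W\<close>. Replacing the
  complementary basis vectors \<open>Z\<close> by \<open>Z - J B\<close> cancels the component of their images along \<open>A W\<close>,
  so that afterwards the border takes its values in \<open>W\<close>.\<close>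

lemma similar_clear_corner:
  fixes C :: "'a :: field mat"
  assumes c: "C \<in> carrier_mat N N" "f \<in> carrier_mat N N" "J \<in> carrier_mat N N" "B \<in> carrier_mat N p" "G \<in> carrier_mat p N"
    and J: "f * J = J" "C * J = 1\<^sub>m N + (-1) \<cdot>\<^sub>m f" and G: "G * f = 0\<^sub>m p N"
  shows "similar_mat (four_block_mat C B G (l \<cdot>\<^sub>m 1\<^sub>m p))
    (four_block_mat (C + J * (B * G)) (f * B + l \<cdot>\<^sub>m (J * B)) G (l \<cdot>\<^sub>m 1\<^sub>m p))"
proof -
  have GJ: "G * (J * z) = 0\<^sub>m p (dim_col z)" if "dim_row z = N" for z
  proof -
    have "G * (J * z) = G * ((f * J) * z)" by (simp only: J)
    also have "\<dots> = (G * f) * (J * z)" using c that by (simp add: mm_simps)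
    finally show ?thesis unfolding G using c that by (simp add: mm_simps)
  qed
  have CJ: "C * (J * z) = z + (-1) \<cdot>\<^sub>m (f * z)" if "dim_row z = N" for z
  proof -
    have "C * (J * z) = (C * J) * z" using c that by (simp add: mm_simps)
    then show ?thesis unfolding J using c that by (simp add: mm_simps)
  qed
  show ?thesis
  proof (rule similar_by[where n = "N + p" and T = "four_block_mat (1\<^sub>m N) ((-1) \<cdot>\<^sub>m (J * B)) (0\<^sub>m p N) (1\<^sub>m p)"
          and S = "four_block_mat (1\<^sub>m N) (J * B) (0\<^sub>m p N) (1\<^sub>m p)"])
    show "four_block_mat (1\<^sub>m N) ((-1) \<cdot>\<^sub>m (J * B)) (0\<^sub>m p N) (1\<^sub>m p) * four_block_mat (1\<^sub>m N) (J * B) (0\<^sub>m p N) (1\<^sub>m p)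
        = 1\<^sub>m (N + p)"
      unfolding fb_one using c
      by (simp add: block_simps del: four_block_one_mat) (intro cong_four_block_mat; intro eq_matI; auto simp del: index_mult_mat(1))
    show "four_block_mat C B G (l \<cdot>\<^sub>m 1\<^sub>m p) * four_block_mat (1\<^sub>m N) ((-1) \<cdot>\<^sub>m (J * B)) (0\<^sub>m p N) (1\<^sub>m p) =
      four_block_mat (1\<^sub>m N) ((-1) \<cdot>\<^sub>m (J * B)) (0\<^sub>m p N) (1\<^sub>m p) *
      four_block_mat (C + J * (B * G)) (f * B + l \<cdot>\<^sub>m (J * B)) G (l \<cdot>\<^sub>m 1\<^sub>m p)"
      using c by (simp add: block_simps GJ CJ) (intro cong_four_block_mat; intro eq_matI; auto simp: algebra_simps simp del: index_mult_mat(1))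
  qed (use c in \<open>auto simp: carrier_mat_def\<close>)
qed

text \<open>One backward step removes a border \<open>B\<close> with values in \<open>W\<close>. Tilting the kernel of the projection
  onto \<open>W\<close> by a multiple of \<open>B\<close> and choosing the free corner as \<open>1 - 3 l\<close> times that projection
  makes the columns of \<open>Z + 2 B\<close> eigenvectors of the new matrix for the eigenvalue \<open>l\<close>.\<close>

lemma word_from_clear_column:
  fixes C :: "'a :: field mat"
  assumes two: "(2 :: 'a) \<noteq> 0"
    and c: "C \<in> carrier_mat N N" "f \<in> carrier_mat N N" "B \<in> carrier_mat N p" "G \<in> carrier_mat p N"
    and f: "f * f = f" "f * (C * f) = 0\<^sub>m N N" and B: "f * B = B" and G: "G * f = 0\<^sub>m p N"
  shows "word_from (N + p) 1 (four_block_mat C B G (l \<cdot>\<^sub>m 1\<^sub>m p))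
    (four_block_mat (C + C * f + f * C + (-6) \<cdot>\<^sub>m (B * G) + (1 - 3 * l) \<cdot>\<^sub>m f) (0\<^sub>m N p) G (l \<cdot>\<^sub>m 1\<^sub>m p))"
proof -
  let ?x = "four_block_mat C B G (l \<cdot>\<^sub>m 1\<^sub>m p)"
  \<comment> \<open>With a tilt \<open>- u\<close> and free corner \<open>\<mu>\<close>, the border left after straightening is \<open>2 B - u (3 l + \<mu>) / 2\<close>; it vanishes for \<open>\<mu> = 1 - 3 l\<close> and \<open>u = 4 B\<close>.\<close>
  let ?F = "four_block_mat f ((-4) \<cdot>\<^sub>m B) (0\<^sub>m p N) (0\<^sub>m p p)"
  let ?D = "(1 - 3 * l) \<cdot>\<^sub>m 1\<^sub>m (N + p)"
  let ?K = "C + C * f + f * C + (-6) \<cdot>\<^sub>m (B * G) + (1 - 3 * l) \<cdot>\<^sub>m f"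
  have GB: "G * B = 0\<^sub>m p p"
  proof -
    have "G * B = (G * f) * B" using c B by (simp add: mm_simps)
    then show ?thesis unfolding G using c by (simp add: mm_simps)
  qed
  have fCB: "f * (C * B) = 0\<^sub>m N p"
  proof -
    have "f * (C * B) = f * (C * (f * B))" by (simp only: B)
    also have "\<dots> = (f * (C * f)) * B" using c by (simp add: mm_simps)
    finally show ?thesis unfolding f using c by (simp add: mm_simps)
  qed
  have FF: "?F * ?F = ?F" using c f B by (simp add: block_simps)
  have "?F * (?x * ?F) = 0\<^sub>m (N + p) (N + p)"
    unfolding fb_zero using c f B G GB fCB by (simp add: block_simps)
      ((intro cong_four_block_mat; intro eq_matI; auto simp del: index_mult_mat(1))?)
  then have "word_from (N + p) 1 ?x (?x + ?x * ?F + ?F * ?x + ?F * (?D * ?F))"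
    using c by (intro word_from_step[OF two _ _ _ FF]) (auto simp: carrier_mat_def)
  moreover have "similar_mat (?x + ?x * ?F + ?F * ?x + ?F * (?D * ?F)) (four_block_mat ?K (0\<^sub>m N p) G (l \<cdot>\<^sub>m 1\<^sub>m p))"
  proof (rule similar_by[where n = "N + p" and T = "four_block_mat (1\<^sub>m N) (2 \<cdot>\<^sub>m B) (0\<^sub>m p N) (1\<^sub>m p)"
          and S = "four_block_mat (1\<^sub>m N) ((-2) \<cdot>\<^sub>m B) (0\<^sub>m p N) (1\<^sub>m p)"])
    show "four_block_mat (1\<^sub>m N) (2 \<cdot>\<^sub>m B) (0\<^sub>m p N) (1\<^sub>m p) * four_block_mat (1\<^sub>m N) ((-2) \<cdot>\<^sub>m B) (0\<^sub>m p N) (1\<^sub>m p)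
        = 1\<^sub>m (N + p)"
      unfolding fb_one using c
      by (simp add: block_simps del: four_block_one_mat) (intro cong_four_block_mat; intro eq_matI; auto simp del: index_mult_mat(1))
    have "?F * (?D * ?F) = (1 - 3 * l) \<cdot>\<^sub>m ?F" using c FF by (simp add: mm_simps)
    then show "(?x + ?x * ?F + ?F * ?x + ?F * (?D * ?F)) * four_block_mat (1\<^sub>m N) (2 \<cdot>\<^sub>m B) (0\<^sub>m p N) (1\<^sub>m p) =
      four_block_mat (1\<^sub>m N) (2 \<cdot>\<^sub>m B) (0\<^sub>m p N) (1\<^sub>m p) * four_block_mat ?K (0\<^sub>m N p) G (l \<cdot>\<^sub>m 1\<^sub>m p)"
      using c f B G GB fCB
      by (simp add: block_simps) (intro cong_four_block_mat; intro eq_matI; auto simp: algebra_simps simp del: index_mult_mat(1))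
  qed (use c in \<open>auto simp: carrier_mat_def\<close>)
  ultimately show ?thesis
    using word_from_trans[OF _ word_from_similar, of "N + p" 1] c by (fastforce simp: carrier_mat_def)
qed

lemma word_from_scalar_corner:
  fixes C :: "'a :: field mat"
  assumes two: "(2 :: 'a) \<noteq> 0"
    and c: "C \<in> carrier_mat (m + m) (m + m)" "B \<in> carrier_mat (m + m) p" "G \<in> carrier_mat p (m + m)"
    and C: "C * corner_proj m = corner_shift m" and G: "G * corner_proj m = 0\<^sub>m p (m + m)"
  shows "\<exists>a \<in> carrier_mat m m. \<exists>b \<in> carrier_mat m m. \<exists>G' \<in> carrier_mat p (m + m).
    word_from ((m + m) + p) 1 (four_block_mat C B G (l \<cdot>\<^sub>m 1\<^sub>m p))
      (four_block_mat (companion_block m a b) (0\<^sub>m (m + m) p) G' (l \<cdot>\<^sub>m 1\<^sub>m p))"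
proof -
  let ?N = "m + m" and ?f = "corner_proj m :: 'a mat"
  \<comment> \<open>\<open>?J\<close> undoes on \<open>A W\<close> what \<open>C\<close> does on \<open>W\<close>.\<close>
  let ?J = "four_block_mat (0\<^sub>m m m) (0\<^sub>m m m) (1\<^sub>m m) (0\<^sub>m m m) :: 'a mat"
  let ?I = "four_block_mat (0\<^sub>m m m) (1\<^sub>m m) (1\<^sub>m m) (0\<^sub>m m m) :: 'a mat"
  have ff: "?f * ?f = ?f" "?f * corner_shift m = 0\<^sub>m ?N ?N" "?f * ?J = ?J"
    "corner_shift m * ?f = corner_shift m"
    by (simp_all add: corner_proj_def corner_shift_def block_simps)
  have Jc: "?J \<in> carrier_mat ?N ?N" by simp
  have fz: "?f * (?f * z) = ?f * z" "?f * (?J * z) = ?J * z" if "dim_row z = ?N" for z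
    using mm_assoc[of ?f ?f z] mm_assoc[of ?f ?J z] ff that by simp_all
  have "C * ?J = C * (?f * ?I)"
    by (simp add: corner_proj_def block_simps)
  also have "\<dots> = (C * ?f) * ?I" using c by (intro mm_assoc[symmetric]) (auto simp: carrier_mat_def)
  also have "\<dots> = 1\<^sub>m ?N + (-1) \<cdot>\<^sub>m ?f"
    unfolding C fb_one by (simp add: corner_proj_def corner_shift_def block_simps del: four_block_one_mat)
      (intro cong_four_block_mat; intro eq_matI; auto)
  finally have CJ: "C * ?J = 1\<^sub>m ?N + (-1) \<cdot>\<^sub>m ?f" .
  define C' where "C' = C + ?J * (B * G)"
  define B' where "B' = ?f * B + l \<cdot>\<^sub>m (?J * B)"
  have c': "C' \<in> carrier_mat ?N ?N" "B' \<in> carrier_mat ?N p"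
    using c by (auto simp: C'_def B'_def carrier_mat_def)
  have sim: "similar_mat (four_block_mat C B G (l \<cdot>\<^sub>m 1\<^sub>m p)) (four_block_mat C' B' G (l \<cdot>\<^sub>m 1\<^sub>m p))"
    unfolding C'_def B'_def using similar_clear_corner[OF c(1) _ Jc c(2,3) ff(3) CJ G] by simp
  have C'f: "C' * ?f = corner_shift m"
    unfolding C'_def using c Jc C G by (simp add: mm_simps)
  have B'f: "?f * B' = B'" unfolding B'_def using c Jc by (simp add: mm_simps fz)
  let ?K = "C' + C' * ?f + ?f * C' + (-6) \<cdot>\<^sub>m (B' * G) + (1 - 3 * l) \<cdot>\<^sub>m ?f"
  have w: "word_from (?N + p) 1 (four_block_mat C' B' G (l \<cdot>\<^sub>m 1\<^sub>m p))
      (four_block_mat ?K (0\<^sub>m ?N p) G (l \<cdot>\<^sub>m 1\<^sub>m p))"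
    using c c' ff C'f by (intro word_from_clear_column[OF two _ _ _ _ ff(1) _ B'f G]) auto
  have Kc: "?K \<in> carrier_mat ?N ?N" using c c' by (simp add: carrier_mat_def)
  have Kf: "?K * ?f = 2 \<cdot>\<^sub>m corner_shift m + (1 - 3 * l) \<cdot>\<^sub>m ?f"
    using c c' C'f G ff by (simp add: mm_simps) (intro eq_matI; auto simp del: index_mult_mat(1))
  obtain k1 k2 k3 k4 where K: "?K = four_block_mat k1 k2 k3 k4"
    "k1 \<in> carrier_mat m m" "k2 \<in> carrier_mat m m" "k3 \<in> carrier_mat m m" "k4 \<in> carrier_mat m m"
    using fb_ex[OF Kc] by blast
  have "four_block_mat (0\<^sub>m m m) k2 (0\<^sub>m m m) k4 = four_block_mat k1 k2 k3 k4 * ?f"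
    unfolding corner_proj_def using K(2-) by (simp add: block_simps)
  also have "\<dots> = ?K * ?f" unfolding K(1) ..
  also have "\<dots> = four_block_mat (0\<^sub>m m m) (2 \<cdot>\<^sub>m 1\<^sub>m m) (0\<^sub>m m m) ((1 - 3 * l) \<cdot>\<^sub>m 1\<^sub>m m)"
    unfolding Kf by (simp add: corner_proj_def corner_shift_def block_simps)
  finally have k: "k2 = 2 \<cdot>\<^sub>m 1\<^sub>m m" "k4 = (1 - 3 * l) \<cdot>\<^sub>m 1\<^sub>m m"
    using fb_inject[of "0\<^sub>m m m" k2 "0\<^sub>m m m" k4 "0\<^sub>m m m" "2 \<cdot>\<^sub>m 1\<^sub>m m" "0\<^sub>m m m" "(1 - 3 * l) \<cdot>\<^sub>m 1\<^sub>m m"] K(2-)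
    by (auto simp: carrier_mat_def)
  define a where "a = k1 + k4"
  define b where "b = 2 \<cdot>\<^sub>m k3 + (-1) \<cdot>\<^sub>m (k4 * k1)"
  have ab: "a \<in> carrier_mat m m" "b \<in> carrier_mat m m" using K(2-) by (auto simp: a_def b_def carrier_mat_def)
  have Ks: "similar_mat ?K (companion_block m a b)"
    unfolding K(1) a_def b_def k(1) using similar_companion_block[OF two K(2,4,5)] .
  have "word_from ?N 0 ?K (companion_block m a b)"
    using Ks ab by (intro word_from_similar) auto
  then obtain M where M: "M \<in> carrier_mat ?N ?N"
    "word_from (?N + p) 0 (four_block_mat ?K (0\<^sub>m ?N p) G (l \<cdot>\<^sub>m 1\<^sub>m p))
      (four_block_mat (companion_block m a b) (0\<^sub>m ?N p) (G * M) (l \<cdot>\<^sub>m 1\<^sub>m p))"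
    using word_from_lower_triangular[OF two, of ?N 0 ?K "companion_block m a b"] c(3) by force
  have "word_from (?N + p) 1 (four_block_mat C B G (l \<cdot>\<^sub>m 1\<^sub>m p))
      (four_block_mat (companion_block m a b) (0\<^sub>m ?N p) (G * M) (l \<cdot>\<^sub>m 1\<^sub>m p))"
    using word_from.sim[OF word_from_trans[OF w M(2)] sim] by simp
  moreover have "G * M \<in> carrier_mat p ?N" using c M by (simp add: carrier_mat_def)
  ultimately show ?thesis using ab by blast
qed

section \<open>Nonscalar matrices\<close>

text \<open>Of the \<open>4 j + 10\<close> letters, one clears the border, four normalise the companion block, and at most
  \<open>4 j + 5\<close> are spent on the idempotent plus scalar matrix that remains.\<close>

lemma word_value_nonscalar:
  fixes A :: "'a :: field mat"
  assumes two: "(2 :: 'a) \<noteq> 0" and A: "A \<in> carrier_mat n n" "A \<notin> scalar_mats n" and j: "n \<le> 2 ^ j"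
  shows "is_word_value jordan_prod (carrier_mat n n) (4 * j + 10) A"
proof -
  obtain m p l C B G where n: "n = (m + m) + p"
    and c: "C \<in> carrier_mat (m + m) (m + m)" "B \<in> carrier_mat (m + m) p" "G \<in> carrier_mat p (m + m)"
    and sim: "similar_mat A (four_block_mat C B G (l \<cdot>\<^sub>m 1\<^sub>m p))"
    and CG: "C * corner_proj m = corner_shift m" "G * corner_proj m = 0\<^sub>m p (m + m)"
    using similar_scalar_corner[OF A(1)] by blast
  let ?N = "m + m"
  have m: "m \<noteq> 0"
  proof
    assume m: "m = 0"
    have "four_block_mat C B G (l \<cdot>\<^sub>m 1\<^sub>m p) = l \<cdot>\<^sub>m 1\<^sub>m n"
      using n m c by (intro eq_matI) (auto simp: carrier_mat_def)
    then obtain P Q k where "P * Q = 1\<^sub>m k" "A = P * (l \<cdot>\<^sub>m 1\<^sub>m n) * Q" "{A, l \<cdot>\<^sub>m 1\<^sub>m n, P, Q} \<subseteq> carrier_mat k k"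
      using similar_matD[OF sim] by force
    then have "A = l \<cdot>\<^sub>m 1\<^sub>m n" by (auto simp: mm_simps)
    then show False using A(2) by (auto simp: scalar_mats_def)
  qed
  obtain a b G1 where ab: "a \<in> carrier_mat m m" "b \<in> carrier_mat m m" "G1 \<in> carrier_mat p ?N"
    and w1: "word_from (?N + p) 1 (four_block_mat C B G (l \<cdot>\<^sub>m 1\<^sub>m p))
      (four_block_mat (companion_block m a b) (0\<^sub>m ?N p) G1 (l \<cdot>\<^sub>m 1\<^sub>m p))"
    using word_from_scalar_corner[OF two c CG] by blast
  \<comment> \<open>\<open>\<beta> = 0\<close> makes the block idempotent, but to split off the eigenvalue \<open>l\<close>, \<open>\<beta> = l\<^sup>2 - l\<close> must be avoided.\<close>
  define \<beta> where "\<beta> = (if l = 0 \<or> l = 1 then 1 else 0 :: 'a)"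
  let ?Q = "\<lambda>\<beta>. companion_block m (1\<^sub>m m) (\<beta> \<cdot>\<^sub>m 1\<^sub>m m)"
  have QQ: "?Q \<beta> * ?Q \<beta> = ?Q \<beta> + \<beta> \<cdot>\<^sub>m 1\<^sub>m ?N" for \<beta> :: 'a
    unfolding companion_block_def fb_one
    by (simp add: block_simps del: four_block_one_mat)
  have Qc: "?Q \<beta> \<in> carrier_mat ?N ?N" for \<beta> :: 'a by simp
  have lp: "l \<cdot>\<^sub>m 1\<^sub>m p \<in> carrier_mat p p" by simp
  obtain M where M: "M \<in> carrier_mat ?N ?N" "word_from (?N + p) 4
      (four_block_mat (companion_block m a b) (0\<^sub>m ?N p) G1 (l \<cdot>\<^sub>m 1\<^sub>m p))
      (four_block_mat (?Q \<beta>) (0\<^sub>m ?N p) (G1 * M) (l \<cdot>\<^sub>m 1\<^sub>m p))"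
    using word_from_lower_triangular[OF two companion_block_to_scalar[OF two ab(1,2)]] lp ab(3) by blast
  have "\<beta> + l - l * l = \<beta> + l * (1 - l)" by (simp add: algebra_simps)
  moreover have "\<beta> + l * (1 - l) \<noteq> 0" by (auto simp: \<beta>_def)
  ultimately have "\<beta> + l - l * l \<noteq> 0" by (simp only: not_False_eq_True)
  then have "similar_mat (four_block_mat (?Q \<beta>) (0\<^sub>m ?N p) (G1 * M) (l \<cdot>\<^sub>m 1\<^sub>m p))
      (four_block_mat (?Q \<beta>) (0\<^sub>m ?N p) (0\<^sub>m p ?N) (l \<cdot>\<^sub>m 1\<^sub>m p))"
    using ab(3) M(1) by (intro similar_split_eigenspace[OF Qc _ QQ]) (auto simp: carrier_mat_def)
  then have w2: "word_from (?N + p) 0 (four_block_mat (?Q \<beta>) (0\<^sub>m ?N p) (G1 * M) (l \<cdot>\<^sub>m 1\<^sub>m p))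
      (four_block_mat (?Q \<beta>) (0\<^sub>m ?N p) (0\<^sub>m p ?N) (l \<cdot>\<^sub>m 1\<^sub>m p))"
    by (rule word_from_similar) (auto simp: carrier_mat_def companion_block_def)
  have w: "word_from n 5 A (four_block_mat (?Q \<beta>) (0\<^sub>m ?N p) (0\<^sub>m p ?N) (l \<cdot>\<^sub>m 1\<^sub>m p))"
    using word_from.sim[OF word_from_trans[OF w1 word_from_trans[OF M(2) w2]] sim] n by simp
  have z: "(0 :: 'a) \<cdot>\<^sub>m 1\<^sub>m m = 0\<^sub>m m m" by (intro eq_matI) auto
  show ?thesis
  proof (cases "l = 0 \<or> l = 1")
    case True
    then have \<beta>: "\<beta> = 1" by (simp add: \<beta>_def)
    have "word_from (?N + p) 4 (four_block_mat (?Q \<beta>) (0\<^sub>m ?N p) (0\<^sub>m p ?N) (l \<cdot>\<^sub>m 1\<^sub>m p))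
        (four_block_mat (?Q 0) (0\<^sub>m ?N p) (0\<^sub>m p ?N) (l \<cdot>\<^sub>m 1\<^sub>m p))"
      by (rule word_from_direct_sum[OF two companion_block_to_scalar[OF two]]) auto
    then have "word_from n 9 A (four_block_mat (?Q 0) (0\<^sub>m ?N p) (0\<^sub>m p ?N) (l \<cdot>\<^sub>m 1\<^sub>m p))"
      using word_from_trans[OF w] n by fastforce
    moreover have ll: "l * l = l" using True by auto
    have "is_word_value jordan_prod (carrier_mat n n) 1 (four_block_mat (?Q 0) (0\<^sub>m ?N p) (0\<^sub>m p ?N) (l \<cdot>\<^sub>m 1\<^sub>m p))"
      unfolding n z companion_block_def
      by (intro is_word_value_idem[OF two]) (simp_all add: block_simps ll)
    ultimately have "is_word_value jordan_prod (carrier_mat n n) (1 + 9) A"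
      using is_word_value_word_from[OF two] by blast
    then show ?thesis by (rule is_word_value_mono) simp
  next
    case False
    then have \<beta>: "\<beta> = 0" by (simp add: \<beta>_def)
    have "word_from ?N 0 (?Q 0) (diag01 ?N {..<m} :: 'a mat)"
      using similar_companion_diag[of m, where 'a = 'a] unfolding diag01_lower z by (intro word_from_similar) auto
    then have "word_from (?N + p) 0 (four_block_mat (?Q \<beta>) (0\<^sub>m ?N p) (0\<^sub>m p ?N) (l \<cdot>\<^sub>m 1\<^sub>m p))
      (four_block_mat (diag01 ?N {..<m}) (0\<^sub>m ?N p) (0\<^sub>m p ?N) (l \<cdot>\<^sub>m 1\<^sub>m p))"
      unfolding \<beta> by (rule word_from_direct_sum[OF two]) simp
    then have "word_from n 5 A (four_block_mat (diag01 ?N {..<m}) (0\<^sub>m ?N p) (0\<^sub>m p ?N) (l \<cdot>\<^sub>m 1\<^sub>m p))"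
      using word_from_trans[OF w] n by fastforce
    moreover have "p \<le> 2 ^ j * ?N" using j n m by (metis le_add2 le_trans mult_le_mono2 nat_mult_1_right add_is_0 less_one not_le)
    then have "is_word_value jordan_prod (carrier_mat n n) (4 * j + 5)
        (four_block_mat (diag01 ?N {..<m}) (0\<^sub>m ?N p) (0\<^sub>m p ?N) (l \<cdot>\<^sub>m 1\<^sub>m p))"
      unfolding n using False by (intro word_value_diag01_scalar[OF two]) auto
    ultimately have "is_word_value jordan_prod (carrier_mat n n) (4 * j + 5 + 5) A"
      using is_word_value_word_from[OF two] by blast
    then show ?thesis by (rule is_word_value_mono) simp
  qed
qed

lemma nonscalar_word_value:
  assumes two: "(2 :: 'a :: field) \<noteq> 0" and A: "(A :: 'a mat) \<in> carrier_mat n n - scalar_mats n"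
  shows "A \<in> word_values jordan_prod (carrier_mat n n)"
proof -
  have "n \<le> 2 ^ n" by (simp add: less_imp_le)
  then have "is_word_value jordan_prod (carrier_mat n n) (4 * n + 10) A"
    using A by (intro word_value_nonscalar[OF two]) auto
  then show ?thesis unfolding word_values_def by blast
qed

section \<open>Cyclic subspaces\<close>

definition orbit :: "'a :: field mat \<Rightarrow> 'a mat \<Rightarrow> nat \<Rightarrow> 'a mat" where
  "orbit X v i = ((\<lambda>w. X * w) ^^ i) v"

lemma orbit_0 [simp]: "orbit X v 0 = v" and orbit_Suc: "orbit X v (Suc i) = X * orbit X v i"
  by (simp_all add: orbit_def)

lemma orbit_carrier:
  assumes "X \<in> carrier_mat N N" "v \<in> carrier_mat N 1"
  shows "orbit X v i \<in> carrier_mat N 1"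
  using assms by (induction i) (auto simp: orbit_Suc carrier_mat_def)

definition krylov :: "'a :: field mat \<Rightarrow> 'a mat \<Rightarrow> nat \<Rightarrow> 'a mat" where
  "krylov X v d = mat (dim_row v) d (\<lambda>(i, j). orbit X v j $$ (i, 0))"

lemma krylov_dim [simp]: "dim_row (krylov X v d) = dim_row v" "dim_col (krylov X v d) = d"
  by (simp_all add: krylov_def)

lemma krylov_Suc:
  assumes "X \<in> carrier_mat N N" "v \<in> carrier_mat N 1"
  shows "krylov X v (Suc d) = hcat (krylov X v d) (orbit X v d)"
  using orbit_carrier[OF assms, of d] assms
  by (intro eq_matI) (auto simp: krylov_def carrier_mat_def less_Suc_eq)

lemma mult_krylov_index:
  assumes "X \<in> carrier_mat N N" "v \<in> carrier_mat N 1" "dim_col M = N" "i < dim_row M" "j < d"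
  shows "(M * krylov X v d) $$ (i, j) = (M * orbit X v j) $$ (i, 0)"
proof -
  have "col (krylov X v d) j = col (orbit X v j) 0"
    using orbit_carrier[OF assms(1,2), of j] assms by (intro eq_vecI) (auto simp: krylov_def carrier_mat_def)
  then show ?thesis using orbit_carrier[OF assms(1,2), of j] assms by (simp add: carrier_mat_def)
qed

lemma krylov_gram_index:
  assumes "X \<in> carrier_mat N N" "v \<in> carrier_mat N 1" "u \<in> carrier_mat N 1" "M \<in> carrier_mat N N" "i < d" "j < e"
  shows "((krylov X v d)\<^sup>T * (M * krylov X u e)) $$ (i, j) = ((orbit X v i)\<^sup>T * (M * orbit X u j)) $$ (0, 0)"
proof -
  have o: "orbit X v i \<in> carrier_mat N 1" "orbit X u j \<in> carrier_mat N 1"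
    using orbit_carrier assms by blast+
  have "((krylov X v d)\<^sup>T * (M * krylov X u e)) $$ (i, j) = ((krylov X v d)\<^sup>T * M * krylov X u e) $$ (i, j)"
    using assms by (simp add: mm_simps)
  also have "\<dots> = ((krylov X v d)\<^sup>T * M * orbit X u j) $$ (i, 0)"
    using assms by (intro mult_krylov_index) (auto simp: carrier_mat_def)
  also have "\<dots> = ((krylov X v d)\<^sup>T * (M * orbit X u j)) $$ (i, 0)"
    using assms o by (simp add: mm_simps)
  also have "\<dots> = row ((krylov X v d)\<^sup>T) i \<bullet> col (M * orbit X u j) 0"
    using assms o by (simp add: carrier_mat_def)
  also have "row ((krylov X v d)\<^sup>T) i = row ((orbit X v i)\<^sup>T) 0"
    using assms o by (intro eq_vecI) (auto simp: krylov_def carrier_mat_def)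
  finally show ?thesis using assms o by (simp add: carrier_mat_def)
qed

text \<open>\<open>X\<close> shifts the vectors of the orbit, so only the image of the last one is at issue.\<close>

lemma krylov_invariant:
  assumes X: "X \<in> carrier_mat N N" and v: "v \<in> carrier_mat N 1"
    and li: "left_invertible (krylov X v d)" and nli: "\<not> left_invertible (krylov X v (Suc d))"
  shows "\<exists>C \<in> carrier_mat d d. X * krylov X v d = krylov X v d * C"
proof -
  let ?K = "krylov X v d"
  have K: "?K \<in> carrier_mat N d" using v by (simp add: carrier_mat_def)
  obtain L where L: "L \<in> carrier_mat d N" "L * ?K = 1\<^sub>m d"
    using li v by (auto simp: left_invertible_def carrier_mat_def)
  have o: "orbit X v i \<in> carrier_mat N 1" for i using orbit_carrier[OF X v] .
  have KL: "?K * (L * orbit X v j) = orbit X v j" if "j \<le> d" for j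
  proof (cases "j = d")
    case True
    then show ?thesis
      using left_invertible_hcat_col[OF K L(1) o L(2), of d] nli krylov_Suc[OF X v] by auto
  next
    case False
    then have j: "j < d" using that by simp
    have "orbit X v j = ?K * unit_col d j"
      using mult_unit_col_index[of _ ?K j] j o[of j] K
      by (intro eq_matI) (auto simp: carrier_mat_def krylov_def simp del: index_mult_mat(1))
    moreover have "?K * (L * (?K * z)) = ?K * z" if "dim_row z = d" for z
      using mm_assoc[of L ?K z] L K that by (simp add: carrier_mat_def)
    ultimately show ?thesis by simp
  qed
  have "X * ?K = ?K * (L * (X * ?K))"
  proof (rule eq_matI)
    fix i j assume "i < dim_row (?K * (L * (X * ?K)))" "j < dim_col (?K * (L * (X * ?K)))"
    then have ij: "i < N" "j < d" using v by (auto simp: carrier_mat_def)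
    have "(?K * (L * (X * ?K))) $$ (i, j) = (?K * L * X * ?K) $$ (i, j)"
      using K L X by (simp add: mm_simps)
    also have "\<dots> = (?K * L * X * orbit X v j) $$ (i, 0)"
      using ij K L X by (intro mult_krylov_index[OF X v]) (auto simp: carrier_mat_def)
    also have "?K * L * X * orbit X v j = ?K * (L * orbit X v (Suc j))"
      using K L X o[of j] by (simp add: mm_simps orbit_Suc)
    also have "\<dots> = X * orbit X v j" using KL[of "Suc j"] ij by (simp add: orbit_Suc)
    also have "(X * orbit X v j) $$ (i, 0) = (X * ?K) $$ (i, j)"
      using ij X by (intro mult_krylov_index[OF X v, symmetric]) (auto simp: carrier_mat_def)
    finally show "(X * ?K) $$ (i, j) = (?K * (L * (X * ?K))) $$ (i, j)" by simp
  qed (use X v in \<open>auto simp: carrier_mat_def\<close>)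
  moreover have "L * (X * ?K) \<in> carrier_mat d d" using L by (simp add: carrier_mat_def)
  ultimately show ?thesis by blast
qed

section \<open>The symplectic form\<close>

lemma smult_one_mat [simp]: "(1 :: 'a :: field) \<cdot>\<^sub>m A = A"
  by (rule eq_matI) auto

lemma transpose_smult: "(k \<cdot>\<^sub>m A)\<^sup>T = k \<cdot>\<^sub>m A\<^sup>T"
  by (rule eq_matI) auto

lemma transpose_mm: "dim_col A = dim_row B \<Longrightarrow> (A * B)\<^sup>T = B\<^sup>T * (A :: 'a :: field mat)\<^sup>T"
  by (rule transpose_mult[of _ "dim_row A" "dim_col A" _ "dim_col B"]) auto

lemma uminus_smult: "- A = (-1) \<cdot>\<^sub>m (A :: 'a :: field mat)"
  by (rule eq_matI) auto

lemma symp_R_transpose: "(symp_R n)\<^sup>T = (-1) \<cdot>\<^sub>m (symp_R n :: 'a :: field mat)"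
  by (rule eq_matI) (auto simp: symp_R_def)

lemma symp_R_square: "symp_R n * symp_R n = (-1) \<cdot>\<^sub>m (1\<^sub>m (2 * n) :: 'a :: field mat)"
  unfolding symp_R_def mult_2 fb_one uminus_smult by (simp add: block_simps del: four_block_one_mat)

lemma symp_R_dim [simp]: "dim_row (symp_R n) = 2 * n" "dim_col (symp_R n) = 2 * n"
  by (simp_all add: symp_R_def)

lemma symp_form_skew:
  assumes "A \<in> carrier_mat (2 * n) k" "B \<in> carrier_mat (2 * n) l"
  shows "B\<^sup>T * (symp_R n * A) = (-1) \<cdot>\<^sub>m (A\<^sup>T * (symp_R n * (B :: 'a :: field mat)))\<^sup>T"
  using assms by (simp add: transpose_mm symp_R_transpose transpose_smult mm_simps)

lemma symp_form_zero_sym: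
  assumes "A \<in> carrier_mat (2 * n) k" "B \<in> carrier_mat (2 * n) l"
    and "A\<^sup>T * (symp_R n * (B :: 'a :: field mat)) = 0\<^sub>m k l"
  shows "B\<^sup>T * (symp_R n * A) = 0\<^sub>m l k"
  using symp_form_skew[OF assms(1,2)] assms(3) by (simp add: smult_zero_mat)

lemma herm_sp_adjoint:
  assumes "X \<in> herm_sp n" "A \<in> carrier_mat (2 * n) k" "B \<in> carrier_mat (2 * n) l"
  shows "(X * A)\<^sup>T * (symp_R n * B) = A\<^sup>T * (symp_R n * (X * (B :: 'a :: field mat)))"
proof -
  have X: "X \<in> carrier_mat (2 * n) (2 * n)" "X\<^sup>T * symp_R n = symp_R n * X"
    using assms(1) by (auto simp: herm_sp_def)
  have "(X * A)\<^sup>T * (symp_R n * B) = A\<^sup>T * ((X\<^sup>T * symp_R n) * B)"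
    using X(1) assms(2,3) by (simp add: transpose_mm mm_simps)
  also have "\<dots> = A\<^sup>T * (symp_R n * (X * B))"
    unfolding X(2) using X(1) assms(2,3) by (simp add: mm_simps)
  finally show ?thesis .
qed

lemma orbit_form:
  assumes X: "X \<in> herm_sp n" and v: "v \<in> carrier_mat (2 * n) 1" and u: "u \<in> carrier_mat (2 * n) 1"
  shows "(orbit X v i)\<^sup>T * (symp_R n * orbit X u j) = (orbit X v (i + j))\<^sup>T * (symp_R n * (u :: 'a :: field mat))"
proof (induction j arbitrary: i)
  case (Suc j)
  have Xc: "X \<in> carrier_mat (2 * n) (2 * n)" using X by (simp add: herm_sp_def)
  note o = orbit_carrier[OF Xc v] orbit_carrier[OF Xc u]
  show ?case
    using Suc[of "Suc i"] herm_sp_adjoint[OF X o(1,2), of i j] by (simp add: orbit_Suc)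
qed simp

text \<open>The form is skew and \<open>X\<close> is self-adjoint, so the pairing of \<open>X\<^sup>i v\<close> with \<open>X\<^sup>j v\<close> equals both the
  pairing of \<open>X\<^sup>i\<^sup>+\<^sup>j v\<close> with \<open>v\<close> and its negative.\<close>

lemma krylov_isotropic:
  assumes two: "(2 :: 'a :: field) \<noteq> 0"
    and X: "X \<in> herm_sp n" and v: "v \<in> carrier_mat (2 * n) 1"
  shows "(krylov X v d)\<^sup>T * (symp_R n * krylov X v d) = (0\<^sub>m d d :: 'a mat)"
proof (rule eq_matI)
  fix i j assume "i < dim_row (0\<^sub>m d d)" "j < dim_col (0\<^sub>m d d)"
  then have ij: "i < d" "j < d" by auto
  have Xc: "X \<in> carrier_mat (2 * n) (2 * n)" using X by (simp add: herm_sp_def)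
  let ?w = "orbit X v (i + j)"
  have w: "?w \<in> carrier_mat (2 * n) 1" using orbit_carrier[OF Xc v] .
  have "?w\<^sup>T * (symp_R n * v) = v\<^sup>T * (symp_R n * ?w)"
    using orbit_form[OF X v v, of 0 "i + j"] by simp
  also have "\<dots> = (-1) \<cdot>\<^sub>m (?w\<^sup>T * (symp_R n * v))\<^sup>T"
    using symp_form_skew[OF w v] .
  finally have "(?w\<^sup>T * (symp_R n * v)) $$ (0, 0) = ((-1) \<cdot>\<^sub>m (?w\<^sup>T * (symp_R n * v))\<^sup>T) $$ (0, 0)"
    by (rule arg_cong)
  also have "\<dots> = - (?w\<^sup>T * (symp_R n * v)) $$ (0, 0)"
    using v w by (simp add: carrier_mat_def del: index_mult_mat(1))
  finally have "2 * (?w\<^sup>T * (symp_R n * v)) $$ (0, 0) = 0" by simp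
  then have "(?w\<^sup>T * (symp_R n * v)) $$ (0, 0) = 0" using two by simp
  then show "((krylov X v d)\<^sup>T * (symp_R n * krylov X v d)) $$ (i, j) = 0\<^sub>m d d $$ (i, j)"
    using krylov_gram_index[OF Xc v v symp_R_carrier ij] orbit_form[OF X v v, of i j] ij by simp
qed (use v in \<open>auto simp: carrier_mat_def\<close>)

lemma symp_form_hcat:
  fixes A :: "'a :: field mat"
  assumes "A \<in> carrier_mat (2 * n) a" "B \<in> carrier_mat (2 * n) b" "C \<in> carrier_mat (2 * n) c" "D \<in> carrier_mat (2 * n) d"
  shows "(hcat A B)\<^sup>T * (symp_R n * hcat C D) = four_block_mat (A\<^sup>T * (symp_R n * C)) (A\<^sup>T * (symp_R n * D))
    (B\<^sup>T * (symp_R n * C)) (B\<^sup>T * (symp_R n * D))"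
proof -
  have "(hcat A B)\<^sup>T = vcat (A\<^sup>T) (B\<^sup>T)" using assms by (intro transpose_hcat) (simp add: carrier_mat_def)
  moreover have "symp_R n * hcat C D = hcat (symp_R n * C) (symp_R n * D)"
    using assms by (intro mult_hcat) (auto simp: carrier_mat_def)
  ultimately have "(hcat A B)\<^sup>T * (symp_R n * hcat C D) = vcat (A\<^sup>T) (B\<^sup>T) * hcat (symp_R n * C) (symp_R n * D)"
    by (simp only:)
  also have "\<dots> = four_block_mat (A\<^sup>T * (symp_R n * C)) (A\<^sup>T * (symp_R n * D))
    (B\<^sup>T * (symp_R n * C)) (B\<^sup>T * (symp_R n * D))"
    using assms by (intro vcat_hcat) (auto simp: carrier_mat_def)
  finally show ?thesis .
qed

lemma invariant_hcat:
  fixes X :: "'a :: field mat"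
  assumes "X \<in> carrier_mat N N" "P \<in> carrier_mat N k" "K \<in> carrier_mat N d" "A \<in> carrier_mat k k" "C \<in> carrier_mat d d"
    and "X * P = P * A" "X * K = K * C"
  shows "X * hcat P K = hcat P K * four_block_mat A (0\<^sub>m k d) (0\<^sub>m d k) C"
proof -
  have "X * hcat P K = hcat (X * P) (X * K)" using assms by (intro mult_hcat) (auto simp: carrier_mat_def)
  also have "\<dots> = hcat P K * four_block_mat A (0\<^sub>m k d) (0\<^sub>m d k) C"
    using assms by (subst hcat_fb) (auto simp: mm_simps)
  finally show ?thesis .
qed

section \<open>Block form of symplectic Hermitian matrices\<close>

text \<open>Bases of two \<open>X\<close>-invariant isotropic subspaces that are dual to each other under the symplectic form.\<close>

definition symp_frame :: "nat \<Rightarrow> 'a :: field mat \<Rightarrow> nat \<Rightarrow> 'a mat \<Rightarrow> 'a mat \<Rightarrow> bool" where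
  "symp_frame n X k P Q \<longleftrightarrow> P \<in> carrier_mat (2 * n) k \<and> Q \<in> carrier_mat (2 * n) k
    \<and> P\<^sup>T * (symp_R n * P) = 0\<^sub>m k k \<and> Q\<^sup>T * (symp_R n * Q) = 0\<^sub>m k k \<and> P\<^sup>T * (symp_R n * Q) = 1\<^sub>m k
    \<and> (\<exists>A \<in> carrier_mat k k. X * P = P * A) \<and> (\<exists>B \<in> carrier_mat k k. X * Q = Q * B)"

lemma symp_frame_le:
  assumes "symp_frame n X k P Q"
  shows "k \<le> n"
proof -
  have f: "P \<in> carrier_mat (2 * n) k" "Q \<in> carrier_mat (2 * n) k"
    "P\<^sup>T * (symp_R n * P) = 0\<^sub>m k k" "Q\<^sup>T * (symp_R n * Q) = 0\<^sub>m k k" "P\<^sup>T * (symp_R n * Q) = 1\<^sub>m k"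
    using assms by (auto simp: symp_frame_def)
  have QP: "Q\<^sup>T * (symp_R n * P) = (-1) \<cdot>\<^sub>m 1\<^sub>m k" using symp_form_skew[OF f(1,2)] f(5) by simp
  let ?L = "vcat ((-1) \<cdot>\<^sub>m (Q\<^sup>T * symp_R n)) (P\<^sup>T * symp_R n)"
  have "?L * hcat P Q = 1\<^sub>m (k + k)"
    unfolding fb_one using f QP
    by (subst vcat_hcat; simp add: mm_simps smult_zero_mat del: four_block_one_mat)
  then have "left_invertible (hcat P Q)"
    unfolding left_invertible_def using f by (intro bexI[of _ ?L]) (auto simp: carrier_mat_def)
  from left_invertible_le[OF this] show ?thesis using f by (simp add: carrier_mat_def)
qed

text \<open>The rows of \<open>H c = 0\<close>, read from the top, annihilate the coordinates of \<open>c\<close> from the last to the first.\<close>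

lemma antitriangular_invertible:
  fixes H :: "'a :: field mat"
  assumes H: "H \<in> carrier_mat d d"
    and zero: "\<And>i j. i < d \<Longrightarrow> j < d \<Longrightarrow> Suc (i + j) < d \<Longrightarrow> H $$ (i, j) = 0"
    and one: "\<And>i j. i < d \<Longrightarrow> j < d \<Longrightarrow> Suc (i + j) = d \<Longrightarrow> H $$ (i, j) = 1"
  shows "\<exists>H' \<in> carrier_mat d d. H * H' = 1\<^sub>m d \<and> H' * H = 1\<^sub>m d"
proof -
  have "c = 0\<^sub>v d" if c: "c \<in> carrier_vec d" "H *\<^sub>v c = 0\<^sub>v d" for c
  proof -
    have row: "(\<Sum>j<d. H $$ (i, j) * c $ j) = 0" if i: "i < d" for i
    proof -
      have "(H *\<^sub>v c) $ i = (\<Sum>j<d. H $$ (i, j) * c $ j)"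
        using i c(1) H by (auto simp: scalar_prod_def carrier_mat_def atLeast0LessThan)
      then show ?thesis using c(2) i by simp
    qed
    have claim: "i < d \<Longrightarrow> c $ (d - 1 - i) = 0" for i
    proof (induction i rule: less_induct)
      case (less i)
      have "(\<Sum>j<d. H $$ (i, j) * c $ j) = (\<Sum>j<d. if j = d - 1 - i then c $ j else 0)"
      proof (rule sum.cong)
        fix j assume "j \<in> {..<d}"
        then have j: "j < d" by simp
        consider "Suc (i + j) < d" | "Suc (i + j) = d" | "Suc (i + j) > d" by linarith
        then show "H $$ (i, j) * c $ j = (if j = d - 1 - i then c $ j else 0)"
        proof cases
          case 3
          have "c $ (d - 1 - (d - 1 - j)) = 0" using 3 j by (intro less.IH) auto
          moreover have "d - 1 - (d - 1 - j) = j" using j by simp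
          ultimately show ?thesis using 3 by auto
        qed (use zero[OF less.prems j] one[OF less.prems j] in auto)
      qed simp
      also have "\<dots> = c $ (d - 1 - i)" using less.prems by (simp add: sum.delta)
      finally show ?case using row[OF less.prems] by simp
    qed
    have "c $ j = 0" if "j < d" for j
      using claim[of "d - 1 - j"] that by simp
    then show ?thesis using c(1) by (intro eq_vecI) auto
  qed
  then have "det H \<noteq> 0" using det_0_iff_vec_prod_zero_field[OF H] by blast
  then show ?thesis
    using det_non_zero_imp_unit[OF H, of undefined] unfolding Units_def ring_mat_def by auto
qed

text \<open>In the orthogonal complement of the frame, which is invariant, take \<open>v\<close> whose cyclic subspace has
  the largest possible dimension \<open>d\<close>, and \<open>u\<close> pairing to 1 with \<open>X\<^sup>d\<^sup>-\<^sup>1 v\<close> and to 0 with the earlier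
  \<open>X\<^sup>i v\<close>. The pairing of \<open>X\<^sup>i v\<close> with \<open>X\<^sup>j u\<close> depends on \<open>i + j\<close> only, so its matrix \<open>H\<close> is
  antitriangular and invertible. Hence the vectors \<open>X\<^sup>j u\<close> with \<open>j < d\<close> are independent, and by
  maximality of \<open>d\<close> their span is invariant. Both cyclic subspaces are isotropic, and after
  multiplication by the inverse of \<open>H\<close> the two bases are dual.\<close>

lemma symp_frame_extend:
  assumes two: "(2 :: 'a :: field) \<noteq> 0" and X: "X \<in> herm_sp n" and fr: "symp_frame n X k P (Q :: 'a mat)" and k: "k < n"
  shows "\<exists>k' P' Q'. k < k' \<and> symp_frame n X k' P' Q'"
proof -
  let ?N = "2 * n" and ?R = "symp_R n :: 'a mat"
  have Xc: "X \<in> carrier_mat ?N ?N" using X by (simp add: herm_sp_def)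
  obtain A B where f: "P \<in> carrier_mat ?N k" "Q \<in> carrier_mat ?N k"
    "P\<^sup>T * (?R * P) = 0\<^sub>m k k" "Q\<^sup>T * (?R * Q) = 0\<^sub>m k k" "P\<^sup>T * (?R * Q) = 1\<^sub>m k"
    and AB: "A \<in> carrier_mat k k" "X * P = P * A" "B \<in> carrier_mat k k" "X * Q = Q * B"
    using fr by (auto simp: symp_frame_def)
  have QP: "Q\<^sup>T * (?R * P) = (-1) \<cdot>\<^sub>m 1\<^sub>m k" using symp_form_skew[OF f(1,2)] f(5) by simp
  define perp where "perp v \<longleftrightarrow> v \<in> carrier_mat ?N 1 \<and> P\<^sup>T * (?R * v) = 0\<^sub>m k 1 \<and> Q\<^sup>T * (?R * v) = 0\<^sub>m k 1" for v
  have perpc: "v \<in> carrier_mat ?N 1" if "perp v" for v using that by (simp add: perp_def)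
  have perpX: "perp (X * v)" if v: "perp v" for v
  proof -
    have vc: "v \<in> carrier_mat ?N 1" using v by (simp add: perp_def)
    have "P\<^sup>T * (?R * (X * v)) = (P * A)\<^sup>T * (?R * v)" using herm_sp_adjoint[OF X f(1) vc] AB by simp
    also have "\<dots> = A\<^sup>T * (P\<^sup>T * (?R * v))" using f AB vc by (simp add: transpose_mm mm_simps)
    finally have 1: "P\<^sup>T * (?R * (X * v)) = 0\<^sub>m k 1" using v AB by (simp add: perp_def mm_simps)
    have "Q\<^sup>T * (?R * (X * v)) = (Q * B)\<^sup>T * (?R * v)" using herm_sp_adjoint[OF X f(2) vc] AB by simp
    also have "\<dots> = B\<^sup>T * (Q\<^sup>T * (?R * v))" using f AB vc by (simp add: transpose_mm mm_simps)
    finally have 2: "Q\<^sup>T * (?R * (X * v)) = 0\<^sub>m k 1" using v AB by (simp add: perp_def mm_simps)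
    show ?thesis using 1 2 Xc vc by (simp add: perp_def carrier_mat_def)
  qed
  have perp_orbit: "perp (orbit X v i)" if "perp v" for v i
    using that perpX by (induction i) (auto simp: orbit_Suc)
  have perp_krylov: "P\<^sup>T * (?R * krylov X v d) = 0\<^sub>m k d" "Q\<^sup>T * (?R * krylov X v d) = 0\<^sub>m k d" if v: "perp v" for v d
  proof -
    have "Y\<^sup>T * (?R * krylov X v d) = 0\<^sub>m k d"
      if Y: "Y \<in> carrier_mat ?N k" and Yo: "\<And>j. Y\<^sup>T * (?R * orbit X v j) = 0\<^sub>m k 1" for Y
    proof (rule eq_matI)
      fix i j assume "i < dim_row (0\<^sub>m k d)" "j < dim_col (0\<^sub>m k d)"
      then have ij: "i < k" "j < d" by auto
      have "(Y\<^sup>T * (?R * krylov X v d)) $$ (i, j) = (Y\<^sup>T * ?R * krylov X v d) $$ (i, j)"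
        using Y perpc[OF v] by (simp add: mm_simps)
      also have "\<dots> = (Y\<^sup>T * ?R * orbit X v j) $$ (i, 0)"
        using Y ij by (intro mult_krylov_index[OF Xc perpc[OF v]]) (auto simp: carrier_mat_def)
      also have "\<dots> = (Y\<^sup>T * (?R * orbit X v j)) $$ (i, 0)"
        using Y orbit_carrier[OF Xc perpc[OF v], of j] by (simp add: mm_simps)
      finally show "(Y\<^sup>T * (?R * krylov X v d)) $$ (i, j) = 0\<^sub>m k d $$ (i, j)"
        using ij unfolding Yo by simp
    qed (use Y in \<open>auto simp: carrier_mat_def\<close>)
    then show "P\<^sup>T * (?R * krylov X v d) = 0\<^sub>m k d" "Q\<^sup>T * (?R * krylov X v d) = 0\<^sub>m k d"
      using f perp_orbit[OF v] by (auto simp: perp_def)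
  qed
  \<comment> \<open>The projection onto the orthogonal complement along the span of the frame.\<close>
  define proj where "proj y = y + P * (Q\<^sup>T * (?R * y)) + (-1) \<cdot>\<^sub>m (Q * (P\<^sup>T * (?R * y)))" for y
  have Pz: "P\<^sup>T * (?R * (P * z)) = 0\<^sub>m k (dim_col z)" "P\<^sup>T * (?R * (Q * z)) = z"
    "Q\<^sup>T * (?R * (P * z)) = (-1) \<cdot>\<^sub>m z" "Q\<^sup>T * (?R * (Q * z)) = 0\<^sub>m k (dim_col z)" if "dim_row z = k" for z
  proof -
    have s: "Y\<^sup>T * (?R * (Z * z)) = (Y\<^sup>T * (?R * Z)) * z" if "Y \<in> carrier_mat ?N k" "Z \<in> carrier_mat ?N k" for Y Z
      using that \<open>dim_row z = k\<close> by (simp add: mm_simps)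
    show "P\<^sup>T * (?R * (P * z)) = 0\<^sub>m k (dim_col z)" "P\<^sup>T * (?R * (Q * z)) = z"
      "Q\<^sup>T * (?R * (P * z)) = (-1) \<cdot>\<^sub>m z" "Q\<^sup>T * (?R * (Q * z)) = 0\<^sub>m k (dim_col z)"
      using that by (simp_all add: s f QP mm_one mm_zero mm_smult_mult)
  qed
  have perp_proj: "perp (proj y)" if y: "y \<in> carrier_mat ?N 1" for y
    unfolding perp_def proj_def using f(1,2) y
    by (auto simp: mm_simps Pz; intro eq_matI; auto simp del: index_mult_mat(1))
  let ?S = "\<lambda>d. \<exists>v. perp v \<and> left_invertible (krylov X v d)"
  have "?S 1"
  proof -
    have "\<exists>y \<in> carrier_mat ?N 1. proj y \<noteq> 0\<^sub>m ?N 1"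
    proof (rule ccontr)
      assume "\<not> ?thesis"
      then have z: "proj (unit_col ?N j) = 0\<^sub>m ?N 1" for j
        using unit_col_carrier(1)[of ?N j, where 'a = 'a] by blast
      \<comment> \<open>Otherwise the frame would span, and the identity would factor through dimension \<open>2 k\<close>.\<close>
      let ?U = "P * ((-1) \<cdot>\<^sub>m (Q\<^sup>T * ?R)) + Q * (P\<^sup>T * ?R)"
      have "1\<^sub>m ?N = ?U"
      proof (rule eq_matI)
        fix i j assume "i < dim_row ?U" "j < dim_col ?U"
        then have ij: "i < ?N" "j < ?N" using f by (auto simp: carrier_mat_def)
        have "unit_col ?N j = ?U * unit_col ?N j + proj (unit_col ?N j)"
          unfolding proj_def using f(1,2) by (simp add: mm_simps) (intro eq_matI; auto simp del: index_mult_mat(1))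
        then have "unit_col ?N j = ?U * unit_col ?N j"
          unfolding z using f(1,2) by (simp add: carrier_mat_def)
        then have "unit_col ?N j $$ (i, 0) = (?U * unit_col ?N j) $$ (i, 0)" by (rule arg_cong)
        also have "\<dots> = ?U $$ (i, j)"
          using mult_unit_col_index[of i ?U j] ij f(1,2) by (simp add: carrier_mat_def del: index_mult_mat(1))
        finally show "(1\<^sub>m ?N :: 'a mat) $$ (i, j) = ?U $$ (i, j)" using ij by (simp add: unit_col_def)
      qed (use f in \<open>auto simp: carrier_mat_def\<close>)
      moreover have "rank_at_most (k + k) ?U"
        using f(1,2) by (intro rank_at_most_add rank_at_most_product) (auto simp: carrier_mat_def)
      ultimately have "rank_at_most (k + k) (1\<^sub>m ?N :: 'a mat)" by simp
      from rank_at_most_one[OF this] show False using k by simp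
    qed
    then obtain y where y: "y \<in> carrier_mat ?N 1" "proj y \<noteq> 0\<^sub>m ?N 1" by blast
    let ?v = "proj y"
    have v: "perp ?v" using perp_proj[OF y(1)] .
    have "left_invertible (hcat (0\<^sub>m ?N 0) ?v)"
    proof (rule left_invertible_hcat_col[where N = ?N and d = 0 and L = "0\<^sub>m 0 ?N"])
      show "0\<^sub>m 0 ?N * 0\<^sub>m ?N 0 = 1\<^sub>m 0" by (intro eq_matI) auto
      have "0\<^sub>m ?N 0 * (0\<^sub>m 0 ?N * ?v) = 0\<^sub>m ?N 1" using perpc[OF v] by (intro eq_matI) (auto simp: scalar_prod_def carrier_mat_def)
      then show "0\<^sub>m ?N 0 * (0\<^sub>m 0 ?N * ?v) \<noteq> ?v" using y(2) by metis
    qed (use perpc[OF v] in auto)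
    moreover have "hcat (0\<^sub>m ?N 0) ?v = krylov X ?v 1"
      using perpc[OF v] by (intro eq_matI) (auto simp: krylov_def carrier_mat_def)
    ultimately show ?thesis using v by auto
  qed
  moreover have "d \<le> ?N" if S: "?S d" for d
  proof -
    obtain v where "perp v" "left_invertible (krylov X v d)" using S by blast
    then show ?thesis using left_invertible_le[of "krylov X v d"] perpc[of v] by (simp add: carrier_mat_def)
  qed
  ultimately obtain d where "?S d" and max: "\<And>d'. ?S d' \<Longrightarrow> d' \<le> d"
    using Nat.ex_has_greatest_nat[of ?S 1 ?N] by meson
  then obtain v where v: "perp v" "left_invertible (krylov X v d)" by blast
  have d: "d \<ge> 1" using max[OF \<open>?S 1\<close>] .
  have vc: "v \<in> carrier_mat ?N 1" using perpc[OF v(1)] .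
  let ?K = "krylov X v d"
  have K: "?K \<in> carrier_mat ?N d" using vc by (simp add: carrier_mat_def)
  have "\<not> left_invertible (krylov X v (Suc d))" using max[of "Suc d"] v(1) by auto
  then obtain C where C: "C \<in> carrier_mat d d" "X * ?K = ?K * C"
    using krylov_invariant[OF Xc vc v(2)] by blast
  obtain L where L: "L \<in> carrier_mat d ?N" "L * ?K = 1\<^sub>m d"
    using v(2) K by (auto simp: left_invertible_def carrier_mat_def)
  \<comment> \<open>\<open>u'\<close> has the prescribed pairings with the orbit of \<open>v\<close>; projecting it does not change them.\<close>
  define u' where "u' = (-1) \<cdot>\<^sub>m (?R * (L\<^sup>T * unit_col d (d - 1)))"
  define u where "u = proj u'"
  have u'c: "u' \<in> carrier_mat ?N 1" by (simp add: u'_def carrier_mat_def)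
  have u: "perp u" unfolding u_def using perp_proj[OF u'c] .
  have uc: "u \<in> carrier_mat ?N 1" using perpc[OF u] .
  have KP: "?K\<^sup>T * (?R * P) = 0\<^sub>m d k" "?K\<^sup>T * (?R * Q) = 0\<^sub>m d k"
    using symp_form_zero_sym[OF f(1) K] symp_form_zero_sym[OF f(2) K] perp_krylov[OF v(1)] by auto
  have Ku: "?K\<^sup>T * (?R * u) = unit_col d (d - 1)"
  proof -
    have RR: "?R * (?R * z) = (-1) \<cdot>\<^sub>m z" if "dim_row z = ?N" for z
      using mm_assoc[of ?R ?R z] that symp_R_square[of n, where 'a = 'a] by (simp add: mm_simps)
    have KLT: "?K\<^sup>T * (L\<^sup>T * z) = z" if "dim_row z = d" for z
    proof -
      have "?K\<^sup>T * L\<^sup>T = 1\<^sub>m d" using transpose_mm[of L ?K] L K by (simp add: carrier_mat_def)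
      then show ?thesis using mm_assoc[of "?K\<^sup>T" "L\<^sup>T" z] L K that by (simp add: carrier_mat_def)
    qed
    have KPz: "?K\<^sup>T * (?R * (P * z)) = 0\<^sub>m d (dim_col z)" "?K\<^sup>T * (?R * (Q * z)) = 0\<^sub>m d (dim_col z)"
      if "dim_row z = k" for z
    proof -
      have s: "?K\<^sup>T * (?R * (Z * z)) = (?K\<^sup>T * (?R * Z)) * z" if "Z \<in> carrier_mat ?N k" for Z
        using that \<open>dim_row z = k\<close> K by (simp add: mm_simps)
      show "?K\<^sup>T * (?R * (P * z)) = 0\<^sub>m d (dim_col z)" "?K\<^sup>T * (?R * (Q * z)) = 0\<^sub>m d (dim_col z)"
        using that by (simp_all add: s f(1,2) KP mm_zero)
    qed
    have "?K\<^sup>T * (?R * u') = unit_col d (d - 1)"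
      unfolding u'_def using L K by (simp add: mm_simps RR KLT)
    moreover have "?K\<^sup>T * (?R * u) = ?K\<^sup>T * (?R * u')"
      unfolding u_def proj_def using f(1,2) u'c K
      by (simp add: mm_simps KPz smult_zero_mat)
    ultimately show ?thesis by simp
  qed
  let ?U = "krylov X u d"
  have U: "?U \<in> carrier_mat ?N d" using uc by (simp add: carrier_mat_def)
  define H where "H = ?K\<^sup>T * (?R * ?U)"
  have Hc: "H \<in> carrier_mat d d" using K U by (simp add: H_def carrier_mat_def)
  have Hij: "H $$ (i, j) = (if Suc (i + j) = d then 1 else 0)" if "i < d" "j < d" "Suc (i + j) \<le> d" for i j
  proof -
    have "H $$ (i, j) = ((orbit X v (i + j))\<^sup>T * (?R * u)) $$ (0, 0)"
      unfolding H_def using krylov_gram_index[OF Xc vc uc symp_R_carrier that(1,2)] orbit_form[OF X vc uc, of i j]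
      by simp
    also have "\<dots> = (?K\<^sup>T * (?R * krylov X u 1)) $$ (i + j, 0)"
      using krylov_gram_index[OF Xc vc uc symp_R_carrier, of "i + j" d 0 1] that by simp
    also have "krylov X u 1 = u" using uc by (intro eq_matI) (auto simp: krylov_def carrier_mat_def)
    finally show ?thesis unfolding Ku using that by (auto simp: unit_col_def)
  qed
  obtain H' where H': "H' \<in> carrier_mat d d" "H * H' = 1\<^sub>m d" "H' * H = 1\<^sub>m d"
    using antitriangular_invertible[OF Hc] Hij by (metis less_imp_le_nat nat_less_le order_refl)
  have "H' * ?K\<^sup>T * ?R * ?U = 1\<^sub>m d"
    using H'(1,3) K U by (simp add: mm_simps flip: H_def)
  then have "left_invertible ?U"
    unfolding left_invertible_def using H' K U by (intro bexI[of _ "H' * ?K\<^sup>T * ?R"]) (auto simp: carrier_mat_def)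
  moreover have "\<not> left_invertible (krylov X u (Suc d))" using max[of "Suc d"] u by auto
  ultimately obtain D where D: "D \<in> carrier_mat d d" "X * ?U = ?U * D"
    using krylov_invariant[OF Xc uc] by blast
  let ?V = "?U * H'"
  have V: "?V \<in> carrier_mat ?N d" using U H' by (simp add: carrier_mat_def)
  have XV: "X * ?V = ?V * (H * (D * H'))"
  proof -
    have "X * ?V = (X * ?U) * H'" using Xc U H' by (simp add: mm_simps)
    also have "\<dots> = ?U * ((H' * H) * (D * H'))" unfolding D(2) H'(3) using U D H' by (simp add: mm_simps)
    also have "\<dots> = ?V * (H * (D * H'))" using U D(1) H'(1) Hc by (simp add: mm_simps)
    finally show ?thesis .
  qed
  have PV: "P\<^sup>T * (?R * ?V) = 0\<^sub>m k d" "Q\<^sup>T * (?R * ?V) = 0\<^sub>m k d"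
  proof -
    have s: "Y\<^sup>T * (?R * ?V) = (Y\<^sup>T * (?R * ?U)) * H'" if "Y \<in> carrier_mat ?N k" for Y
      using that U H' by (simp add: mm_simps)
    show "P\<^sup>T * (?R * ?V) = 0\<^sub>m k d" "Q\<^sup>T * (?R * ?V) = 0\<^sub>m k d"
      using s[OF f(1)] s[OF f(2)] perp_krylov[OF u, of d] H'(1) by (simp_all add: carrier_mat_def mm_zero)
  qed
  have KV: "?K\<^sup>T * (?R * ?V) = 1\<^sub>m d"
  proof -
    have "?K\<^sup>T * (?R * ?V) = H * H'" unfolding H_def using K U H'(1) by (simp add: mm_simps)
    then show ?thesis using H' by simp
  qed
  have VV: "?V\<^sup>T * (?R * ?V) = 0\<^sub>m d d"
  proof -
    have "?V\<^sup>T * (?R * ?V) = H'\<^sup>T * ((?U\<^sup>T * (?R * ?U)) * H')" using U H'(1) by (simp add: mm_simps transpose_mm)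
    then show ?thesis unfolding krylov_isotropic[OF two X uc] using H'(1) by (simp add: mm_simps)
  qed
  have "symp_frame n X (k + d) (hcat P ?K) (hcat Q ?V)"
    unfolding symp_frame_def
  proof (intro conjI bexI)
    show "(hcat P ?K)\<^sup>T * (?R * hcat P ?K) = 0\<^sub>m (k + d) (k + d)"
      using symp_form_hcat[OF f(1) K f(1) K] f(3) perp_krylov[OF v(1), of d] KP krylov_isotropic[OF two X vc, of d] by simp
    show "(hcat Q ?V)\<^sup>T * (?R * hcat Q ?V) = 0\<^sub>m (k + d) (k + d)"
      using symp_form_hcat[OF f(2) V f(2) V] f(4) PV(2) symp_form_zero_sym[OF f(2) V PV(2)] VV by simp
    show "(hcat P ?K)\<^sup>T * (?R * hcat Q ?V) = 1\<^sub>m (k + d)"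
      using symp_form_hcat[OF f(1) K f(2) V] f(5) PV(1) KP(2) KV by simp
    show "X * hcat P ?K = hcat P ?K * four_block_mat A (0\<^sub>m k d) (0\<^sub>m d k) C"
      by (rule invariant_hcat[OF Xc f(1) K AB(1) C(1) AB(2) C(2)])
    show "X * hcat Q ?V = hcat Q ?V * four_block_mat B (0\<^sub>m k d) (0\<^sub>m d k) (H * (D * H'))"
      using Hc D H' by (intro invariant_hcat[OF Xc f(2) V AB(3) _ AB(4) XV]) (simp add: carrier_mat_def)
  qed (use f K V AB C Hc D H' in \<open>auto simp: carrier_mat_def\<close>)
  then show ?thesis using d by (intro exI[of _ "k + d"]) auto
qed

text \<open>A maximal frame has \<open>k = n\<close>. Self-adjointness of \<open>X\<close> and duality of the two bases force the
  second diagonal block to be the transpose of the first.\<close>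

lemma herm_sp_block_form:
  assumes two: "(2 :: 'a :: field) \<noteq> 0" and X: "(X :: 'a mat) \<in> herm_sp n"
  shows "\<exists>T S A. T \<in> carrier_mat (2 * n) (2 * n) \<and> S \<in> carrier_mat (2 * n) (2 * n) \<and> A \<in> carrier_mat n n
    \<and> T * S = 1\<^sub>m (2 * n) \<and> S * T = 1\<^sub>m (2 * n) \<and> T\<^sup>T * (symp_R n * T) = symp_R n
    \<and> X = T * (four_block_mat A (0\<^sub>m n n) (0\<^sub>m n n) (A\<^sup>T) * S)"
proof -
  let ?N = "2 * n" and ?R = "symp_R n :: 'a mat"
  have Xc: "X \<in> carrier_mat ?N ?N" using X by (simp add: herm_sp_def)
  let ?P = "\<lambda>k. \<exists>P Q. symp_frame n X k P Q"
  have "symp_frame n X 0 (0\<^sub>m ?N 0) (0\<^sub>m ?N 0)"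
    unfolding symp_frame_def
  proof (intro conjI bexI[of _ "0\<^sub>m 0 0"])
    show "(0\<^sub>m ?N 0)\<^sup>T * (?R * 0\<^sub>m ?N 0) = 1\<^sub>m 0" by (intro eq_matI) auto
  qed (use Xc in \<open>auto intro!: eq_matI simp: carrier_mat_def\<close>)
  then have "?P 0" by blast
  moreover have "k \<le> n" if "?P k" for k using that symp_frame_le by blast
  ultimately obtain k where Pk: "?P k" and max: "\<And>k'. ?P k' \<Longrightarrow> k' \<le> k"
    using Nat.ex_has_greatest_nat[of ?P 0 n] by meson
  have "k = n"
  proof (rule ccontr)
    assume "k \<noteq> n"
    then have "k < n" using Pk symp_frame_le by (metis le_neq_implies_less)
    then show False using symp_frame_extend[OF two X] Pk max by (metis not_le)
  qed
  then obtain P Q A B where f: "P \<in> carrier_mat ?N n" "Q \<in> carrier_mat ?N n"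
    "P\<^sup>T * (?R * P) = 0\<^sub>m n n" "Q\<^sup>T * (?R * Q) = 0\<^sub>m n n" "P\<^sup>T * (?R * Q) = 1\<^sub>m n"
    and AB: "A \<in> carrier_mat n n" "X * P = P * A" "B \<in> carrier_mat n n" "X * Q = Q * B"
    using Pk by (auto simp: symp_frame_def)
  have QP: "Q\<^sup>T * (?R * P) = - 1\<^sub>m n" using symp_form_skew[OF f(1,2)] f(5) by (simp add: uminus_smult)
  have BA: "B = A\<^sup>T"
  proof -
    have "B = (P\<^sup>T * (?R * Q)) * B" unfolding f(5) using AB by (simp add: mm_simps)
    also have "\<dots> = P\<^sup>T * (?R * (X * Q))" unfolding AB(4) using f(1,2) AB(3) by (simp add: mm_simps)
    also have "\<dots> = (P * A)\<^sup>T * (?R * Q)" unfolding AB(2)[symmetric] using herm_sp_adjoint[OF X f(1,2)] by simp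
    also have "\<dots> = A\<^sup>T * (P\<^sup>T * (?R * Q))" using f(1,2) AB(1) by (simp add: transpose_mm mm_simps)
    finally show ?thesis unfolding f(5) using AB(1) by (simp add: mm_simps)
  qed
  let ?T = "hcat P Q"
  have T: "?T \<in> carrier_mat ?N ?N" using f(1,2) by (auto simp: carrier_mat_def)
  have form: "?T\<^sup>T * (?R * ?T) = ?R"
    using symp_form_hcat[OF f(1,2) f(1,2)] unfolding f(3-5) QP by (simp add: symp_R_def)
  let ?S = "(-1) \<cdot>\<^sub>m (?R * (?T\<^sup>T * ?R))"
  have S: "?S \<in> carrier_mat ?N ?N" using T by (simp add: carrier_mat_def)
  have "?S * ?T = (-1) \<cdot>\<^sub>m (?R * (?T\<^sup>T * (?R * ?T)))" using T by (simp add: mm_simps)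
  also have "\<dots> = 1\<^sub>m ?N" unfolding form symp_R_square by (simp add: mm_simps)
  finally have ST: "?S * ?T = 1\<^sub>m ?N" .
  have TS: "?T * ?S = 1\<^sub>m ?N" using mat_mult_left_right_inverse[OF S T ST] .
  have "X = (X * ?T) * ?S" using mm_assoc[of X ?T ?S] TS Xc T S by (simp add: carrier_mat_def mm_one)
  also have "X * ?T = ?T * four_block_mat A (0\<^sub>m n n) (0\<^sub>m n n) (A\<^sup>T)"
    using invariant_hcat[OF Xc f(1,2) AB(1,3,2,4)] unfolding BA .
  also have "?T * four_block_mat A (0\<^sub>m n n) (0\<^sub>m n n) (A\<^sup>T) * ?S
    = ?T * (four_block_mat A (0\<^sub>m n n) (0\<^sub>m n n) (A\<^sup>T) * ?S)"
    using T S AB(1) by (intro mm_assoc) (auto simp: carrier_mat_def)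
  finally show ?thesis using T S TS ST form AB(1) by blast
qed

section \<open>Words in the symplectic Hermitian algebra\<close>

definition sp_diag :: "nat \<Rightarrow> 'a :: field mat \<Rightarrow> 'a mat" where
  "sp_diag n M = four_block_mat M (0\<^sub>m n n) (0\<^sub>m n n) (M\<^sup>T)"

lemma sp_diag_carrier: "M \<in> carrier_mat n n \<Longrightarrow> sp_diag n M \<in> carrier_mat (2 * n) (2 * n)"
  by (simp add: sp_diag_def carrier_mat_def mult_2)

lemma sp_diag_jordan:
  assumes "M \<in> carrier_mat n n" "M' \<in> carrier_mat n n"
  shows "sp_diag n (jordan_prod M M') = jordan_prod (sp_diag n M) (sp_diag n (M' :: 'a :: field mat))"
proof -
  have "(jordan_prod M M')\<^sup>T = jordan_prod (M\<^sup>T) (M'\<^sup>T)"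
    unfolding jordan_prod_def using assms
    by (intro eq_matI) (auto simp: carrier_mat_def scalar_prod_def algebra_simps)
  then show ?thesis unfolding sp_diag_def using assms unfolding jordan_prod_def by (simp add: block_simps)
qed

lemma sp_diag_herm_sp: "M \<in> carrier_mat n n \<Longrightarrow> sp_diag n M \<in> herm_sp n"
  using sp_diag_carrier[of M n]
  by (simp add: herm_sp_def, unfold sp_diag_def symp_R_def uminus_smult, subst transpose_four_block_mat)
    (simp_all add: block_simps)

lemma herm_sp_conj:
  fixes T :: "'a :: field mat"
  assumes Y: "Y \<in> herm_sp n" and c: "T \<in> carrier_mat (2 * n) (2 * n)" "S \<in> carrier_mat (2 * n) (2 * n)"
    and TS: "T * S = 1\<^sub>m (2 * n)" and T: "T\<^sup>T * (symp_R n * T) = symp_R n"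
  shows "T * Y * S \<in> herm_sp n"
proof -
  let ?R = "symp_R n :: 'a mat"
  have Yc: "Y \<in> carrier_mat (2 * n) (2 * n)" "Y\<^sup>T * ?R = ?R * Y" using Y by (auto simp: herm_sp_def)
  have STz: "S\<^sup>T * (T\<^sup>T * z) = z" if "dim_row z = 2 * n" for z
  proof -
    have "S\<^sup>T * T\<^sup>T = 1\<^sub>m (2 * n)" using transpose_mm[of T S] TS c by (simp add: carrier_mat_def)
    then show ?thesis using mm_assoc[of "S\<^sup>T" "T\<^sup>T" z] c that by (simp add: carrier_mat_def)
  qed
  have "T\<^sup>T * ?R = T\<^sup>T * (?R * (T * S))" unfolding TS using c by (simp add: mm_simps)
  also have "\<dots> = (T\<^sup>T * (?R * T)) * S" using c by (simp add: mm_simps)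
  finally have 1: "T\<^sup>T * ?R = ?R * S" unfolding T .
  have 2: "S\<^sup>T * ?R = ?R * T" using STz[of "?R * T"] unfolding T by simp
  have "(T * Y * S)\<^sup>T * ?R = S\<^sup>T * (Y\<^sup>T * (T\<^sup>T * ?R))" using c Yc(1) by (simp add: transpose_mm mm_simps)
  also have "\<dots> = S\<^sup>T * ((Y\<^sup>T * ?R) * S)" unfolding 1 using c Yc(1) by (simp add: mm_simps)
  also have "\<dots> = (S\<^sup>T * ?R) * (Y * S)" unfolding Yc(2) using c Yc(1) by (simp add: mm_simps)
  also have "\<dots> = ?R * (T * Y * S)" unfolding 2 using c Yc(1) by (simp add: mm_simps)
  finally show ?thesis using c Yc(1) by (simp add: herm_sp_def carrier_mat_def)
qed

lemma word_herm_sp_of_word_mat: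
  assumes two: "(2 :: 'a :: field) \<noteq> 0" and X: "(X :: 'a mat) \<in> herm_sp n" "X \<notin> scalar_mats (2 * n)"
  shows "\<exists>A \<in> (carrier_mat n n - scalar_mats n :: 'a mat set). \<forall>m. is_word_value jordan_prod (carrier_mat n n) m A
    \<longrightarrow> is_word_value jordan_prod (herm_sp n) m X"
proof -
  obtain T S A where c: "T \<in> carrier_mat (2 * n) (2 * n)" "S \<in> carrier_mat (2 * n) (2 * n)" "A \<in> carrier_mat n n"
    and TS: "T * S = 1\<^sub>m (2 * n)" "S * T = 1\<^sub>m (2 * n)" and T: "T\<^sup>T * (symp_R n * T) = symp_R n"
    and XA: "X = T * (sp_diag n A * S)"
    using herm_sp_block_form[OF two X(1)] unfolding sp_diag_def by blast
  have XA: "X = T * sp_diag n A * S"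
    unfolding XA using c sp_diag_carrier[OF c(3)] by (simp add: mm_simps)
  have "A \<notin> scalar_mats n"
  proof
    assume "A \<in> scalar_mats n"
    then obtain a where a: "A = a \<cdot>\<^sub>m 1\<^sub>m n" by (auto simp: scalar_mats_def)
    have "sp_diag n A = a \<cdot>\<^sub>m 1\<^sub>m (2 * n)"
      unfolding a sp_diag_def mult_2 by (intro eq_matI) auto
    then have "X = a \<cdot>\<^sub>m 1\<^sub>m (2 * n)" unfolding XA using c TS by (simp add: mm_simps)
    then show False using X(2) by (auto simp: scalar_mats_def)
  qed
  moreover have "is_word_value jordan_prod (herm_sp n) m X" if "is_word_value jordan_prod (carrier_mat n n) m A" for m
    unfolding XA
  proof (rule is_word_value_hom[OF that, where h = "\<lambda>M. T * sp_diag n M * S"])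
    show "T * sp_diag n M * S \<in> herm_sp n" if "M \<in> carrier_mat n n" for M
      using herm_sp_conj[OF sp_diag_herm_sp[OF that] c(1,2) TS(1) T] .
    show "T * sp_diag n (jordan_prod M M') * S = jordan_prod (T * sp_diag n M * S) (T * sp_diag n M' * S)"
      if "M \<in> carrier_mat n n" "M' \<in> carrier_mat n n" for M M'
      using that c TS by (simp add: sp_diag_jordan jordan_prod_conj[OF sp_diag_carrier sp_diag_carrier])
  qed (auto intro: jordan_prod_carrier)
  ultimately show ?thesis using c(3) by blast
qed

lemma word_value_herm_sp_imp:
  assumes "is_word_value jordan_prod (herm_sp n) m (x :: 'a :: field mat)"
  shows "is_word_value jordan_prod (carrier_mat (2 * n) (2 * n)) m x"
proof (rule is_word_value_hom[where h = "\<lambda>x. x", OF assms])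
  show "jordan_prod a b \<in> herm_sp n" if "a \<in> herm_sp n" "b \<in> herm_sp n" for a b :: "'a mat"
    using herm_sp_jordan_prod[OF that] .
  show "a \<in> carrier_mat (2 * n) (2 * n)" if "a \<in> herm_sp n" for a :: "'a mat"
    using that unfolding herm_sp_def by blast
qed simp

lemma zero_one_herm_sp_words:
  assumes "(2 :: 'a :: field) \<noteq> 0" "X \<in> {0\<^sub>m (2 * n) (2 * n), 1\<^sub>m (2 * n) :: 'a mat}"
  shows "is_word_value jordan_prod (herm_sp n) 1 X"
proof (rule is_word_value_idempotent)
  have "0\<^sub>m (2 * n) (2 * n) \<in> (herm_sp n :: 'a mat set)"
    by (simp add: herm_sp_def)
  then have "X \<in> herm_sp n" using assms(2) herm_sp_one by auto
  moreover have "X * X = X" using assms(2) by auto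
  ultimately show "X \<in> idempotents jordan_prod (herm_sp n)"
    using jordan_prod_idempotent[OF assms(1), of X] by (simp add: idempotents_def)
qed

lemma word_values_herm_sp:
  assumes two: "(2 :: 'a :: field) \<noteq> 0"
  shows "word_values jordan_prod (herm_sp n :: 'a mat set)
    = (herm_sp n - scalar_mats (2 * n)) \<union> {0\<^sub>m (2 * n) (2 * n), 1\<^sub>m (2 * n)}"
proof (intro equalityI subsetI)
  fix X :: "'a mat"
  assume "X \<in> word_values jordan_prod (herm_sp n)"
  then obtain m where m: "is_word_value jordan_prod (herm_sp n) m X" by (auto simp: word_values_def)
  have Xh: "X \<in> herm_sp n" using word_value_carrier[OF m] herm_sp_jordan_prod by blast
  show "X \<in> (herm_sp n - scalar_mats (2 * n)) \<union> {0\<^sub>m (2 * n) (2 * n), 1\<^sub>m (2 * n)}"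
  proof (cases "X \<in> scalar_mats (2 * n)")
    case True
    then obtain c where c: "X = c \<cdot>\<^sub>m 1\<^sub>m (2 * n)" by (auto simp: scalar_mats_def)
    show ?thesis
    proof (cases "c = 0 \<or> c = 1 \<or> n = 0")
      case True
      then show ?thesis unfolding c by (auto intro!: eq_matI)
    next
      case False
      \<comment> \<open>The rank bound with rank 0.\<close>
      have "X + (- c) \<cdot>\<^sub>m 1\<^sub>m (2 * n) = 0\<^sub>m (2 * n) 0 * 0\<^sub>m 0 (2 * n)"
        unfolding c by (intro eq_matI) (auto simp: scalar_prod_def)
      then have "rank_at_most 0 (X + (- c) \<cdot>\<^sub>m 1\<^sub>m (2 * n))" by (simp only:, intro rank_at_most_product) auto
      then have "2 * n \<le> 2 ^ (m - 1) * 0"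
        using False word_value_herm_sp_imp[OF m] by (intro word_rank_bound[OF two, of c _ m X]) auto
      then show ?thesis using False by simp
    qed
  qed (use Xh in simp)
next
  fix X :: "'a mat"
  assume X: "X \<in> (herm_sp n - scalar_mats (2 * n)) \<union> {0\<^sub>m (2 * n) (2 * n), 1\<^sub>m (2 * n)}"
  show "X \<in> word_values jordan_prod (herm_sp n)"
  proof (cases "X \<in> {0\<^sub>m (2 * n) (2 * n), 1\<^sub>m (2 * n)}")
    case True
    then show ?thesis using zero_one_herm_sp_words[OF two] by (auto simp: word_values_def)
  next
    case False
    then have X: "X \<in> herm_sp n" "X \<notin> scalar_mats (2 * n)" using X by auto
    then obtain A :: "'a mat" where A: "A \<in> carrier_mat n n - scalar_mats n" and
      w: "\<And>m. is_word_value jordan_prod (carrier_mat n n) m A \<Longrightarrow> is_word_value jordan_prod (herm_sp n) m X"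
      using word_herm_sp_of_word_mat[OF two] by blast
    show ?thesis
      using w[OF word_value_word_length[OF nonscalar_word_value[OF two A]]] unfolding word_values_def by blast
  qed
qed

lemma max_word_length_herm_sp_lower:
  assumes two: "(2 :: 'a :: field) \<noteq> 0" and n: "n \<ge> 2"
  shows "enat (1 + nat \<lceil>log 2 (real n)\<rceil>) \<le> max_word_length jordan_prod (herm_sp n :: 'a mat set)"
proof -
  \<comment> \<open>The matrix \<open>E - 1\<close> with the matrix unit \<open>E\<close>: adding 1 to its symplectic double leaves rank 2. The scalar \<open>- 1\<close> differs from 0 and 1 over every field of characteristic other than 2.\<close>
  let ?u = "unit_col n 0 :: 'a mat"
  define E where "E = ?u * ?u\<^sup>T"
  let ?M = "E + (-1) \<cdot>\<^sub>m 1\<^sub>m n"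
  let ?X = "sp_diag n ?M"
  have Ec: "E \<in> carrier_mat n n" by (simp add: E_def carrier_mat_def)
  have Eij: "E $$ (i, j) = (if i = 0 \<and> j = 0 then 1 else 0)" if "i < n" "j < n" for i j
    unfolding E_def using that by (auto simp: unit_col_def scalar_prod_def)
  have X: "?X \<in> herm_sp n" using Ec by (intro sp_diag_herm_sp) (simp add: carrier_mat_def)
  have "?X \<notin> scalar_mats (2 * n)"
  proof
    assume "?X \<in> scalar_mats (2 * n)"
    then obtain c where c: "?X = c \<cdot>\<^sub>m 1\<^sub>m (2 * n)" by (auto simp: scalar_mats_def)
    have "?X $$ (0, 0) = 0" "?X $$ (1, 1) = -1"
      using n Ec Eij by (auto simp: sp_diag_def carrier_mat_def simp del: index_mult_mat(1))
    moreover have "?X $$ (0, 0) = c" "?X $$ (1, 1) = c" unfolding c using n by auto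
    ultimately show False by simp
  qed
  then have Xw: "?X \<in> word_values jordan_prod (herm_sp n)" using X word_values_herm_sp[OF two] by blast
  define m where "m = word_length jordan_prod (herm_sp n) ?X"
  have w: "is_word_value jordan_prod (carrier_mat (2 * n) (2 * n)) m ?X"
    unfolding m_def using word_value_herm_sp_imp word_value_word_length[OF Xw] by blast
  have ET: "E\<^sup>T = E" using Ec Eij by (intro eq_matI) (auto simp: carrier_mat_def)
  have "?M\<^sup>T = ?M" using Ec ET by (subst transpose_add[of _ n n]) (auto simp: transpose_smult)
  then have "?X + (- (-1)) \<cdot>\<^sub>m 1\<^sub>m (2 * n) = four_block_mat E (0\<^sub>m n n) (0\<^sub>m n n) E"
    unfolding sp_diag_def mult_2 fb_one using Ec
    by (simp add: block_simps del: four_block_one_mat) (intro cong_four_block_mat; intro eq_matI; auto simp: carrier_mat_def)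
  also have "\<dots> = four_block_mat ?u (0\<^sub>m n 1) (0\<^sub>m n 1) ?u * four_block_mat (?u\<^sup>T) (0\<^sub>m 1 n) (0\<^sub>m 1 n) (?u\<^sup>T)"
    unfolding E_def by (simp add: block_simps)
  finally have rk: "rank_at_most (1 + 1) (?X + (- (-1)) \<cdot>\<^sub>m 1\<^sub>m (2 * n))"
    by (simp only:, intro rank_at_most_product) auto
  have "2 * n \<le> 2 ^ (m - 1) * (1 + 1)"
  proof (rule word_rank_bound[OF two _ _ w])
    show "(-1 :: 'a) \<noteq> 1"
    proof
      assume "(-1 :: 'a) = 1"
      then have "(1 :: 'a) + 1 = 0" by (metis add.right_inverse)
      then show False using two by simp
    qed
  qed (simp, rule rk)
  then have "n \<le> 2 ^ (m - 1)" by simp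
  then have "real n \<le> 2 ^ (m - 1)" by (metis of_nat_le_iff of_nat_numeral of_nat_power)
  then have "log 2 (real n) \<le> log 2 (2 ^ (m - 1))" using n by (subst log_le_cancel_iff) simp_all
  then have "log 2 (real n) \<le> real (m - 1)" by (simp add: log_nat_power)
  then have "nat \<lceil>log 2 (real n)\<rceil> \<le> m - 1" by (simp add: ceiling_le_iff nat_le_iff)
  moreover have "1 \<le> m" using is_word_value_pos[OF w] .
  ultimately have "1 + nat \<lceil>log 2 (real n)\<rceil> \<le> m" by linarith
  then have "enat (1 + nat \<lceil>log 2 (real n)\<rceil>) \<le> enat m" by (simp only: enat_ord_simps)
  also have "\<dots> \<le> max_word_length jordan_prod (herm_sp n :: 'a mat set)"
    unfolding max_word_length_def m_def using Xw by (rule SUP_upper)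
  finally show ?thesis .
qed

lemma max_word_length_herm_sp_le:
  assumes two: "(2 :: 'a :: field) \<noteq> 0"
    and bound: "\<And>A. A \<in> carrier_mat n n - scalar_mats n \<Longrightarrow> A \<in> word_values jordan_prod (carrier_mat n n) \<Longrightarrow>
      enat (word_length jordan_prod (carrier_mat n n) (A :: 'a mat)) \<le> b" and one: "1 \<le> b"
  shows "max_word_length jordan_prod (herm_sp n :: 'a mat set) \<le> b"
  unfolding max_word_length_def
proof (rule SUP_least)
  fix X :: "'a mat"
  assume "X \<in> word_values jordan_prod (herm_sp n)"
  then consider "X \<in> {0\<^sub>m (2 * n) (2 * n), 1\<^sub>m (2 * n)}" | "X \<in> herm_sp n" "X \<notin> scalar_mats (2 * n)"
    unfolding word_values_herm_sp[OF two] by blast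
  then show "enat (word_length jordan_prod (herm_sp n) X) \<le> b"
  proof cases
    case 1
    then have "word_length jordan_prod (herm_sp n) X \<le> 1"
      by (intro word_length_le zero_one_herm_sp_words[OF two])
    then have "enat (word_length jordan_prod (herm_sp n) X) \<le> 1" by (simp add: one_enat_def)
    then show ?thesis using one by order
  next
    case 2
    then obtain A :: "'a mat" where A: "A \<in> carrier_mat n n - scalar_mats n" and
      w: "\<And>m. is_word_value jordan_prod (carrier_mat n n) m A \<Longrightarrow> is_word_value jordan_prod (herm_sp n) m X"
      using word_herm_sp_of_word_mat[OF two] by blast
    have Aw: "A \<in> word_values jordan_prod (carrier_mat n n)" using nonscalar_word_value[OF two A] .
    have "word_length jordan_prod (herm_sp n) X \<le> word_length jordan_prod (carrier_mat n n) A"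
      using word_length_le[OF w[OF word_value_word_length[OF Aw]]] .
    then have "enat (word_length jordan_prod (herm_sp n) X) \<le> enat (word_length jordan_prod (carrier_mat n n) A)" by simp
    also have "\<dots> \<le> b" using bound[OF A Aw] .
    finally show ?thesis .
  qed
qed

lemma max_word_length_herm_sp_le_mat:
  assumes two: "(2 :: 'a :: field) \<noteq> 0"
  shows "max_word_length jordan_prod (herm_sp n :: 'a mat set) \<le> max_word_length jordan_prod (carrier_mat n n :: 'a mat set)"
proof (rule max_word_length_herm_sp_le[OF two])
  fix A :: "'a mat"
  assume "A \<in> word_values jordan_prod (carrier_mat n n)"
  then show "enat (word_length jordan_prod (carrier_mat n n) A) \<le> max_word_length jordan_prod (carrier_mat n n :: 'a mat set)"
    unfolding max_word_length_def by (rule SUP_upper)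
next
  let ?z = "0\<^sub>m n n :: 'a mat"
  have w: "is_word_value jordan_prod (carrier_mat n n) 1 ?z" by (rule is_word_value_idem[OF two]) auto
  then have z: "?z \<in> word_values jordan_prod (carrier_mat n n)" by (auto simp: word_values_def)
  have "1 \<le> enat (word_length jordan_prod (carrier_mat n n) ?z)"
    using is_word_value_pos[OF word_value_word_length[OF z]] by (simp add: one_enat_def)
  also have "\<dots> \<le> max_word_length jordan_prod (carrier_mat n n :: 'a mat set)"
    unfolding max_word_length_def using z by (rule SUP_upper)
  finally show "1 \<le> max_word_length jordan_prod (carrier_mat n n :: 'a mat set)" .
qed

lemma max_word_length_herm_sp_upper:
  assumes two: "(2 :: 'a :: field) \<noteq> 0" and n: "n \<ge> 2"
  shows "max_word_length jordan_prod (herm_sp n :: 'a mat set) \<le> enat (4 * nat \<lceil>log 2 (real n)\<rceil> + 10)"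
proof (rule max_word_length_herm_sp_le[OF two])
  fix A :: "'a mat"
  assume A: "A \<in> carrier_mat n n - scalar_mats n"
  let ?j = "nat \<lceil>log 2 (real n)\<rceil>"
  have "real n = 2 powr (log 2 (real n))" using n by simp
  also have "\<dots> \<le> 2 powr (real ?j)" by (rule powr_mono) linarith+
  also have "\<dots> = 2 ^ ?j" by (simp add: powr_realpow)
  finally have "n \<le> 2 ^ ?j" by (metis of_nat_le_iff of_nat_numeral of_nat_power)
  then have "is_word_value jordan_prod (carrier_mat n n) (4 * ?j + 10) A"
    using word_value_nonscalar[OF two] A by blast
  then show "enat (word_length jordan_prod (carrier_mat n n) A) \<le> enat (4 * ?j + 10)"
    using word_length_le by force
qed (simp add: one_enat_def)

theorem theorem6p2:
  assumes "CHAR('a :: field) \<noteq> 2"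
  shows "(\<forall>n::nat. n \<ge> 2 \<longrightarrow>
             word_values jordan_prod (herm_sp n :: 'a mat set)
               = (herm_sp n - scalar_mats (2 * n)) \<union> {0\<^sub>m (2 * n) (2 * n), 1\<^sub>m (2 * n)}
           \<and> enat (1 + nat \<lceil>log 2 (real n)\<rceil>) \<le> max_word_length jordan_prod (herm_sp n :: 'a mat set)
           \<and> max_word_length jordan_prod (herm_sp n :: 'a mat set)
               \<le> max_word_length jordan_prod (carrier_mat n n :: 'a mat set))
       \<and> (\<exists>c C :: real. 0 < c \<and> 0 < C \<and>
           (\<forall>n::nat. n \<ge> 2 \<longrightarrow>
              ereal (c * ln (real n)) \<le> ereal_of_enat (max_word_length jordan_prod (herm_sp n :: 'a mat set))
            \<and> ereal_of_enat (max_word_length jordan_prod (herm_sp n :: 'a mat set)) \<le> ereal (C * ln (real n))))"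
proof -
  have two: "(2 :: 'a) \<noteq> 0" using two_neq_zero[OF assms] .
  have "ereal (1 * ln (real n)) \<le> ereal_of_enat (max_word_length jordan_prod (herm_sp n :: 'a mat set))
      \<and> ereal_of_enat (max_word_length jordan_prod (herm_sp n :: 'a mat set)) \<le> ereal (22 / ln 2 * ln (real n))"
    if n: "n \<ge> 2" for n
  proof
    let ?w = "max_word_length jordan_prod (herm_sp n :: 'a mat set)"
    let ?c = "nat \<lceil>log 2 (real n)\<rceil>"
    have ln2: "0 < ln (2 :: real)" "ln (2 :: real) \<le> 1" using ln_le_minus_one[of "2 :: real"] by auto
    have l1: "1 \<le> log 2 (real n)" using n by (simp add: le_log_iff)
    have "ln (real n) * ln 2 \<le> ln (real n) * 1" using n ln2 by (intro mult_left_mono) auto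
    then have "ln (real n) \<le> log 2 (real n)" using ln2 by (simp add: log_def pos_le_divide_eq)
    also have "\<dots> \<le> real (1 + ?c)" by linarith
    finally have "ereal (1 * ln (real n)) \<le> ereal_of_enat (enat (1 + ?c))" by simp
    also have "\<dots> \<le> ereal_of_enat ?w"
      using max_word_length_herm_sp_lower[OF two n] by (simp only: ereal_of_enat_le_iff)
    finally show "ereal (1 * ln (real n)) \<le> ereal_of_enat ?w" .
    have "ereal_of_enat ?w \<le> ereal_of_enat (enat (4 * ?c + 10))"
      using max_word_length_herm_sp_upper[OF two n] by (simp only: ereal_of_enat_le_iff)
    also have "\<dots> = ereal (4 * real ?c + 10)" by simp
    also have "real ?c \<le> log 2 (real n) + 1" using l1 by linarith
    then have "4 * real ?c + 10 \<le> 22 * log 2 (real n)" using l1 by linarith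
    then have "ereal (4 * real ?c + 10) \<le> ereal (22 / ln 2 * ln (real n))" by (simp add: log_def)
    finally show "ereal_of_enat ?w \<le> ereal (22 / ln 2 * ln (real n))" .
  qed
  then have "\<exists>c C :: real. 0 < c \<and> 0 < C \<and> (\<forall>n::nat. n \<ge> 2 \<longrightarrow>
      ereal (c * ln (real n)) \<le> ereal_of_enat (max_word_length jordan_prod (herm_sp n :: 'a mat set))
    \<and> ereal_of_enat (max_word_length jordan_prod (herm_sp n :: 'a mat set)) \<le> ereal (C * ln (real n)))"
    by (intro exI[of _ 1] exI[of _ "22 / ln 2"]) auto
  then show ?thesis
    using word_values_herm_sp[OF two] max_word_length_herm_sp_lower[OF two] max_word_length_herm_sp_le_mat[OF two] by blast
qed

end
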